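(* The $Z$-polynomials of fan graphs, wheel graphs and whirl matroids are \[ Z_{F_n}(t)=\sum _{k = 0}^{n}\frac{1}{n+1} \binom {n + 1} {k+1}\binom {n + 1} {k} t^k \quad (n\ge 1), \] \[ Z_{W_n}(t)= \sum _{k = 0}^n \left(\binom {n} {k}^2 - \frac {2}{n} \binom {n} {k +1}\binom {n} {k - 1}\right)t^k \quad (n\ge 3), \] \[ Z_{W^n}(t)=\sum _{k = 0}^n \binom {n} {k}^2 t^k \quad (n\ge 3), \] with the convention $\binom{n}{j}=0$ for $j<0$ or $j>n$.
   Context: For a matroid $M$ let $L(M)$ be its lattice of flats, $\mathrm{rk}\, M$ its rank, $\chi_M(t)$ its characteristic polynomial; for a flat $F$, $M_F$ is the localization (restriction to $F$) and $M^F$ the contraction at $F$. The Kazhdan–Lusztig polynomial is the unique assignment of $P_M(t)\in\mathbb{Z}[t]$ to each loopless matroid $M$ with: $P_M=1$ if $\mathrm{rk}\, M=0$; $\deg P_M<\frac12\mathrm{rk}\, M$ if $\mathrm{rk}\, M>0$; $t^{\mathrm{rk}\, M}P_M(t^{-1})=\sum_{F\in L(M)}\chi_{M_F}(t)P_{M^F}(t)$. The $Z$-polynomial of $M$ is $Z_M(t)=\sum_{F\in L(M)}t^{\mathrm{rk}\, M_F}P_{M^F}(t)$; for a graph $G$, $Z_G=Z_{M(G)}$ for its graphic matroid. The fan graph $F_n$ has vertices $0,1,\dots,n$, edges $\{i,i+1\}$ ($1\le i<n$) and $\{0,i\}$ ($1\le i\le n$). The wheel $W_n$ ($n\ge3$)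 has vertices $0,\dots,n$, the edges of the cycle $1,2,\dots,n,1$ (edge set $O_n$) and edges $\{0,i\}$ ($1\le i\le n$). The whirl matroid $W^n$ is the matroid on $E(W_n)$ whose independent sets are the edge sets of forests of $W_n$ together with $O_n$. *)

theory Defs
  imports "HOL-Computational_Algebra.Polynomial"
begin

section \<open>Matroids\<close>

record 'a matroid =
  ground :: "'a set"
  indep :: "'a set \<Rightarrow> bool"

definition is_matroid :: "'a matroid \<Rightarrow> bool" where
  "is_matroid M \<longleftrightarrow>
     finite (ground M) \<and>
     (\<forall>X. indep M X \<longrightarrow> X \<subseteq> ground M) \<and>
     indep M {} \<and>
     (\<forall>X Y. indep M X \<and> Y \<subseteq> X \<longrightarrow> indep M Y) \<and>
     (\<forall>X Y. indep M X \<and> indep M Y \<and> card X < card Y \<longrightarrow>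
        (\<exists>y\<in>Y - X. indep M (insert y X)))"

definition loopless :: "'a matroid \<Rightarrow> bool" where
  "loopless M \<longleftrightarrow> (\<forall>e\<in>ground M. indep M {e})"

definition rank_of :: "'a matroid \<Rightarrow> 'a set \<Rightarrow> nat" where
  "rank_of M A = Max (card ` {X. X \<subseteq> A \<and> indep M X})"

definition rk :: "'a matroid \<Rightarrow> nat" where
  "rk M = rank_of M (ground M)"

definition flats :: "'a matroid \<Rightarrow> 'a set set" where
  "flats M = {F. F \<subseteq> ground M \<and> (\<forall>e\<in>ground M - F. rank_of M (insert e F) > rank_of M F)}"

definition basis_of :: "'a matroid \<Rightarrow> 'a set \<Rightarrow> 'a set \<Rightarrow> bool" where
  "basis_of M A B \<longleftrightarrow> B \<subseteq> A \<and> indep M B \<and> card B = rank_of M A"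

definition localization :: "'a matroid \<Rightarrow> 'a set \<Rightarrow> 'a matroid" where
  "localization M F = \<lparr>ground = F, indep = (\<lambda>X. X \<subseteq> F \<and> indep M X)\<rparr>"

definition contraction :: "'a matroid \<Rightarrow> 'a set \<Rightarrow> 'a matroid" where
  "contraction M F =
     \<lparr>ground = ground M - F,
      indep = (\<lambda>X. X \<subseteq> ground M - F \<and> (\<exists>B. basis_of M F B \<and> indep M (X \<union> B)))\<rparr>"

section \<open>Characteristic polynomial\<close>

text \<open>The Moebius function of a family \<open>L\<close> of finite sets ordered by inclusion.
  Finiteness of \<open>G\<close> is tested only to make the recursion terminate.\<close>

function moebius :: "'a set set \<Rightarrow> 'a set \<Rightarrow> 'a set \<Rightarrow> int" where
  "moebius L F G =
     (if F = G then 1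
      else if F \<subset> G \<and> finite G then - (\<Sum>H\<in>{H\<in>L. F \<subseteq> H \<and> H \<subset> G}. moebius L F H)
      else 0)"
  by pat_completeness auto
termination
  by (relation "measure (\<lambda>(L, F, G). card G)") (auto intro: psubset_card_mono)

declare moebius.simps [simp del]

text \<open>The intersection of all flats is the least flat, i.e. the bottom of the lattice of flats.\<close>

definition char_poly :: "'a matroid \<Rightarrow> int poly" where
  "char_poly M =
     (\<Sum>F\<in>flats M. monom (moebius (flats M) (\<Inter>(flats M)) F) (rk M - rank_of M F))"

section \<open>Kazhdan--Lusztig polynomial and Z-polynomial\<close>

text \<open>For \<open>degree p \<le> r\<close> this is the polynomial \<open>t\<^sup>r p(t\<^sup>-\<^sup>1)\<close>.\<close>

definition reverse_poly :: "nat \<Rightarrow> int poly \<Rightarrow> int poly" where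
  "reverse_poly r p = (\<Sum>i\<le>degree p. monom (coeff p i) (r - i))"

text \<open>Since HOL functions are total, an assignment is required to vanish outside the loopless
  matroids; without this clause it could not be unique. The degree conditions guarantee
  \<open>degree (P M) \<le> rk M\<close>, as needed for \<^const>\<open>reverse_poly\<close>.\<close>

definition kl_assignment :: "('a matroid \<Rightarrow> int poly) \<Rightarrow> bool" where
  "kl_assignment P \<longleftrightarrow>
     (\<forall>M. is_matroid M \<and> loopless M \<longrightarrow>
        (rk M = 0 \<longrightarrow> P M = 1) \<and>
        (rk M > 0 \<longrightarrow> 2 * degree (P M) < rk M) \<and>
        reverse_poly (rk M) (P M) =
          (\<Sum>F\<in>flats M. char_poly (localization M F) * P (contraction M F))) \<and>
     (\<forall>M. \<not> (is_matroid M \<and> loopless M) \<longrightarrow> P M = 0)"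

definition kl_poly :: "'a matroid \<Rightarrow> int poly" where
  "kl_poly = (THE P. kl_assignment P)"

definition Z_poly :: "'a matroid \<Rightarrow> int poly" where
  "Z_poly M = (\<Sum>F\<in>flats M. monom 1 (rk (localization M F)) * kl_poly (contraction M F))"

section \<open>Graphs, fans, wheels and whirls\<close>

text \<open>A simple graph is given by its vertex set and its set of edges, which are two-element
  sets of vertices.\<close>

type_synonym 'v graph = "'v set \<times> 'v set set"

definition is_cycle :: "'v set set \<Rightarrow> 'v list \<Rightarrow> bool" where
  "is_cycle X vs \<longleftrightarrow>
     length vs \<ge> 3 \<and> distinct vs \<and>
     (\<forall>i<length vs. {vs ! i, vs ! (Suc i mod length vs)} \<in> X)"

definition forest :: "'v set set \<Rightarrow> bool" where
  "forest X \<longleftrightarrow> \<not> (\<exists>vs. is_cycle X vs)"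

definition graphic_matroid :: "'v graph \<Rightarrow> 'v set matroid" where
  "graphic_matroid G = \<lparr>ground = snd G, indep = (\<lambda>X. X \<subseteq> snd G \<and> forest X)\<rparr>"

definition Z_graph :: "'v graph \<Rightarrow> int poly" where
  "Z_graph G = Z_poly (graphic_matroid G)"

definition spokes :: "nat \<Rightarrow> nat set set" where
  "spokes n = {{0, i} | i. 1 \<le> i \<and> i \<le> n}"

definition fan_graph :: "nat \<Rightarrow> nat graph" where
  "fan_graph n = ({0..n}, {{i, i + 1} | i. 1 \<le> i \<and> i < n} \<union> spokes n)"

definition rim :: "nat \<Rightarrow> nat set set" where
  "rim n = {{i, i + 1} | i. 1 \<le> i \<and> i < n} \<union> {{n, 1}}"

definition wheel_graph :: "nat \<Rightarrow> nat graph" where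
  "wheel_graph n = ({0..n}, rim n \<union> spokes n)"

definition whirl_matroid :: "nat \<Rightarrow> nat set matroid" where
  "whirl_matroid n =
     \<lparr>ground = snd (wheel_graph n),
      indep = (\<lambda>X. (X \<subseteq> snd (wheel_graph n) \<and> forest X) \<or> X = rim n)\<rparr>"

section \<open>Binomial coefficients with integer lower index\<close>

text \<open>Zero for negative \<open>j\<close>, so that \<open>j = k - 1\<close> with \<open>k = 0\<close> is not
  truncated to \<open>0\<close>.\<close>

definition binom :: "nat \<Rightarrow> int \<Rightarrow> rat" where
  "binom n j = (if j < 0 then 0 else of_nat (n choose nat j))"

end

theory Submission
  imports Defs "HOL-Computational_Algebra.Formal_Power_Series"
begin

text \<open>
  By Moebius inversion, the defining recursion of the Kazhdan--Lusztig polynomials says exactly that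
  all \<open>Z\<close>-polynomials are palindromic. So a function \<open>f\<close> on the flats of \<open>M\<close> with \<open>f(E) = 1\<close> and
  \<open>2 deg f(F) < rk M - rk F\<close> whose sums \<open>\<Sum>\<^bsub>G \<supseteq> F\<^esub> t\<^bsup>rk G - rk F\<^esup> f(G)\<close> are
  palindromic of degree \<open>rk M - rk F\<close> must be \<open>f(F) = P(M\<^sup>F)\<close>; the sum for \<open>F = \<emptyset>\<close> is then \<open>Z\<^sub>M\<close>.

  Flats of fans, wheels and whirls are words over a three-letter alphabet, and the sums over intervals
  of the lattice are computed letter by letter; cutting at the letters of the hub block turns products
  of contractions into products of polynomials. The candidate for the fan \<open>F\<^sub>n\<close> is the Motzkin
  polynomial of index \<open>n - 1\<close>, whose binomial transform is the Narayana polynomial. With \<open>m\<close> the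
  generating function of these Motzkin polynomials, whirls correspond to \<open>X m' / (1 + m)\<close>, which
  leads to the Narayana polynomials of type B, and wheels differ from whirls by
  \<open>t (X m\<^sup>2 + m\<^sup>3) / (1 + m)\<close>.
\<close>

subsection \<open>Rank, contraction and localization\<close>

text \<open>A contraction of a fan is, up to parallel elements, a direct sum of smaller fans, but
  \<open>kl_poly\<close> is attached to each matroid literally. Hence uniqueness is formulated for
  functions on the flats of one fixed matroid, where a candidate may be any formula in the word of a
  flat. Binomial transforms enter because, above a word without hub vertices, each block either
  survives or merges with its predecessor at the price of a factor t. Parameters of composed
  transforms add up; 1 + t is the parameter in the gamma expansions of both kinds of Narayana
  polynomials, and splitting it as t + 1 yields the Motzkin polynomials. The cyclic candidates can
  be read off from a = X Nar, where a = X (1 + a) (1 + t a). Its logarithmic derivative is X a'/a =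
  1 + X a'/(1 + a) + t X a'/(1 + t a): the left side is the type B series, the last term collects
  the flats with a spoke, and the middle term, pulled back along X -> X/(1 - t X), is the whirl
  candidate. For the wheel, the rim replaces the n sets "rim minus one edge" as a flat, which
  accounts for the correction.\<close>

lemma finite_indep_subsets:
  assumes "is_matroid M"
  shows "finite {X. X \<subseteq> A \<and> indep M X}"
proof -
  have "{X. X \<subseteq> A \<and> indep M X} \<subseteq> Pow (ground M)"
    using assms by (auto simp: is_matroid_def)
  then show ?thesis
    using assms by (meson finite_Pow_iff finite_subset is_matroid_def)
qed

lemma indep_finite: "is_matroid M \<Longrightarrow> indep M X \<Longrightarrow> finite X"
  by (auto simp: is_matroid_def intro: finite_subset)

lemma indep_ground: "is_matroid M \<Longrightarrow> indep M X \<Longrightarrow> X \<subseteq> ground M"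
  by (auto simp: is_matroid_def)

lemma indep_subset: "is_matroid M \<Longrightarrow> indep M X \<Longrightarrow> Y \<subseteq> X \<Longrightarrow> indep M Y"
  unfolding is_matroid_def by blast

lemma indep_augment:
  "is_matroid M \<Longrightarrow> indep M X \<Longrightarrow> indep M Y \<Longrightarrow> card X < card Y \<Longrightarrow>
   \<exists>y\<in>Y - X. indep M (insert y X)"
  unfolding is_matroid_def by blast

lemma indep_card_le_rank:
  assumes "is_matroid M" "indep M X" "X \<subseteq> A"
  shows "card X \<le> rank_of M A"
  unfolding rank_of_def
  using assms finite_indep_subsets[OF assms(1), of A] by (intro Max_ge) auto

lemma exists_basis:
  assumes "is_matroid M"
  shows "\<exists>B. basis_of M A B"
proof -
  have "rank_of M A \<in> card ` {X. X \<subseteq> A \<and> indep M X}"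
    unfolding rank_of_def using assms finite_indep_subsets[OF assms, of A]
    by (intro Max_in) (auto simp: is_matroid_def)
  then show ?thesis
    by (auto simp: basis_of_def)
qed

lemma extend_to_basis:
  assumes M: "is_matroid M" and "indep M X" "X \<subseteq> A"
  shows "\<exists>B. basis_of M A B \<and> X \<subseteq> B"
  using assms(2,3)
proof (induction "rank_of M A - card X" arbitrary: X rule: less_induct)
  case less
  obtain Y where Y: "basis_of M A Y"
    using exists_basis[OF M] by blast
  show ?case
  proof (cases "card X < rank_of M A")
    case True
    then obtain y where y: "y \<in> Y - X" "indep M (insert y X)"
      using indep_augment[OF M less.prems(1), of Y] Y by (auto simp: basis_of_def)
    have "card (insert y X) = Suc (card X)"
      using y indep_finite[OF M less.prems(1)] by simp
    moreover have "insert y X \<subseteq> A"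
      using y Y less.prems by (auto simp: basis_of_def)
    ultimately have "\<exists>B. basis_of M A B \<and> insert y X \<subseteq> B"
      using y True by (intro less.hyps) auto
    then show ?thesis by blast
  next
    case False
    then have "card X = rank_of M A"
      using indep_card_le_rank[OF M less.prems] by simp
    then show ?thesis
      using less.prems by (auto simp: basis_of_def)
  qed
qed

lemma extend_to_basisE:
  assumes "is_matroid M" "indep M X" "X \<subseteq> A"
  obtains B where "B \<subseteq> A" "indep M B" "card B = rank_of M A" "X \<subseteq> B"
  using extend_to_basis[OF assms] unfolding basis_of_def by blast

lemma rank_of_indep:
  assumes "is_matroid M" "indep M X"
  shows "rank_of M X = card X"
proof -
  obtain B where "basis_of M X B" "X \<subseteq> B"
    using extend_to_basis[OF assms] by blast
  then show ?thesis
    by (auto simp: basis_of_def dest: subset_antisym)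
qed

lemma rank_of_mono:
  assumes M: "is_matroid M" and "A \<subseteq> A'"
  shows "rank_of M A \<le> rank_of M A'"
proof -
  obtain B where "basis_of M A B"
    using exists_basis[OF M] by blast
  then show ?thesis
    using indep_card_le_rank[OF M, of B A'] assms by (auto simp: basis_of_def)
qed

lemma rank_of_Un_le:
  assumes M: "is_matroid M" and Y: "finite Y"
  shows "rank_of M (A \<union> Y) \<le> rank_of M A + card Y"
proof -
  obtain B where B: "B \<subseteq> A \<union> Y" "indep M B" "card B = rank_of M (A \<union> Y)"
    using exists_basis[OF M, of "A \<union> Y"] by (auto simp: basis_of_def)
  have "card B = card (B \<inter> A) + card (B - A)"
    using indep_finite[OF M B(2)] by (metis card_Int_Diff)
  moreover have "card (B \<inter> A) \<le> rank_of M A"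
    using B indep_subset[OF M B(2)] by (intro indep_card_le_rank[OF M]) auto
  moreover have "card (B - A) \<le> card Y"
    using B Y by (intro card_mono) auto
  ultimately show ?thesis
    using B by simp
qed

lemma rank_of_empty: "is_matroid M \<Longrightarrow> rank_of M {} = 0"
  using rank_of_indep[of M "{}"] by (auto simp: is_matroid_def)

text \<open>Extend a basis B of F to a basis of \<open>insert e G\<close>. If e raised the rank of
  G, that basis would contain e, so \<open>insert e B\<close> would be independent inside
  \<open>insert e F\<close>.\<close>

lemma rank_of_insert_eq_mono:
  assumes M: "is_matroid M" and eq: "rank_of M (insert e F) = rank_of M F" and FG: "F \<subseteq> G"
  shows "rank_of M (insert e G) = rank_of M G"
proof (rule ccontr)
  assume neq: "rank_of M (insert e G) \<noteq> rank_of M G"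
  have gt: "rank_of M G < rank_of M (insert e G)"
    using neq rank_of_mono[OF M, of G "insert e G"] by (simp add: subset_insertI)
  obtain B where B: "B \<subseteq> F" "indep M B" "card B = rank_of M F"
    using exists_basis[OF M, of F] by (auto simp: basis_of_def)
  obtain C where C: "C \<subseteq> insert e G" "indep M C" "card C = rank_of M (insert e G)" "B \<subseteq> C"
    using extend_to_basisE[OF M B(2), of "insert e G"] B(1) FG by blast
  have "\<not> C \<subseteq> G"
    using gt C(3) indep_card_le_rank[OF M C(2), of G] by linarith
  then have e: "e \<in> C" "e \<notin> G"
    using C by auto
  have "insert e B \<subseteq> C" using e C by auto
  then have "indep M (insert e B)"
    by (rule indep_subset[OF M C(2)])
  moreover have "e \<notin> B" using e B FG by auto
  ultimately have "rank_of M (insert e F) \<ge> Suc (rank_of M F)"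
    using indep_card_le_rank[OF M, of "insert e B" "insert e F"] B indep_finite[OF M B(2)] by auto
  then show False using eq by simp
qed

lemma rank_of_gain_mono:
  assumes M: "is_matroid M" and "rank_of M (insert e G) > rank_of M G" "F \<subseteq> G"
  shows "rank_of M (insert e F) > rank_of M F"
  using rank_of_insert_eq_mono[OF M _ assms(3), of e] assms(2) rank_of_mono[OF M, of F "insert e F"]
  by fastforce

lemma rank_of_flat_less:
  assumes M: "is_matroid M" and "F \<in> flats M" "F \<subset> G" "G \<subseteq> ground M"
  shows "rank_of M F < rank_of M G"
proof -
  obtain e where e: "e \<in> G" "e \<notin> F" using assms by auto
  then have "rank_of M F < rank_of M (insert e F)"
    using assms by (auto simp: flats_def)
  also have "\<dots> \<le> rank_of M G"
    using e assms by (intro rank_of_mono[OF M]) auto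
  finally show ?thesis .
qed

lemma finite_flats: "is_matroid M \<Longrightarrow> finite (flats M)"
  by (rule finite_subset[of _ "Pow (ground M)"]) (auto simp: flats_def is_matroid_def)

lemma ground_in_flats: "ground M \<in> flats M"
  by (auto simp: flats_def)

lemma loopless_empty_flat:
  assumes "is_matroid M" "loopless M"
  shows "{} \<in> flats M"
proof -
  have "rank_of M {e} = 1" if "e \<in> ground M" for e
    using that assms rank_of_indep[of M "{e}"] by (auto simp: loopless_def)
  then show ?thesis
    using rank_of_empty[OF assms(1)] by (auto simp: flats_def)
qed

section \<open>Contractions, described through the rank function\<close>

lemma is_matroid_contraction:
  assumes M: "is_matroid M"
  shows "is_matroid (contraction M F)"
proof -
  obtain B where B: "basis_of M F B"
    using exists_basis[OF M] by blast
  \<comment> \<open>The definition of \<open>contraction\<close> lets the basis of F depend on X. A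
    basis of \<open>X \<union> F\<close> extending B2 has at least card X elements outside F, hence
    contains X; so any basis of F will do, and the axioms follow from those of M for the sets
    \<open>X \<union> B\<close>.\<close>
  have swap: "indep M (X \<union> B2)"
    if B1: "basis_of M F B1" and B2: "basis_of M F B2" and X: "X \<inter> F = {}" "indep M (X \<union> B1)" for X B1 B2
  proof -
    have fin: "finite X" "finite B1" "finite B2" "X \<inter> B1 = {}"
      using indep_finite[OF M] X B1 B2 by (auto simp: basis_of_def)
    obtain C where C: "C \<subseteq> X \<union> F" "indep M C" "card C = rank_of M (X \<union> F)" "B2 \<subseteq> C"
      using extend_to_basisE[OF M, of B2 "X \<union> F"] B2 unfolding basis_of_def by blast
    have "card X + card B1 = card (X \<union> B1)"
      using fin by (simp add: card_Un_disjoint)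
    also have "\<dots> \<le> card C"
      unfolding C using X B1 by (intro indep_card_le_rank[OF M]) (auto simp: basis_of_def)
    finally have le: "card X + card B1 \<le> card C" .
    have finC: "finite C" using indep_finite[OF M C(2)] .
    have "card (C \<inter> F) \<le> rank_of M F"
      using indep_subset[OF M C(2)] by (intro indep_card_le_rank[OF M]) auto
    then have i: "card (C \<inter> F) \<le> card B1"
      using B1 by (simp add: basis_of_def)
    have "card (C - F) \<ge> card X"
      using le i card_Int_Diff[OF finC, of F] by linarith
    moreover have "C - F \<subseteq> X" using C by auto
    ultimately have "C - F = X"
      using fin by (metis card_seteq)
    then have "X \<union> B2 \<subseteq> C" using C by auto
    then show ?thesis
      using indep_subset[OF M C(2)] by blast
  qed
  have iff: "indep (contraction M F) X \<longleftrightarrow> X \<subseteq> ground M - F \<and> indep M (X \<union> B)" for X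
    using swap[OF _ B, of _ X] B unfolding contraction_def by auto
  have disj: "X \<inter> B = {}" if "X \<subseteq> ground M - F" for X
    using that B by (auto simp: basis_of_def)
  have finB: "finite B" using B indep_finite[OF M] by (auto simp: basis_of_def)
  have aug: "\<exists>y\<in>Y - X. indep (contraction M F) (insert y X)"
    if XY: "indep (contraction M F) X" "indep (contraction M F) Y" "card X < card Y" for X Y
  proof -
    have "finite X" "finite Y"
      using XY iff M by (auto simp: is_matroid_def intro: finite_subset)
    then have "card (X \<union> B) < card (Y \<union> B)"
      using XY iff disj finB by (simp add: card_Un_disjoint)
    then obtain y where "y \<in> (Y \<union> B) - (X \<union> B)" "indep M (insert y (X \<union> B))"
      using indep_augment[OF M] XY iff by blast
    then show ?thesis
      using XY iff by auto
  qed
  have sub: "indep (contraction M F) Y" if "indep (contraction M F) X" "Y \<subseteq> X" for X Y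
    using that iff indep_subset[OF M, of "X \<union> B" "Y \<union> B"] by blast
  have emp: "indep (contraction M F) {}"
    using iff B by (simp add: basis_of_def)
  have gr: "ground (contraction M F) = ground M - F"
    by (simp add: contraction_def)
  show ?thesis
    unfolding is_matroid_def gr
  proof (intro conjI allI impI)
    show "finite (ground M - F)" using M by (simp add: is_matroid_def)
    show "X \<subseteq> ground M - F" if "indep (contraction M F) X" for X
      using that iff by blast
    show "indep (contraction M F) {}" by (rule emp)
    show "indep (contraction M F) Y" if "indep (contraction M F) X \<and> Y \<subseteq> X" for X Y
      using that sub by blast
    show "\<exists>y\<in>Y - X. indep (contraction M F) (insert y X)"
      if "indep (contraction M F) X \<and> indep (contraction M F) Y \<and> card X < card Y" for X Y
      using that aug by blast
  qed
qed

lemma ground_contraction [simp]: "ground (contraction M F) = ground M - F"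
  by (simp add: contraction_def)

lemma ground_localization [simp]: "ground (localization M F) = F"
  by (simp add: localization_def)

text \<open>This form mentions no basis of F and turns statements about contractions into equations
  between ranks in M. For the converse, a basis of \<open>X \<union> F\<close> extending one of F
  must contain all of X, by counting.\<close>

lemma indep_contraction_iff:
  assumes M: "is_matroid M"
  shows "indep (contraction M F) X \<longleftrightarrow>
         X \<subseteq> ground M - F \<and> rank_of M (X \<union> F) = card X + rank_of M F"
proof (cases "X \<subseteq> ground M - F")
  case X: True
  have finX: "finite X" using X M by (auto simp: is_matroid_def intro: finite_subset)
  show ?thesis
  proof
    assume "indep (contraction M F) X"
    then obtain B where B: "B \<subseteq> F" "indep M B" "card B = rank_of M F" "indep M (X \<union> B)"
      by (auto simp: contraction_def basis_of_def)
    have "card X + card B = card (X \<union> B)"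
      using finX B X indep_finite[OF M B(2)] by (subst card_Un_disjoint) auto
    also have "\<dots> \<le> rank_of M (X \<union> F)"
      using B by (intro indep_card_le_rank[OF M]) auto
    finally show "X \<subseteq> ground M - F \<and> rank_of M (X \<union> F) = card X + rank_of M F"
      using B X rank_of_Un_le[OF M finX, of F] by (simp add: Un_commute)
  next
    assume r: "X \<subseteq> ground M - F \<and> rank_of M (X \<union> F) = card X + rank_of M F"
    obtain B where B: "basis_of M F B" using exists_basis[OF M] by blast
    obtain C where C: "C \<subseteq> X \<union> F" "indep M C" "card C = rank_of M (X \<union> F)" "B \<subseteq> C"
      using extend_to_basisE[OF M, of B "X \<union> F"] B unfolding basis_of_def by blast
    have finC: "finite C" using indep_finite[OF M C(2)] .
    have "card (C \<inter> F) \<le> rank_of M F"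
      using indep_subset[OF M C(2)] by (intro indep_card_le_rank[OF M]) auto
    then have "card (C - F) \<ge> card X"
      using r C(3) card_Int_Diff[OF finC, of F] by linarith
    moreover have "C - F \<subseteq> X" using C by auto
    ultimately have "C - F = X"
      using finX by (metis card_seteq)
    then have "X \<union> B \<subseteq> C" using C by auto
    then have "indep M (X \<union> B)"
      using indep_subset[OF M C(2)] by blast
    then show "indep (contraction M F) X"
      using B X by (auto simp: contraction_def)
  qed
qed (simp add: contraction_def)

lemma rank_of_contraction:
  assumes M: "is_matroid M" and A: "A \<subseteq> ground M - F"
  shows "rank_of (contraction M F) A + rank_of M F = rank_of M (A \<union> F)"
proof (rule antisym)
  note M' = is_matroid_contraction[OF M, of F]
  obtain X where "X \<subseteq> A" "indep (contraction M F) X" "card X = rank_of (contraction M F) A"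
    using exists_basis[OF M'] by (auto simp: basis_of_def)
  then show "rank_of (contraction M F) A + rank_of M F \<le> rank_of M (A \<union> F)"
    using indep_contraction_iff[OF M, of F X] rank_of_mono[OF M, of "X \<union> F" "A \<union> F"] by auto
  obtain B where B: "basis_of M F B" using exists_basis[OF M] by blast
  obtain C where C: "C \<subseteq> A \<union> F" "indep M C" "card C = rank_of M (A \<union> F)" "B \<subseteq> C"
    using extend_to_basisE[OF M, of B "A \<union> F"] B unfolding basis_of_def by blast
  have finC: "finite C" using indep_finite[OF M C(2)] .
  have "card (C \<inter> F) \<le> rank_of M F"
    using indep_subset[OF M C(2)] by (intro indep_card_le_rank[OF M]) auto
  moreover have "(C - F) \<union> B \<subseteq> C" using C by auto
  then have "indep M ((C - F) \<union> B)"
    using indep_subset[OF M C(2)] by blast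
  then have "indep (contraction M F) (C - F)"
    using B C A by (auto simp: contraction_def)
  then have "card (C - F) \<le> rank_of (contraction M F) A"
    using C by (intro indep_card_le_rank[OF M']) auto
  ultimately show "rank_of M (A \<union> F) \<le> rank_of (contraction M F) A + rank_of M F"
    using C(3) card_Int_Diff[OF finC, of F] by linarith
qed

lemma rk_contraction:
  assumes M: "is_matroid M" and "F \<subseteq> ground M"
  shows "rk (contraction M F) = rk M - rank_of M F"
proof -
  have "ground M - F \<union> F = ground M" using assms by auto
  then show ?thesis
    using rank_of_contraction[OF M, of "ground M - F" F] by (simp add: rk_def)
qed

text \<open>Ranks in the contraction are those of M with F adjoined, shifted by a constant, so the
  rank jumps that define flats are the same.\<close>

lemma flats_contraction:
  assumes M: "is_matroid M" and F: "F \<subseteq> ground M"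
  shows "flats (contraction M F) = (\<lambda>G. G - F) ` {G \<in> flats M. F \<subseteq> G}"
proof -
  have *: "H \<in> flats (contraction M F) \<longleftrightarrow> H \<union> F \<in> flats M" if H: "H \<subseteq> ground M - F" for H
  proof -
    have "rank_of (contraction M F) H < rank_of (contraction M F) (insert e H) \<longleftrightarrow>
          rank_of M (H \<union> F) < rank_of M (insert e (H \<union> F))" if "e \<in> ground M - F - H" for e
      using rank_of_contraction[OF M, of H F] rank_of_contraction[OF M, of "insert e H" F] H that
      by auto
    moreover have "ground M - F - H = ground M - (H \<union> F)" by auto
    ultimately show ?thesis
      using H F by (auto simp: flats_def)
  qed
  show ?thesis
  proof (intro equalityI subsetI)
    fix H assume H: "H \<in> flats (contraction M F)"
    then have H': "H \<subseteq> ground M - F" by (auto simp: flats_def)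
    then have "H = H \<union> F - F" by auto
    then show "H \<in> (\<lambda>G. G - F) ` {G \<in> flats M. F \<subseteq> G}"
      using H *[OF H'] by blast
  next
    fix H assume "H \<in> (\<lambda>G. G - F) ` {G \<in> flats M. F \<subseteq> G}"
    then obtain G where G: "H = G - F" "G \<in> flats M" "F \<subseteq> G" by auto
    then have "H \<subseteq> ground M - F" "H \<union> F = G" by (auto simp: flats_def)
    then show "H \<in> flats (contraction M F)" using * G by auto
  qed
qed

text \<open>An assignment of polynomials is a function on matroids, so iterated contractions have to
  agree as records; an isomorphism would not permit rewriting under \<open>P\<close>.\<close>

lemma contraction_contraction:
  assumes M: "is_matroid M" and FG: "F \<subseteq> G" "G \<subseteq> ground M"
  shows "contraction (contraction M F) (G - F) = contraction M G"
proof -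
  note M' = is_matroid_contraction[OF M, of F]
  have "indep (contraction (contraction M F) (G - F)) X \<longleftrightarrow> indep (contraction M G) X" for X
  proof (cases "X \<subseteq> ground M - G")
    case X: True
    have eq: "X \<union> (G - F) \<union> F = X \<union> G" "G - F \<union> F = G" using FG by auto
    show ?thesis
    proof -
      have "X \<union> (G - F) \<subseteq> ground M - F" "G - F \<subseteq> ground M - F" "X \<subseteq> ground M - F - (G - F)"
        using X FG by auto
      then show ?thesis
        unfolding indep_contraction_iff[OF M'] indep_contraction_iff[OF M, of G]
        using X rank_of_contraction[OF M, of "X \<union> (G - F)" F] rank_of_contraction[OF M, of "G - F" F]
        unfolding eq by auto
    qed
  next
    case False
    then show ?thesis
      unfolding indep_contraction_iff[OF M'] indep_contraction_iff[OF M, of G] using FG by auto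
  qed
  moreover have "ground (contraction (contraction M F) (G - F)) = ground (contraction M G)"
    using FG by auto
  ultimately show ?thesis
    by (intro matroid.equality) auto
qed

lemma contraction_empty:
  assumes M: "is_matroid M"
  shows "contraction M {} = M"
proof (rule matroid.equality)
  show "indep (contraction M {}) = indep M"
  proof
    fix X show "indep (contraction M {}) X = indep M X"
      using indep_ground[OF M, of X] rank_of_empty[OF M] M
      by (auto simp: contraction_def basis_of_def is_matroid_def)
  qed
qed auto

lemma loopless_contraction:
  assumes M: "is_matroid M" and F: "F \<in> flats M"
  shows "loopless (contraction M F)"
proof -
  have "rank_of M (insert e F) = 1 + rank_of M F" if "e \<in> ground M - F" for e
  proof -
    have "rank_of M F < rank_of M (insert e F)" using that F by (auto simp: flats_def)
    then show ?thesis using rank_of_Un_le[OF M, of "{e}" F] by auto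
  qed
  then show ?thesis
    by (auto simp: loopless_def indep_contraction_iff[OF M])
qed

lemma rank_of_localization:
  assumes "A \<subseteq> F"
  shows "rank_of (localization M F) A = rank_of M A"
proof -
  have "{X. X \<subseteq> A \<and> indep (localization M F) X} = {X. X \<subseteq> A \<and> indep M X}"
    using assms by (auto simp: localization_def)
  then show ?thesis by (simp add: rank_of_def)
qed

lemma rk_localization [simp]: "rk (localization M F) = rank_of M F"
  by (simp add: rk_def rank_of_localization)

text \<open>For e outside G the rank condition on F is inherited from G by
  \<open>rank_of_gain_mono\<close>; only the elements of G - F remain to be tested.\<close>

lemma flats_localization:
  assumes M: "is_matroid M" and G: "G \<in> flats M"
  shows "flats (localization M G) = {F \<in> flats M. F \<subseteq> G}"
proof -
  have "F \<in> flats (localization M G) \<longleftrightarrow> F \<in> flats M" if F: "F \<subseteq> G" for F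
  proof -
    have "rank_of M (insert e F) > rank_of M F" if "e \<in> ground M - G" for e
      using rank_of_gain_mono[OF M _ F, of e] G that by (auto simp: flats_def)
    then have "F \<in> flats M \<longleftrightarrow> (\<forall>e\<in>G - F. rank_of M (insert e F) > rank_of M F)"
      using F G by (fastforce simp: flats_def)
    moreover have "F \<in> flats (localization M G) \<longleftrightarrow>
        (\<forall>e\<in>G - F. rank_of M (insert e F) > rank_of M F)"
      using F by (auto simp: flats_def rank_of_localization)
    ultimately show ?thesis by simp
  qed
  moreover have "F \<in> flats (localization M G) \<Longrightarrow> F \<subseteq> G" for F
    by (simp add: flats_def)
  ultimately show ?thesis by blast
qed

subsection \<open>Palindromic polynomials and the characterization of Kazhdan--Lusztig polynomials\<close>

text \<open>The bound on the degree belongs to the notion, since the coefficient condition only sees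
  indices up to r.\<close>

definition palindromic :: "nat \<Rightarrow> int poly \<Rightarrow> bool" where
  "palindromic r p \<longleftrightarrow> degree p \<le> r \<and> (\<forall>i\<le>r. coeff p (r - i) = coeff p i)"

lemma coeff_reverse_poly:
  assumes "degree p \<le> r"
  shows "coeff (reverse_poly r p) i = (if i \<le> r then coeff p (r - i) else 0)"
proof -
  have "coeff (reverse_poly r p) i = (\<Sum>j\<le>degree p. if r - j = i then coeff p j else 0)"
    by (simp add: reverse_poly_def coeff_sum)
  also have "\<dots> = (\<Sum>j\<le>degree p. if j = r - i then (if i \<le> r then coeff p j else 0) else 0)"
    using assms by (intro sum.cong) auto
  also have "\<dots> = (if r - i \<le> degree p \<and> i \<le> r then coeff p (r - i) else 0)"
    by (simp add: sum.delta)
  finally show ?thesis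
    using coeff_eq_0[of p "r - i"] by auto
qed

lemma palindromic_iff_reverse:
  assumes "degree p \<le> r"
  shows "palindromic r p \<longleftrightarrow> reverse_poly r p = p"
proof
  assume "palindromic r p"
  then show "reverse_poly r p = p"
    using assms coeff_eq_0[of p] by (intro poly_eqI) (auto simp: palindromic_def coeff_reverse_poly)
next
  assume "reverse_poly r p = p"
  then show "palindromic r p"
    using assms coeff_reverse_poly[OF assms] unfolding palindromic_def by metis
qed

lemma reverse_poly_sum:
  assumes "\<And>x. x \<in> A \<Longrightarrow> degree (f x) \<le> r"
  shows "reverse_poly r (\<Sum>x\<in>A. f x) = (\<Sum>x\<in>A. reverse_poly r (f x))"
proof -
  have "degree (\<Sum>x\<in>A. f x) \<le> r"
    using assms by (cases "finite A") (auto intro: degree_sum_le)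
  then show ?thesis
    using assms by (intro poly_eqI) (simp add: coeff_reverse_poly coeff_sum)
qed

lemma degree_monom_mult_le: "degree (monom (1::int) k * p) \<le> k + degree p"
  using degree_mult_le[of "monom (1::int) k" p] degree_monom_le[of "1::int" k] by linarith

text \<open>Reversal absorbs the rank shift: the reversed terms of an upper Z-sum no longer depend
  on its lower flat, which is what Moebius inversion requires.\<close>

lemma reverse_poly_shift:
  assumes "degree p + k \<le> r"
  shows "reverse_poly r (monom 1 k * p) = reverse_poly (r - k) p"
proof -
  have "degree (monom 1 k * p) \<le> r"
    using degree_monom_mult_le[of k p] assms by linarith
  then show ?thesis
    using assms
  proof (intro poly_eqI)
    fix i
    have "r - i - k = r - k - i" by simp
    then show "coeff (reverse_poly r (monom 1 k * p)) i = coeff (reverse_poly (r - k) p) i"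
      using assms \<open>degree (monom 1 k * p) \<le> r\<close> coeff_eq_0[of p "r - i - k"]
      by (auto simp: coeff_reverse_poly coeff_monom_mult)
  qed
qed

lemma smult_sum_right: "smult c (\<Sum>x\<in>A. f x) = (\<Sum>x\<in>A. smult c (f x))"
  by (induction A rule: infinite_finite_induct) (auto simp: smult_add_right)

lemma palindromic_diff: "palindromic r p \<Longrightarrow> palindromic r q \<Longrightarrow> palindromic r (p - q)"
  by (auto simp: palindromic_def intro: degree_diff_le)

lemma palindromic_add: "palindromic r p \<Longrightarrow> palindromic r q \<Longrightarrow> palindromic r (p + q)"
  by (auto simp: palindromic_def intro: degree_add_le)

text \<open>The leading coefficient, in degree d < r/2, would have to reappear in degree r - d > d.
  This is the source of uniqueness.\<close>

lemma palindromic_small_degree: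
  assumes "palindromic r p" "2 * degree p < r"
  shows "p = 0"
proof (rule ccontr)
  assume "p \<noteq> 0"
  moreover have "coeff p (r - degree p) = coeff p (degree p)"
    using assms by (simp add: palindromic_def)
  moreover have "coeff p (r - degree p) = 0"
    using assms(2) by (intro coeff_eq_0) simp
  ultimately show False by simp
qed

lemma palindromic_mult:
  assumes "palindromic r p" "palindromic s q"
  shows "palindromic (r + s) (p * q)"
proof -
  have dp: "degree p \<le> r" and dq: "degree q \<le> s"
    using assms by (auto simp: palindromic_def)
  have deg: "degree (p * q) \<le> r + s"
    using degree_mult_le[of p q] dp dq by linarith
  have "coeff (p * q) (r + s - i) = coeff (p * q) i" if i: "i \<le> r + s" for i
  proof -
    \<comment> \<open>The indices of the convolution are confined to a box on which (j, k) -> (r -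
      j, s - k) is an involution; outside the box one of the factors vanishes.\<close>
    define A where "A n = {jk. fst jk \<le> r \<and> snd jk \<le> s \<and> fst jk + snd jk = n}" for n :: nat
    have *: "coeff (p * q) n = (\<Sum>(j, k)\<in>A n. coeff p j * coeff q k)" for n
    proof -
      have "coeff (p * q) n = (\<Sum>(j, k)\<in>{jk. fst jk + snd jk = n}. coeff p j * coeff q k)"
        unfolding coeff_mult
        by (rule sum.reindex_bij_witness[of _ fst "\<lambda>j. (j, n - j)"]) auto
      also have "\<dots> = (\<Sum>(j, k)\<in>A n. coeff p j * coeff q k)"
      proof (rule sum.mono_neutral_right)
        have "{jk. fst jk + snd jk = n} \<subseteq> {..n} \<times> {..n}" by auto
        then show "finite {jk. fst jk + snd jk = n}"
          by (rule finite_subset) simp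
        show "A n \<subseteq> {jk. fst jk + snd jk = n}" by (auto simp: A_def)
        show "\<forall>i\<in>{jk. fst jk + snd jk = n} - A n. (case i of (j, k) \<Rightarrow> coeff p j * coeff q k) = 0"
        proof
          fix x assume "x \<in> {jk. fst jk + snd jk = n} - A n"
          then have "fst x > degree p \<or> snd x > degree q"
            using dp dq by (auto simp: A_def)
          then show "(case x of (j, k) \<Rightarrow> coeff p j * coeff q k) = 0"
            by (cases x) (auto simp: coeff_eq_0)
        qed
      qed
      finally show ?thesis .
    qed
    show ?thesis
      unfolding *
      by (rule sum.reindex_bij_witness[of _ "\<lambda>(j, k). (r - j, s - k)" "\<lambda>(j, k). (r - j, s - k)"])
         (use i assms in \<open>auto simp: A_def palindromic_def\<close>)
  qed
  then show ?thesis using deg by (simp add: palindromic_def)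
qed

section \<open>Moebius inversion on the lattice of flats\<close>

lemma moebius_refl [simp]: "moebius L F F = 1"
  by (simp add: moebius.simps)

lemma moebius_sum:
  assumes "finite G" "F \<subseteq> G" "F \<in> L" "G \<in> L"
  shows "(\<Sum>H\<in>{H\<in>L. F \<subseteq> H \<and> H \<subseteq> G}. moebius L F H) = (if F = G then 1 else 0)"
proof (cases "F = G")
  case True
  then have "{H\<in>L. F \<subseteq> H \<and> H \<subseteq> G} = {G}" using assms by auto
  then show ?thesis using True by simp
next
  case False
  have eq: "{H\<in>L. F \<subseteq> H \<and> H \<subseteq> G} = insert G {H\<in>L. F \<subseteq> H \<and> H \<subset> G}"
    using assms by auto
  have "finite {H\<in>L. F \<subseteq> H \<and> H \<subset> G}"
    by (rule finite_subset[of _ "Pow G"]) (use assms in auto)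
  then have "(\<Sum>H\<in>{H\<in>L. F \<subseteq> H \<and> H \<subseteq> G}. moebius L F H) =
      moebius L F G + (\<Sum>H\<in>{H\<in>L. F \<subseteq> H \<and> H \<subset> G}. moebius L F H)"
    unfolding eq by (subst sum.insert) auto
  also have "\<dots> = 0"
    using False assms by (subst moebius.simps) auto
  finally show ?thesis using False by simp
qed

text \<open>The recursion for the value at G only visits members of the family below G; hence a
  localization has the Moebius function of the whole lattice.\<close>

lemma moebius_cong:
  assumes "\<And>H. H \<subseteq> G \<Longrightarrow> H \<in> L \<longleftrightarrow> H \<in> L'" "finite G"
  shows "moebius L F G = moebius L' F G"
  using assms(2,1)
proof (induction G rule: finite_psubset_induct)
  case (psubset G)
  have eq: "{H\<in>L. F \<subseteq> H \<and> H \<subset> G} = {H\<in>L'. F \<subseteq> H \<and> H \<subset> G}"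
    using psubset.prems by auto
  have "(\<Sum>H\<in>{H\<in>L. F \<subseteq> H \<and> H \<subset> G}. moebius L F H) =
        (\<Sum>H\<in>{H\<in>L'. F \<subseteq> H \<and> H \<subset> G}. moebius L' F H)"
    unfolding eq
  proof (rule sum.cong[OF refl])
    fix H assume "H \<in> {H\<in>L'. F \<subseteq> H \<and> H \<subset> G}"
    then have "H \<subset> G" by simp
    then show "moebius L F H = moebius L' F H"
      using psubset.prems by (intro psubset.IH) auto
  qed
  then show ?case
    by (subst (1 2) moebius.simps) simp
qed

lemma char_poly_localization:
  assumes M: "is_matroid M" "loopless M" and G: "G \<in> flats M"
  shows "char_poly (localization M G) =
    (\<Sum>F\<in>{F\<in>flats M. F \<subseteq> G}. monom (moebius (flats M) {} F) (rank_of M G - rank_of M F))"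
proof -
  have bot: "\<Inter>{F \<in> flats M. F \<subseteq> G} = {}"
    using loopless_empty_flat[OF M] by auto
  have "finite F" if "F \<in> flats M" for F
    using that M(1) by (auto simp: flats_def is_matroid_def intro: finite_subset)
  then have "moebius {F \<in> flats M. F \<subseteq> G} {} F = moebius (flats M) {} F" if "F \<in> flats M" "F \<subseteq> G" for F
    using that by (intro moebius_cong) auto
  then show ?thesis
    unfolding char_poly_def flats_localization[OF M(1) G] bot
    by (intro sum.cong) (auto simp: rank_of_localization)
qed

text \<open>If \<open>p G\<close> is the polynomial of the contraction at G, this is the
  Z-polynomial of the contraction at F, written with the flats and ranks of M itself.\<close>

definition upper_Z :: "'a matroid \<Rightarrow> ('a set \<Rightarrow> int poly) \<Rightarrow> 'a set \<Rightarrow> int poly" where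
  "upper_Z M p F = (\<Sum>G\<in>{G\<in>flats M. F \<subseteq> G}. monom 1 (rank_of M G - rank_of M F) * p G)"

text \<open>Each characteristic polynomial expands over the flats below G; exchanging the summations
  leaves upper Z-sums weighted with Moebius values.\<close>

lemma char_poly_sum:
  assumes M: "is_matroid M" "loopless M"
  shows "(\<Sum>G\<in>flats M. char_poly (localization M G) * p G) =
         (\<Sum>H\<in>flats M. smult (moebius (flats M) {} H) (upper_Z M p H))"
proof -
  let ?L = "flats M"
  have fin: "finite ?L" by (rule finite_flats[OF M(1)])
  have "(\<Sum>G\<in>?L. char_poly (localization M G) * p G) =
     (\<Sum>G\<in>?L. \<Sum>H\<in>{H\<in>?L. H \<subseteq> G}. monom (moebius ?L {} H) (rank_of M G - rank_of M H) * p G)"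
    by (intro sum.cong refl) (simp add: char_poly_localization[OF M] sum_distrib_right)
  also have "\<dots> = (\<Sum>H\<in>?L. \<Sum>G\<in>{G\<in>?L. H \<subseteq> G}. monom (moebius ?L {} H) (rank_of M G - rank_of M H) * p G)"
    by (rule sum.swap_restrict[OF fin fin])
  also have "\<dots> = (\<Sum>H\<in>?L. smult (moebius ?L {} H) (upper_Z M p H))"
    unfolding upper_Z_def smult_sum_right
    by (intro sum.cong refl) (simp flip: mult_smult_left add: smult_monom)
  finally show ?thesis .
qed

text \<open>After exchanging the summations, the Moebius values of all H below G add up to 0 unless
  G is the bottom flat.\<close>

lemma moebius_inversion_bottom:
  fixes q :: "'a set \<Rightarrow> int poly"
  assumes M: "is_matroid M" "loopless M"
  shows "(\<Sum>H\<in>flats M. smult (moebius (flats M) {} H) (\<Sum>G\<in>{G\<in>flats M. H \<subseteq> G}. q G)) = q {}"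
proof -
  let ?L = "flats M"
  have fin: "finite ?L" by (rule finite_flats[OF M(1)])
  have finG: "finite G" if "G \<in> ?L" for G
    using that M(1) by (auto simp: flats_def is_matroid_def intro: finite_subset)
  note e = loopless_empty_flat[OF M]
  have "(\<Sum>H\<in>?L. smult (moebius ?L {} H) (\<Sum>G\<in>{G\<in>?L. H \<subseteq> G}. q G)) =
        (\<Sum>H\<in>?L. \<Sum>G\<in>{G\<in>?L. H \<subseteq> G}. smult (moebius ?L {} H) (q G))"
    by (simp add: smult_sum_right)
  also have "\<dots> = (\<Sum>G\<in>?L. \<Sum>H\<in>{H\<in>?L. H \<subseteq> G}. smult (moebius ?L {} H) (q G))"
    by (rule sum.swap_restrict[OF fin fin])
  also have "\<dots> = (\<Sum>G\<in>?L. smult (\<Sum>H\<in>{H\<in>?L. {} \<subseteq> H \<and> H \<subseteq> G}. moebius ?L {} H) (q G))"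
    by (simp add: smult_sum)
  also have "\<dots> = (\<Sum>G\<in>?L. if G = {} then q G else 0)"
    using finG e by (intro sum.cong refl) (subst moebius_sum, auto)
  also have "\<dots> = q {}"
    using fin e by simp
  finally show ?thesis .
qed

text \<open>Moebius inversion from the bottom of the lattice turns the defining recursion of the
  Kazhdan--Lusztig polynomial into the palindromicity of the \<open>Z\<close>-polynomial.\<close>

lemma kl_equation_iff_palindromic:
  assumes M: "is_matroid M" "loopless M"
    and deg: "\<And>G. G \<in> flats M \<Longrightarrow> degree (p G) \<le> rk M - rank_of M G"
    and pal: "\<And>H. H \<in> flats M \<Longrightarrow> H \<noteq> {} \<Longrightarrow> palindromic (rk M - rank_of M H) (upper_Z M p H)"
  shows "reverse_poly (rk M) (p {}) = (\<Sum>G\<in>flats M. char_poly (localization M G) * p G) \<longleftrightarrow>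
         palindromic (rk M) (upper_Z M p {})"
proof -
  let ?L = "flats M" and ?r = "\<lambda>H. rk M - rank_of M H"
  note e = loopless_empty_flat[OF M]
  have r0: "rank_of M {} = 0" by (rule rank_of_empty[OF M(1)])
  have le: "rank_of M G \<le> rk M" if "G \<in> ?L" for G
    unfolding rk_def using that by (intro rank_of_mono[OF M(1)]) (auto simp: flats_def)
  have deg': "degree (monom 1 (rank_of M G - rank_of M H) * p G) \<le> ?r H"
    and shift: "reverse_poly (?r H) (monom 1 (rank_of M G - rank_of M H) * p G) = reverse_poly (?r G) (p G)"
    if "H \<in> ?L" "G \<in> ?L" "H \<subseteq> G" for H G
  proof -
    have "degree (p G) + (rank_of M G - rank_of M H) \<le> ?r H"
      using deg[OF that(2)] le[OF that(2)] rank_of_mono[OF M(1) that(3)] by linarith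
    moreover have "?r H - (rank_of M G - rank_of M H) = ?r G"
      using le[OF that(2)] rank_of_mono[OF M(1) that(3)] by linarith
    ultimately show "reverse_poly (?r H) (monom 1 (rank_of M G - rank_of M H) * p G) = reverse_poly (?r G) (p G)"
      by (simp add: reverse_poly_shift)
    show "degree (monom 1 (rank_of M G - rank_of M H) * p G) \<le> ?r H"
      using degree_monom_mult_le[of "rank_of M G - rank_of M H" "p G"]
        \<open>degree (p G) + (rank_of M G - rank_of M H) \<le> ?r H\<close> by linarith
  qed
  have degZ: "degree (upper_Z M p H) \<le> ?r H" if "H \<in> ?L" for H
    unfolding upper_Z_def using finite_flats[OF M(1)] deg' that by (intro degree_sum_le) auto
  \<comment> \<open>The defect of palindromicity. The recursion says that the Moebius-weighted sum
    of all defects vanishes; those at nonempty flats vanish by hypothesis, which leaves the one at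
    the bottom, with weight 1.\<close>
  define D where "D H = upper_Z M p H - reverse_poly (?r H) (upper_Z M p H)" for H
  have rev: "reverse_poly (?r H) (upper_Z M p H) = (\<Sum>G\<in>{G\<in>?L. H \<subseteq> G}. reverse_poly (?r G) (p G))"
    if "H \<in> ?L" for H
    unfolding upper_Z_def using that deg' shift by (subst reverse_poly_sum) auto
  have D0: "D H = 0" if "H \<in> ?L" "H \<noteq> {}" for H
    using pal[OF that] degZ[OF that(1)] palindromic_iff_reverse unfolding D_def by simp
  have "reverse_poly (rk M) (p {}) = (\<Sum>H\<in>?L. smult (moebius ?L {} H) (\<Sum>G\<in>{G\<in>?L. H \<subseteq> G}. reverse_poly (?r G) (p G)))"
    using moebius_inversion_bottom[OF M, of "\<lambda>G. reverse_poly (?r G) (p G)"] r0 by simp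
  also have "\<dots> = (\<Sum>H\<in>?L. smult (moebius ?L {} H) (reverse_poly (?r H) (upper_Z M p H)))"
    by (simp add: rev)
  finally have "(\<Sum>G\<in>?L. char_poly (localization M G) * p G) - reverse_poly (rk M) (p {}) =
      (\<Sum>H\<in>?L. smult (moebius ?L {} H) (D H))"
    by (simp add: char_poly_sum[OF M] D_def sum_subtractf smult_diff_right)
  also have "\<dots> = (\<Sum>H\<in>?L. if H = {} then D H else 0)"
    using D0 by (intro sum.cong) auto
  also have "\<dots> = D {}"
    using e finite_flats[OF M(1)] by simp
  finally have "reverse_poly (rk M) (p {}) = (\<Sum>G\<in>?L. char_poly (localization M G) * p G) \<longleftrightarrow> D {} = 0"
    by (metis right_minus_eq)
  also have "\<dots> \<longleftrightarrow> palindromic (rk M) (upper_Z M p {})"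
    using palindromic_iff_reverse[OF degZ[OF e]] r0 by (auto simp: D_def)
  finally show ?thesis .
qed

lemma upper_Z_contraction:
  assumes M: "is_matroid M" and F: "F \<in> flats M"
  shows "upper_Z (contraction M F) (\<lambda>G. P (contraction (contraction M F) G)) {} =
         upper_Z M (\<lambda>G. P (contraction M G)) F"
proof -
  note M' = is_matroid_contraction[OF M, of F]
  have F': "F \<subseteq> ground M" using F by (auto simp: flats_def)
  have inj: "inj_on (\<lambda>G. G - F) {G \<in> flats M. F \<subseteq> G}"
    by (rule inj_onI) blast
  have eq: "{G \<in> flats (contraction M F). {} \<subseteq> G} = (\<lambda>G. G - F) ` {G \<in> flats M. F \<subseteq> G}"
    unfolding flats_contraction[OF M F', symmetric] by simp
  have "upper_Z (contraction M F) (\<lambda>G. P (contraction (contraction M F) G)) {} =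
    (\<Sum>G\<in>{G \<in> flats M. F \<subseteq> G}. monom 1 (rank_of (contraction M F) (G - F)) * P (contraction (contraction M F) (G - F)))"
    unfolding upper_Z_def eq rank_of_empty[OF M'] by (subst sum.reindex[OF inj]) simp
  also have "\<dots> = upper_Z M (\<lambda>G. P (contraction M G)) F"
    unfolding upper_Z_def
  proof (rule sum.cong[OF refl])
    fix G assume G: "G \<in> {G \<in> flats M. F \<subseteq> G}"
    then have G': "G \<subseteq> ground M" "F \<subseteq> G" by (auto simp: flats_def)
    then have "rank_of (contraction M F) (G - F) + rank_of M F = rank_of M G"
      using rank_of_contraction[OF M, of "G - F" F] by (simp add: Diff_mono Un_absorb2)
    then have "rank_of (contraction M F) (G - F) = rank_of M G - rank_of M F" by simp
    then show "monom 1 (rank_of (contraction M F) (G - F)) * P (contraction (contraction M F) (G - F)) =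
          monom 1 (rank_of M G - rank_of M F) * P (contraction M G)"
      using contraction_contraction[OF M G'(2,1)] by simp
  qed
  finally show ?thesis .
qed

definition palindromic_assignment :: "('a matroid \<Rightarrow> int poly) \<Rightarrow> bool" where
  "palindromic_assignment P \<longleftrightarrow>
     (\<forall>M. is_matroid M \<and> loopless M \<longrightarrow>
        (rk M = 0 \<longrightarrow> P M = 1) \<and>
        (rk M > 0 \<longrightarrow> 2 * degree (P M) < rk M) \<and>
        palindromic (rk M) (upper_Z M (\<lambda>G. P (contraction M G)) {})) \<and>
     (\<forall>M. \<not> (is_matroid M \<and> loopless M) \<longrightarrow> P M = 0)"

lemma palindromic_assignment_degree:
  "palindromic_assignment P \<Longrightarrow> is_matroid M \<Longrightarrow> loopless M \<Longrightarrow> 0 < rk M \<Longrightarrow> 2 * degree (P M) < rk M"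
  by (simp add: palindromic_assignment_def)

lemma card_contraction_less:
  assumes "is_matroid M" "F \<in> flats M" "F \<noteq> {}"
  shows "card (ground (contraction M F)) < card (ground M)"
  using assms by (auto simp: flats_def is_matroid_def intro!: psubset_card_mono)

lemma degree_contraction_le:
  assumes deg: "\<And>M. is_matroid M \<Longrightarrow> loopless M \<Longrightarrow>
        (rk M = 0 \<longrightarrow> P M = 1) \<and> (rk M > 0 \<longrightarrow> 2 * degree (P M) < rk M)"
    and M: "is_matroid M" "G \<in> flats M"
  shows "degree (P (contraction M G)) \<le> rk M - rank_of M G"
proof -
  have "rk (contraction M G) = rk M - rank_of M G"
    using M by (intro rk_contraction) (auto simp: flats_def)
  then show ?thesis
    using deg[OF is_matroid_contraction[OF M(1)] loopless_contraction[OF M]]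
    by (cases "rk M - rank_of M G = 0") auto
qed

text \<open>For a single M the two conditions are equivalent once palindromicity is known for its
  contractions at nonempty flats. Starting from palindromicity everywhere this is immediate;
  starting from the recursion it takes induction on the size of the ground set.\<close>

lemma kl_assignment_iff_palindromic: "kl_assignment P \<longleftrightarrow> palindromic_assignment P"
proof -
  define kl where "kl M \<longleftrightarrow> reverse_poly (rk M) (P M) =
          (\<Sum>F\<in>flats M. char_poly (localization M F) * P (contraction M F))" for M
  define pal where "pal M \<longleftrightarrow> palindromic (rk M) (upper_Z M (\<lambda>G. P (contraction M G)) {})" for M
  have main: "(\<forall>M. is_matroid M \<and> loopless M \<longrightarrow> kl M) \<longleftrightarrow> (\<forall>M. is_matroid M \<and> loopless M \<longrightarrow> pal M)"
    if deg: "\<And>M. is_matroid M \<Longrightarrow> loopless M \<Longrightarrow>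
        (rk M = 0 \<longrightarrow> P M = 1) \<and> (rk M > 0 \<longrightarrow> 2 * degree (P M) < rk M)"
  proof -
    have iff: "kl M \<longleftrightarrow> pal M"
      if M: "is_matroid M" "loopless M"
        and hyp: "\<And>H. H \<in> flats M \<Longrightarrow> H \<noteq> {} \<Longrightarrow> pal (contraction M H)" for M
    proof -
      have "palindromic (rk M - rank_of M H) (upper_Z M (\<lambda>G. P (contraction M G)) H)"
        if "H \<in> flats M" "H \<noteq> {}" for H
      proof -
        have "H \<subseteq> ground M" using that by (simp add: flats_def)
        then show ?thesis
          using hyp[OF that] unfolding pal_def
          by (simp add: upper_Z_contraction[OF M(1) that(1)] rk_contraction[OF M(1)])
      qed
      then show ?thesis
        using kl_equation_iff_palindromic[OF M, of "\<lambda>G. P (contraction M G)"]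
          degree_contraction_le[OF deg M(1)]
        by (simp add: kl_def pal_def contraction_empty[OF M(1)])
    qed
    have "pal M" if kl: "\<forall>M. is_matroid M \<and> loopless M \<longrightarrow> kl M" and M: "is_matroid M" "loopless M" for M
      using M
    proof (induction "card (ground M)" arbitrary: M rule: less_induct)
      case less
      have "pal (contraction M H)" if "H \<in> flats M" "H \<noteq> {}" for H
        using that less card_contraction_less is_matroid_contraction loopless_contraction by blast
      then show ?case using iff[OF less.prems] kl less.prems by blast
    qed
    then show ?thesis
      using iff is_matroid_contraction loopless_contraction by blast
  qed
  show ?thesis
    unfolding kl_assignment_def palindromic_assignment_def kl_def[symmetric] pal_def[symmetric]
    using main by blast
qed

text \<open>The polynomial of degree below r/2 that repairs S: in the sum, the lower half becomes
  the mirror image of the upper half of S. A coefficient at r/2 is symmetric by itself.\<close>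

definition palindromic_completion :: "nat \<Rightarrow> int poly \<Rightarrow> int poly" where
  "palindromic_completion r S = (\<Sum>i\<in>{i. 2 * i < r}. monom (coeff S (r - i) - coeff S i) i)"

lemma coeff_palindromic_completion:
  "coeff (palindromic_completion r S) i = (if 2 * i < r then coeff S (r - i) - coeff S i else 0)"
proof -
  have "finite {i. 2 * i < r}" by (rule finite_subset[of _ "{..r}"]) auto
  then show ?thesis by (simp add: palindromic_completion_def coeff_sum)
qed

lemma degree_palindromic_completion: "r > 0 \<Longrightarrow> 2 * degree (palindromic_completion r S) < r"
  using coeff_palindromic_completion[of r S "degree (palindromic_completion r S)"]
  by (cases "palindromic_completion r S = 0") (auto split: if_splits)

lemma palindromic_add_completion:
  assumes "degree S \<le> r"
  shows "palindromic r (palindromic_completion r S + S)"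
proof (cases "r = 0")
  case False
  then have "degree (palindromic_completion r S + S) \<le> r"
    using assms degree_palindromic_completion[of r S] by (intro degree_add_le) auto
  moreover have "coeff S (r - i) = coeff S i" if "\<not> 2 * i < r" "\<not> 2 * (r - i) < r" "i \<le> r" for i
  proof -
    have "r - i = i" using that by linarith
    then show ?thesis by simp
  qed
  ultimately show ?thesis
    by (auto simp: palindromic_def coeff_palindromic_completion)
qed (use assms in \<open>simp add: palindromic_def palindromic_completion_def\<close>)

text \<open>Solves the palindromic condition for the term of the bottom flat, given the values at
  the smaller contractions. It provides the existence on which the \<open>THE\<close> in
  \<open>kl_poly\<close> depends.\<close>

function kl_rec :: "'a matroid \<Rightarrow> int poly" where
  "kl_rec M =
     (if is_matroid M \<and> loopless M then
        if rk M = 0 then 1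
        else palindromic_completion (rk M)
          (\<Sum>F\<in>{F\<in>flats M. F \<noteq> {}}. monom 1 (rank_of M F) * kl_rec (contraction M F))
      else 0)"
  by pat_completeness auto
termination
  by (relation "measure (\<lambda>M. card (ground M))")
     (auto intro: card_contraction_less[unfolded ground_contraction])

declare kl_rec.simps [simp del]

lemma palindromic_assignment_kl_rec: "palindromic_assignment (kl_rec :: 'a matroid \<Rightarrow> int poly)"
proof -
  have deg: "(rk M = 0 \<longrightarrow> kl_rec M = 1) \<and> (rk M > 0 \<longrightarrow> 2 * degree (kl_rec M) < rk M)"
    if "is_matroid M" "loopless M" for M :: "'a matroid"
    using that degree_palindromic_completion by (subst (1 2) kl_rec.simps) auto
  have "palindromic (rk M) (upper_Z M (\<lambda>G. kl_rec (contraction M G)) {})"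
    if M: "is_matroid M" "loopless M" for M :: "'a matroid"
  proof -
    define S where "S = (\<Sum>F\<in>{F\<in>flats M. F \<noteq> {}}. monom 1 (rank_of M F) * kl_rec (contraction M F))"
    have e: "{} \<in> flats M" by (rule loopless_empty_flat[OF M])
    have fin: "finite (flats M)" by (rule finite_flats[OF M(1)])
    have eq: "{G \<in> flats M. {} \<subseteq> G} = insert {} {F\<in>flats M. F \<noteq> {}}" using e by auto
    have r0: "rank_of M {} = 0" by (rule rank_of_empty[OF M(1)])
    have Z: "upper_Z M (\<lambda>G. kl_rec (contraction M G)) {} = kl_rec M + S"
      unfolding upper_Z_def eq S_def using fin
      by (subst sum.insert) (auto simp: r0 contraction_empty[OF M(1)])
    have le: "degree S \<le> rk M"
      unfolding S_def
    proof (rule degree_sum_le)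
      fix F assume "F \<in> {F\<in>flats M. F \<noteq> {}}"
      then have F: "F \<in> flats M" by simp
      then have "rank_of M F \<le> rk M"
        unfolding rk_def by (intro rank_of_mono[OF M(1)]) (simp add: flats_def)
      then show "degree (monom 1 (rank_of M F) * kl_rec (contraction M F)) \<le> rk M"
        using degree_monom_mult_le[of "rank_of M F" "kl_rec (contraction M F)"]
          degree_contraction_le[OF deg M(1) F] by linarith
    qed (use fin in simp)
    show ?thesis
    proof (cases "rk M = 0")
      case True
      then show ?thesis
        unfolding Z using le deg[OF M] degree_add_le[of 1 0 S] by (auto simp: palindromic_def)
    next
      case False
      then have "kl_rec M = palindromic_completion (rk M) S"
        using M unfolding S_def by (subst kl_rec.simps) simp
      then show ?thesis unfolding Z using palindromic_add_completion[OF le] by simp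
    qed
  qed
  then show ?thesis
    using deg unfolding palindromic_assignment_def by (auto simp: kl_rec.simps)
qed

text \<open>Induction downwards from the ground set: if P and f agree strictly above F, the
  difference of the two palindromic upper sums reduces to the difference at F, whose degree is below
  half the corank.\<close>

lemma palindromic_assignment_unique_on:
  assumes P: "palindromic_assignment P"
    and M: "is_matroid M" "loopless M"
    and top: "f (ground M) = 1"
    and deg: "\<And>F. F \<in> flats M \<Longrightarrow> F \<noteq> ground M \<Longrightarrow> 2 * degree (f F) < rk M - rank_of M F"
    and pal: "\<And>F. F \<in> flats M \<Longrightarrow> palindromic (rk M - rank_of M F) (upper_Z M f F)"
    and F: "F \<in> flats M"
  shows "P (contraction M F) = f F"
  using F
proof (induction "card (ground M - F)" arbitrary: F rule: less_induct)
  case less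
  have finE: "finite (ground M)" using M(1) by (simp add: is_matroid_def)
  have FE: "F \<subseteq> ground M" using less.prems by (simp add: flats_def)
  let ?N = "contraction M F"
  have N: "is_matroid ?N" "loopless ?N" "rk ?N = rk M - rank_of M F"
    using is_matroid_contraction[OF M(1)] loopless_contraction[OF M(1) less.prems]
      rk_contraction[OF M(1) FE] by auto
  show ?case
  proof (cases "F = ground M")
    case True
    then have "rk ?N = 0" using N by (simp add: rk_def)
    then show ?thesis using N P top True by (simp add: palindromic_assignment_def)
  next
    case False
    let ?p = "\<lambda>G. P (contraction M G)"
    have "rank_of M F < rk M"
      unfolding rk_def using False FE less.prems by (intro rank_of_flat_less[OF M(1)]) auto
    then have d1: "2 * degree (?p F) < rk M - rank_of M F"
      using palindromic_assignment_degree[OF P N(1,2)] N(3) by simp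
    have "?p G = f G" if "G \<in> flats M" "F \<subset> G" for G
    proof -
      have "G \<subseteq> ground M" using that by (simp add: flats_def)
      then have "card (ground M - G) < card (ground M - F)"
        using that finE by (intro psubset_card_mono) auto
      then show ?thesis using less.hyps that(1) by blast
    qed
    then have eq: "(\<Sum>G\<in>{G\<in>flats M. F \<subset> G}. monom 1 (rank_of M G - rank_of M F) * ?p G) =
                   (\<Sum>G\<in>{G\<in>flats M. F \<subset> G}. monom 1 (rank_of M G - rank_of M F) * f G)"
      by (intro sum.cong) auto
    have split: "upper_Z M g F = g F + (\<Sum>G\<in>{G\<in>flats M. F \<subset> G}. monom 1 (rank_of M G - rank_of M F) * g G)" for g
    proof -
      have "{G\<in>flats M. F \<subseteq> G} = insert F {G\<in>flats M. F \<subset> G}" using less.prems by auto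
      then show ?thesis
        unfolding upper_Z_def using finite_flats[OF M(1)] by (simp add: one_pCons[symmetric])
    qed
    have "palindromic (rk M - rank_of M F) (upper_Z M ?p F)"
      using P N unfolding palindromic_assignment_def
      by (metis upper_Z_contraction[OF M(1) less.prems])
    then have "palindromic (rk M - rank_of M F) (upper_Z M ?p F - upper_Z M f F)"
      by (rule palindromic_diff) (rule pal[OF less.prems])
    then have "palindromic (rk M - rank_of M F) (?p F - f F)"
      unfolding split[of ?p] split[of f] eq by simp
    moreover have "2 * degree (?p F - f F) < rk M - rank_of M F"
      using d1 deg[OF less.prems False] degree_diff_le_max[of "?p F" "f F"] by linarith
    ultimately show ?thesis
      using palindromic_small_degree by fastforce
  qed
qed

lemma palindromic_assignment_kl_poly: "palindromic_assignment (kl_poly :: 'a matroid \<Rightarrow> int poly)"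
proof -
  have "P = kl_rec" if P: "palindromic_assignment P" for P :: "'a matroid \<Rightarrow> int poly"
  proof
    fix M :: "'a matroid"
    note Q = palindromic_assignment_kl_rec[where 'a = 'a]
    show "P M = kl_rec M"
    proof (cases "is_matroid M \<and> loopless M")
      case True
      then have M: "is_matroid M" "loopless M" by auto
      have "P (contraction M {}) = kl_rec (contraction M {})"
      \<comment> \<open>Global uniqueness is the local one for the function that the explicit
        solution induces on the flats of M, evaluated at the empty flat.\<close>
      proof (rule palindromic_assignment_unique_on[OF P M, where f = "\<lambda>F. kl_rec (contraction M F)"])
        have N: "is_matroid (contraction M F)" "loopless (contraction M F)"
            "rk (contraction M F) = rk M - rank_of M F" if "F \<in> flats M" for F
          using that is_matroid_contraction[OF M(1)] loopless_contraction[OF M(1)]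
            rk_contraction[OF M(1), of F] by (auto simp: flats_def)
        show "kl_rec (contraction M (ground M)) = 1"
          using N[OF ground_in_flats] Q by (simp add: palindromic_assignment_def rk_def)
        show "2 * degree (kl_rec (contraction M F)) < rk M - rank_of M F"
          if "F \<in> flats M" "F \<noteq> ground M" for F
        proof -
          have "rank_of M F < rk M"
            unfolding rk_def using that by (intro rank_of_flat_less[OF M(1)]) (auto simp: flats_def)
          then show ?thesis
            using palindromic_assignment_degree[OF Q N(1,2)[OF that(1)]] N(3)[OF that(1)] by simp
        qed
        show "palindromic (rk M - rank_of M F) (upper_Z M (\<lambda>F. kl_rec (contraction M F)) F)"
          if "F \<in> flats M" for F
          using N[OF that] Q unfolding palindromic_assignment_def
          by (metis upper_Z_contraction[OF M(1) that])
        show "{} \<in> flats M" by (rule loopless_empty_flat[OF M])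
      qed
      then show ?thesis by (simp add: contraction_empty[OF M(1)])
    next
      case False
      then show ?thesis using P Q unfolding palindromic_assignment_def by metis
    qed
  qed
  then have "\<exists>!P. kl_assignment (P :: 'a matroid \<Rightarrow> int poly)"
    using palindromic_assignment_kl_rec unfolding kl_assignment_iff_palindromic by blast
  then show ?thesis
    unfolding kl_poly_def kl_assignment_iff_palindromic by (rule theI')
qed

text \<open>The interface to Kazhdan--Lusztig theory: for each family it remains to guess f on the
  flats, to bound its degrees and to compute its upper sums.\<close>

theorem Z_poly_eqI:
  assumes M: "is_matroid M" "loopless M"
    and "f (ground M) = 1"
    and "\<And>F. F \<in> flats M \<Longrightarrow> F \<noteq> ground M \<Longrightarrow> 2 * degree (f F) < rk M - rank_of M F"
    and "\<And>F. F \<in> flats M \<Longrightarrow> palindromic (rk M - rank_of M F) (upper_Z M f F)"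
  shows "Z_poly M = upper_Z M f {}"
  using palindromic_assignment_unique_on[OF palindromic_assignment_kl_poly assms]
  by (simp add: Z_poly_def upper_Z_def rank_of_empty[OF M(1)])

subsection \<open>Matroids defined by a span relation with the exchange property\<close>

text \<open>A closure operator with exchange, given as a relation. \<open>sp_in\<close> is
  restricted to subsets of the ground set because \<open>spans\<close> below only relates edges of
  the form {u, v}, so an arbitrary set need not span its own members.\<close>

locale span_matroid =
  fixes M :: "'a matroid" and sp :: "'a set \<Rightarrow> 'a \<Rightarrow> bool"
  assumes finite_ground: "finite (ground M)"
    and indep_iff: "indep M X \<longleftrightarrow> X \<subseteq> ground M \<and> (\<forall>x\<in>X. \<not> sp (X - {x}) x)"
    and sp_in: "A \<subseteq> ground M \<Longrightarrow> e \<in> A \<Longrightarrow> sp A e"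
    and sp_mono: "A \<subseteq> B \<Longrightarrow> sp A e \<Longrightarrow> sp B e"
    and sp_trans: "(\<And>b. b \<in> B \<Longrightarrow> sp A b) \<Longrightarrow> sp B e \<Longrightarrow> sp A e"
    and sp_exchange: "sp (insert f A) e \<Longrightarrow> \<not> sp A e \<Longrightarrow> sp (insert e A) f"
begin

lemma indep_insert:
  assumes "indep M X" "e \<in> ground M" "\<not> sp X e"
  shows "indep M (insert e X)"
proof -
  have "X \<subseteq> ground M" using assms(1) indep_iff by simp
  then have eX: "e \<notin> X" using assms(3) sp_in by metis
  have "\<not> sp (insert e X - {x}) x" if x: "x \<in> X" for x
  proof
    assume "sp (insert e X - {x}) x"
    moreover have "insert e X - {x} = insert e (X - {x})" using eX x by auto
    moreover have "\<not> sp (X - {x}) x" using assms(1) x indep_iff by simp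
    ultimately have "sp (insert x (X - {x})) e" using sp_exchange by metis
    then show False using x assms(3) by (simp add: insert_absorb)
  qed
  moreover have "insert e X - {e} = X" using eX by auto
  ultimately show ?thesis
    using assms indep_iff by (metis insert_iff insert_subset)
qed

lemma steinitz:
  assumes "indep M Y" "X \<subseteq> ground M" "\<And>y. y \<in> Y \<Longrightarrow> sp X y"
  shows "card Y \<le> card X"
  using assms(1,3)
proof (induction "card (Y - X)" arbitrary: Y rule: less_induct)
  case less
  have finX: "finite X" using assms(2) finite_ground by (rule finite_subset)
  have YE: "Y \<subseteq> ground M" using less.prems(1) indep_iff by simp
  have finY: "finite Y" using YE finite_ground by (rule finite_subset)
  show ?case
  proof (cases "Y \<subseteq> X")
    case True
    then show ?thesis using finX card_mono by blast
  next
    case False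
    then obtain y where y: "y \<in> Y" "y \<notin> X" by auto
    have ny: "\<not> sp (Y - {y}) y" using less.prems(1) y(1) indep_iff by simp
    \<comment> \<open>Otherwise the rest of Y would span X and hence y. Trading y for such an x
      keeps the size and independence of Y and leaves fewer elements outside X.\<close>
    have "\<exists>x\<in>X. \<not> sp (Y - {y}) x"
      using sp_trans[of X "Y - {y}" y] less.prems(2)[OF y(1)] ny by metis
    then obtain x where x: "x \<in> X" "\<not> sp (Y - {y}) x" by blast
    have iY: "indep M (Y - {y})"
      unfolding indep_iff
    proof (intro conjI ballI)
      show "Y - {y} \<subseteq> ground M" using YE by blast
      fix z assume z: "z \<in> Y - {y}"
      then have "\<not> sp (Y - {z}) z" using less.prems(1) indep_iff by simp
      moreover have "Y - {y} - {z} \<subseteq> Y - {z}" by blast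
      ultimately show "\<not> sp (Y - {y} - {z}) z" using sp_mono by metis
    qed
    define Y' where "Y' = insert x (Y - {y})"
    have iY': "indep M Y'"
      unfolding Y'_def by (rule indep_insert[OF iY _ x(2)]) (use x(1) assms(2) in blast)
    have "Y - {y} \<subseteq> ground M" using YE by blast
    then have "x \<notin> Y - {y}" using x(2) sp_in by metis
    then have "card Y' = card Y"
      unfolding Y'_def using finY y(1) by (metis card_Suc_Diff1 card_insert_disjoint finite_Diff)
    moreover have "card (Y' - X) < card (Y - X)"
      by (rule psubset_card_mono) (use finY x(1) y in \<open>auto simp: Y'_def\<close>)
    moreover have "sp X z" if "z \<in> Y'" for z
      using that less.prems(2)[of z] sp_in[OF assms(2) x(1)] unfolding Y'_def by blast
    ultimately show ?thesis
      using less.hyps[of Y'] iY' by metis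
  qed
qed

lemma is_matroid: "is_matroid M"
  unfolding is_matroid_def
proof (intro conjI allI impI)
  show "finite (ground M)" by (rule finite_ground)
  show "X \<subseteq> ground M" if "indep M X" for X using that indep_iff by simp
  show "indep M {}" using indep_iff by simp
  show "indep M Y" if XY: "indep M X \<and> Y \<subseteq> X" for X Y
    unfolding indep_iff
  proof (intro conjI ballI)
    show "Y \<subseteq> ground M" using XY indep_iff by auto
    fix z assume z: "z \<in> Y"
    have "Y - {z} \<subseteq> X - {z}" using XY by blast
    moreover have "\<not> sp (X - {z}) z" using XY z indep_iff by auto
    ultimately show "\<not> sp (Y - {z}) z" using sp_mono by metis
  qed
  show "\<exists>y\<in>Y - X. indep M (insert y X)"
    if XY: "indep M X \<and> indep M Y \<and> card X < card Y" for X Y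
  proof -
    have XE: "X \<subseteq> ground M" "Y \<subseteq> ground M" using XY indep_iff by auto
    obtain y where y: "y \<in> Y" "\<not> sp X y"
      using steinitz[of Y X] XY XE by fastforce
    then have "y \<notin> X" using sp_in XE by metis
    then show ?thesis using y indep_insert[of X y] XY XE by blast
  qed
qed

lemma rank_of_spanned:
  assumes "A \<subseteq> B" "B \<subseteq> ground M" "\<And>b. b \<in> B \<Longrightarrow> sp A b"
  shows "rank_of M B = rank_of M A"
proof (rule antisym)
  obtain X where X: "X \<subseteq> A" "indep M X" "card X = rank_of M A"
    using exists_basis[OF is_matroid, of A] by (auto simp: basis_of_def)
  have spA: "sp X a" if "a \<in> A" for a
  proof (rule ccontr)
    assume n: "\<not> sp X a"
    have XE: "X \<subseteq> ground M" using X assms by blast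
    have "indep M (insert a X)"
      by (rule indep_insert[OF X(2) _ n]) (use that assms(1,2) in blast)
    moreover have "a \<notin> X" using n XE sp_in by metis
    moreover have "finite X" using XE finite_ground by (rule finite_subset)
    ultimately have "Suc (card X) \<le> rank_of M A"
      using indep_card_le_rank[OF is_matroid, of "insert a X" A] X that by simp
    then show False using X by simp
  qed
  obtain Y where Y: "Y \<subseteq> B" "indep M Y" "card Y = rank_of M B"
    using exists_basis[OF is_matroid, of B] by (auto simp: basis_of_def)
  have "card Y \<le> card X"
  proof (rule steinitz[OF Y(2)])
    show "X \<subseteq> ground M" using X assms by blast
    show "sp X y" if "y \<in> Y" for y
      using sp_trans[of A X y] spA assms(3)[of y] that Y by blast
  qed
  then show "rank_of M B \<le> rank_of M A" using X Y by simp
  show "rank_of M A \<le> rank_of M B" by (rule rank_of_mono[OF is_matroid assms(1)])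
qed

lemma rank_of_insert_gt_iff:
  assumes "A \<subseteq> ground M" "e \<in> ground M"
  shows "rank_of M A < rank_of M (insert e A) \<longleftrightarrow> \<not> sp A e"
proof
  assume "rank_of M A < rank_of M (insert e A)"
  then show "\<not> sp A e"
    using rank_of_spanned[of A "insert e A"] assms sp_in[OF assms(1)] by (auto simp: subset_insertI)
next
  assume n: "\<not> sp A e"
  obtain X where X: "X \<subseteq> A" "indep M X" "card X = rank_of M A"
    using exists_basis[OF is_matroid, of A] by (auto simp: basis_of_def)
  have nX: "\<not> sp X e" using n X(1) sp_mono by metis
  have XE: "X \<subseteq> ground M" using X assms by blast
  have "indep M (insert e X)" by (rule indep_insert[OF X(2) assms(2) nX])
  moreover have "e \<notin> X" using nX XE sp_in by metis
  moreover have "finite X" using XE finite_ground by (rule finite_subset)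
  ultimately show "rank_of M A < rank_of M (insert e A)"
    using indep_card_le_rank[OF is_matroid, of "insert e X" "insert e A"] X
    by (simp add: insert_mono less_eq_Suc_le subset_insertI2)
qed

lemma flats_iff: "F \<in> flats M \<longleftrightarrow> F \<subseteq> ground M \<and> (\<forall>e\<in>ground M. sp F e \<longrightarrow> e \<in> F)"
  using rank_of_insert_gt_iff[of F] by (auto simp: flats_def)

end

subsection \<open>Graphic matroids\<close>

definition joined :: "'v set set \<Rightarrow> ('v \<times> 'v) set" where
  "joined A = {(u, v). {u, v} \<in> A}\<^sup>*"

definition spans :: "'v set set \<Rightarrow> 'v set \<Rightarrow> bool" where
  "spans A e \<longleftrightarrow> (\<exists>u v. e = {u, v} \<and> (u, v) \<in> joined A)"

lemma joined_refl [simp]: "(u, u) \<in> joined A"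
  by (simp add: joined_def)

lemma joined_trans: "(u, v) \<in> joined A \<Longrightarrow> (v, w) \<in> joined A \<Longrightarrow> (u, w) \<in> joined A"
  unfolding joined_def by (rule rtrancl_trans)

lemma joined_edge: "{u, v} \<in> A \<Longrightarrow> (u, v) \<in> joined A"
  unfolding joined_def by auto

lemma joined_sym: "(u, v) \<in> joined A \<Longrightarrow> (v, u) \<in> joined A"
proof -
  have "sym {(u, v). {u, v} \<in> A}" by (auto simp: sym_def insert_commute)
  then show "(u, v) \<in> joined A \<Longrightarrow> (v, u) \<in> joined A"
    unfolding joined_def by (meson sym_rtrancl symE)
qed

lemma joined_mono: "A \<subseteq> B \<Longrightarrow> (u, v) \<in> joined A \<Longrightarrow> (u, v) \<in> joined B"
  unfolding joined_def using rtrancl_mono[of "{(u, v). {u, v} \<in> A}" "{(u, v). {u, v} \<in> B}"] by auto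

text \<open>The invariant for proving that an edge is not spanned: a colouring constant on the edges
  of A is constant on the components of A.\<close>

lemma joined_colour:
  assumes "(u, v) \<in> joined A" "\<And>x y. {x, y} \<in> A \<Longrightarrow> c x = c y"
  shows "c u = c v"
  using assms(1) unfolding joined_def by induction (use assms(2) in auto)

lemma spans_iff: "spans A {u, v} \<longleftrightarrow> (u, v) \<in> joined A"
  unfolding spans_def by (auto simp: doubleton_eq_iff dest: joined_sym)

text \<open>The source of the exchange property: a walk that relies on the new edge splits into an
  old walk to one of its ends and an old walk from the other.\<close>

lemma joined_insert:
  assumes "(u, v) \<in> joined (insert {a, b} A)"
  shows "(u, v) \<in> joined A \<or> (u, a) \<in> joined A \<and> (b, v) \<in> joined A
     \<or> (u, b) \<in> joined A \<and> (a, v) \<in> joined A"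
  using assms unfolding joined_def[of "insert {a, b} A"]
proof induction
  case (step v w)
  from step(2) consider "{v, w} \<in> A" | "v = a" "w = b" | "v = b" "w = a"
    by (auto simp: doubleton_eq_iff)
  then show ?case
  proof cases
    case 1
    then have "(v, w) \<in> joined A" by (rule joined_edge)
    then show ?thesis using step(3) joined_trans by metis
  next
    case 2
    then show ?thesis using step(3) joined_refl by metis
  next
    case 3
    then show ?thesis using step(3) joined_refl by metis
  qed
qed simp

lemma joined_simple_path:
  assumes "(u, v) \<in> joined A"
  shows "\<exists>vs. vs \<noteq> [] \<and> hd vs = u \<and> last vs = v \<and> distinct vs \<and>
    (\<forall>i. Suc i < length vs \<longrightarrow> {vs ! i, vs ! Suc i} \<in> A)"
  using assms unfolding joined_def
proof induction
  case base
  show ?case by (intro exI[of _ "[u]"]) auto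
next
  case (step v w)
  then obtain vs where vs: "vs \<noteq> []" "hd vs = u" "last vs = v" "distinct vs"
    "\<And>i. Suc i < length vs \<Longrightarrow> {vs ! i, vs ! Suc i} \<in> A" by blast
  show ?case
  proof (cases "w \<in> set vs")
    case True
    \<comment> \<open>A vertex already on the path is reached by cutting the path at its earlier
      visit, which keeps the vertices distinct.\<close>
    then obtain k where k: "k < length vs" "vs ! k = w" by (auto simp: in_set_conv_nth)
    have "last (take (Suc k) vs) = w"
      using k by (simp add: take_Suc_conv_app_nth)
    then show ?thesis
      using vs k by (intro exI[of _ "take (Suc k) vs"]) (auto simp: hd_conv_nth)
  next
    case False
    have "{(vs @ [w]) ! i, (vs @ [w]) ! Suc i} \<in> A" if "Suc i < length (vs @ [w])" for i
    proof (cases "Suc i < length vs")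
      case True
      then show ?thesis using vs(5)[of i] by (simp add: nth_append)
    next
      case False
      then have "i = length vs - 1" "Suc i = length vs" using that by auto
      then show ?thesis
        using step(2) vs(1,3) by (auto simp: nth_append last_conv_nth)
    qed
    then show ?thesis
      using vs False by (intro exI[of _ "vs @ [w]"]) auto
  qed
qed

text \<open>A cycle is a simple path together with an edge joining its ends, and this edge is then
  spanned by the others.\<close>

lemma forest_iff:
  assumes "\<And>e. e \<in> X \<Longrightarrow> \<exists>u v. e = {u, v} \<and> u \<noteq> v"
  shows "forest X \<longleftrightarrow> (\<forall>e\<in>X. \<not> spans (X - {e}) e)"
proof
  assume f: "forest X"
  show "\<forall>e\<in>X. \<not> spans (X - {e}) e"
  proof
    fix e assume e: "e \<in> X"
    then obtain u v where uv: "e = {u, v}" "u \<noteq> v" using assms by blast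
    show "\<not> spans (X - {e}) e"
    proof
      assume "spans (X - {e}) e"
      then have "(u, v) \<in> joined (X - {e})" unfolding uv spans_iff .
      then obtain vs where vs: "vs \<noteq> []" "hd vs = u" "last vs = v" "distinct vs"
        "\<And>i. Suc i < length vs \<Longrightarrow> {vs ! i, vs ! Suc i} \<in> X - {e}"
        using joined_simple_path by metis
      have h: "vs ! 0 = u" "vs ! (length vs - 1) = v"
        using vs by (auto simp: hd_conv_nth last_conv_nth)
      have "length vs \<noteq> 0" "length vs \<noteq> 1" using vs(1) h uv(2) by auto
      \<comment> \<open>A path on two vertices would be e itself, which has been removed; so the
        path has the length 3 that \<open>is_cycle\<close> asks for.\<close>
      moreover have "length vs \<noteq> 2" using vs(5)[of 0] h uv(1) by auto
      ultimately have len: "length vs \<ge> 3" by linarith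
      have "{vs ! i, vs ! (Suc i mod length vs)} \<in> X" if "i < length vs" for i
      proof (cases "Suc i < length vs")
        case True
        then show ?thesis using vs(5)[of i] by simp
      next
        case False
        then have "Suc i = length vs" "i = length vs - 1" using that by auto
        then show ?thesis using h e uv by (simp add: insert_commute)
      qed
      then have "is_cycle X vs" using len vs(4) by (simp add: is_cycle_def)
      then show False using f by (auto simp: forest_def)
    qed
  qed
next
  assume *: "\<forall>e\<in>X. \<not> spans (X - {e}) e"
  show "forest X"
    unfolding forest_def
  proof
    assume "\<exists>vs. is_cycle X vs"
    then obtain vs where vs: "length vs \<ge> 3" "distinct vs"
      "\<And>i. i < length vs \<Longrightarrow> {vs ! i, vs ! (Suc i mod length vs)} \<in> X"
      by (auto simp: is_cycle_def)
    define n where "n = length vs"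
    define e where "e = {vs ! 0, vs ! (n - 1)}"
    have eX: "e \<in> X"
    proof -
      have "Suc (n - 1) = n" "n - 1 < n" using vs(1) by (auto simp: n_def)
      then show ?thesis
        using vs(3)[of "n - 1"] by (simp add: e_def n_def insert_commute)
    qed
    \<comment> \<open>Because the length is at least 3, the closing edge differs from all the
      others, so these survive its removal.\<close>
    have edge: "{vs ! i, vs ! Suc i} \<in> X - {e}" if "Suc i < n" for i
    proof -
      have "{vs ! i, vs ! Suc i} \<in> X" using vs(3)[of i] that by (simp add: n_def)
      moreover have "{vs ! i, vs ! Suc i} \<noteq> e"
      proof
        assume "{vs ! i, vs ! Suc i} = e"
        then have "vs ! i = vs ! (n - 1) \<or> vs ! i = vs ! 0 \<and> vs ! Suc i = vs ! (n - 1)"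
          by (auto simp: e_def doubleton_eq_iff)
        moreover have "i < length vs" "Suc i < length vs" "n - 1 < length vs" "0 < length vs"
          using that by (auto simp: n_def)
        ultimately have "i = n - 1 \<or> i = 0 \<and> Suc i = n - 1"
          using nth_eq_iff_index_eq[OF vs(2)] by metis
        then show False using that vs(1) by (auto simp: n_def)
      qed
      ultimately show ?thesis by simp
    qed
    have "(vs ! 0, vs ! i) \<in> joined (X - {e})" if "i < n" for i
      using that
    proof (induction i)
      case (Suc i)
      then have "(vs ! 0, vs ! i) \<in> joined (X - {e})" by simp
      then show ?case
        by (rule joined_trans) (rule joined_edge[OF edge[OF Suc.prems]])
    qed simp
    then have "spans (X - {e}) e"
      unfolding e_def spans_iff using vs(1) by (simp add: n_def)
    then show False using * eX by blast
  qed
qed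

lemma spans_mono: "A \<subseteq> B \<Longrightarrow> spans A e \<Longrightarrow> spans B e"
  unfolding spans_def using joined_mono[of A B] by metis

lemma span_matroid_graphic:
  assumes "finite (snd G)" "\<And>e. e \<in> snd G \<Longrightarrow> \<exists>u v. e = {u, v} \<and> u \<noteq> v"
  shows "span_matroid (graphic_matroid G) spans"
proof
  show "finite (ground (graphic_matroid G))"
    using assms by (simp add: graphic_matroid_def)
  show "indep (graphic_matroid G) X \<longleftrightarrow>
      X \<subseteq> ground (graphic_matroid G) \<and> (\<forall>x\<in>X. \<not> spans (X - {x}) x)" for X
    using forest_iff[of X] assms(2) by (auto simp: graphic_matroid_def)
  show "spans A e" if "A \<subseteq> ground (graphic_matroid G)" "e \<in> A" for A e
  proof -
    have "e \<in> snd G" using that by (auto simp: graphic_matroid_def)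
    then obtain u v where "e = {u, v}" using assms(2) by blast
    then show ?thesis using that(2) joined_edge by (auto simp: spans_iff)
  qed
  show "spans B e" if "A \<subseteq> B" "spans A e" for A B e
    using that by (rule spans_mono)
  show "spans A e" if B: "\<And>b. b \<in> B \<Longrightarrow> spans A b" and e: "spans B e" for A B e
  proof -
    obtain u v where uv: "e = {u, v}" "(u, v) \<in> joined B" using e by (auto simp: spans_def)
    from uv(2) have "(u, v) \<in> joined A"
      unfolding joined_def[of B]
    proof induction
      case (step v w)
      then have "(v, w) \<in> joined A" using B[of "{v, w}"] by (simp add: spans_iff)
      then show ?case using step(3) by (rule joined_trans[rotated])
    qed simp
    then show ?thesis by (simp add: uv spans_iff)
  qed
  show "spans (insert e A) f" if e: "spans (insert f A) e" "\<not> spans A e" for e f A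
  proof (cases "\<exists>a b. f = {a, b}")
    case True
    then obtain a b where f: "f = {a, b}" by blast
    obtain u v where uv: "e = {u, v}" "(u, v) \<in> joined (insert f A)" using e by (auto simp: spans_def)
    have "(u, v) \<notin> joined A" using e uv by (simp add: spans_iff)
    then have *: "(u, a) \<in> joined A \<and> (b, v) \<in> joined A \<or> (u, b) \<in> joined A \<and> (a, v) \<in> joined A"
      using joined_insert[of u v a b A] uv f by blast
    have m: "(x, y) \<in> joined (insert e A)" if "(x, y) \<in> joined A" for x y
      by (rule joined_mono[OF _ that]) blast
    have "(u, v) \<in> joined (insert e A)" by (rule joined_edge) (simp add: uv)
    then have "(a, b) \<in> joined (insert e A)"
      using * m joined_trans joined_sym by meson
    then show ?thesis by (simp add: f spans_iff)
  next
    \<comment> \<open>A set that is not of the form {a, b} joins no vertices, so adding it changes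
      no span.\<close>
    case False
    then have "{(u, v). {u, v} \<in> insert f A} = {(u, v). {u, v} \<in> A}" by auto
    then have "spans (insert f A) e = spans A e" by (simp add: spans_def joined_def)
    then show ?thesis using e by simp
  qed
qed

subsection \<open>Binomial transforms of power series\<close>

text \<open>The series 1 / (1 - s X).\<close>

definition geo :: "'a::comm_ring_1 \<Rightarrow> 'a fps" where
  "geo s = Abs_fps (\<lambda>n. s ^ n)"

text \<open>On coefficients this is the binomial transform with weight s, see
  \<open>binom_transform_nth\<close>. The closed form makes it a substitution, so that functional
  equations can be carried along.\<close>

definition binom_transform :: "'a::comm_ring_1 \<Rightarrow> 'a fps \<Rightarrow> 'a fps" where
  "binom_transform s g = geo s * (g oo (fps_X * geo s))"

lemma geo_nth [simp]: "fps_nth (geo s) n = s ^ n"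
  by (simp add: geo_def)

lemma geo_mult: "geo s * (1 - fps_const s * fps_X) = 1"
proof (rule fps_ext)
  fix n
  show "fps_nth (geo s * (1 - fps_const s * fps_X)) n = fps_nth 1 n"
  proof (cases n)
    case (Suc m)
    have "geo s * (1 - fps_const s * fps_X) = geo s - fps_const s * (fps_X * geo s)"
      by (simp add: algebra_simps)
    then show ?thesis using Suc by (simp del: fps_mult_nth)
  qed simp
qed

lemma geo_power_nth:
  "fps_nth (geo s * (fps_X * geo s) ^ j) n = of_nat (n choose j) * s ^ (n - j)"
proof (induction j arbitrary: n)
  case (Suc j)
  define c where "c i = Abs_fps (\<lambda>n. of_nat (n choose i) * s ^ (n - i))" for i
  have IH: "geo s * (fps_X * geo s) ^ j = c j"
    by (rule fps_ext) (simp add: Suc c_def del: fps_mult_nth)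
  have "c (Suc j) * (1 - fps_const s * fps_X) = fps_X * c j"
  proof (rule fps_ext)
    fix n
    have eq: "c (Suc j) * (1 - fps_const s * fps_X) = c (Suc j) - fps_const s * (fps_X * c (Suc j))"
      by (simp add: algebra_simps)
    show "fps_nth (c (Suc j) * (1 - fps_const s * fps_X)) n = fps_nth (fps_X * c j) n"
    proof (cases n)
      case (Suc m)
      have "of_nat (m choose Suc j) * s ^ (m - j) = s * (of_nat (m choose Suc j) * s ^ (m - Suc j))"
      proof (cases "Suc j \<le> m")
        case True
        then have "m - j = Suc (m - Suc j)" by simp
        then show ?thesis by (simp add: mult_ac)
      qed (simp add: binomial_eq_0)
      then show ?thesis
        unfolding eq using Suc by (simp add: c_def algebra_simps)
    qed (simp add: eq c_def)
  qed
  then have "c (Suc j) * (geo s * (1 - fps_const s * fps_X)) = geo s * (fps_X * c j)"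
    by (simp add: mult_ac)
  then have "c (Suc j) = geo s * (fps_X * geo s) ^ Suc j"
    unfolding geo_mult IH[symmetric] by (simp add: mult_ac)
  then show ?case by (metis c_def fps_nth_Abs_fps)
qed simp

lemma binom_transform_nth:
  "fps_nth (binom_transform s g) n = (\<Sum>j\<le>n. of_nat (n choose j) * s ^ (n - j) * fps_nth g j)"
proof -
  have z: "fps_nth ((fps_X * geo s) ^ j) i = 0" if "i < j" for i j
    using that startsby_zero_power_prefix[of "fps_X * geo s" j] by simp
  have "fps_nth (g oo (fps_X * geo s)) i = (\<Sum>j\<le>n. fps_nth g j * fps_nth ((fps_X * geo s) ^ j) i)" if "i \<le> n" for i
    unfolding fps_compose_nth using that z by (intro sum.mono_neutral_left) auto
  then have "fps_nth (binom_transform s g) n =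
      (\<Sum>i\<le>n. fps_nth (geo s) (n - i) * (\<Sum>j\<le>n. fps_nth g j * fps_nth ((fps_X * geo s) ^ j) i))"
    unfolding binom_transform_def
    by (subst mult.commute, subst fps_mult_nth) (simp add: atLeast0AtMost mult.commute)
  also have "\<dots> = (\<Sum>j\<le>n. fps_nth g j * (\<Sum>i\<le>n. fps_nth ((fps_X * geo s) ^ j) i * fps_nth (geo s) (n - i)))"
    unfolding sum_distrib_left by (subst sum.swap) (simp add: mult_ac)
  also have "\<dots> = (\<Sum>j\<le>n. fps_nth g j * fps_nth (geo s * (fps_X * geo s) ^ j) n)"
    by (subst (2) mult.commute) (simp add: fps_mult_nth atLeast0AtMost)
  finally show ?thesis
    by (simp add: geo_power_nth mult_ac del: fps_mult_nth)
qed

lemma shift_0 [simp]: "fps_nth (fps_X * geo s) 0 = 0"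
  by simp

lemma X_mult_binom_transform:
  fixes s :: "'a::idom"
  shows "fps_X * binom_transform s g = (fps_X * g) oo (fps_X * geo s)"
  by (simp add: fps_compose_mult_distrib binom_transform_def mult_ac)

lemma geo_unique:
  fixes s :: "'a::idom"
  assumes "u * (1 - fps_const s * fps_X) = 1"
  shows "u = geo s"
proof -
  have "u = u * (geo s * (1 - fps_const s * fps_X))" by (simp add: geo_mult)
  also have "\<dots> = geo s * (u * (1 - fps_const s * fps_X))" by (simp add: mult_ac)
  finally show ?thesis by (simp add: assms)
qed

text \<open>The maps X -> X / (1 - s X) form a one-parameter group, and the prefactors 1 / (1 - s X)
  multiply accordingly.\<close>

lemma binom_transform_binom_transform:
  fixes s :: "'a::idom"
  shows "binom_transform s (binom_transform s' g) = binom_transform (s + s') g"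
proof -
  let ?sh = "\<lambda>s. fps_X * geo s :: 'a fps"
  let ?u = "geo s * (geo s' oo ?sh s)"
  have "(geo s' * (1 - fps_const s' * fps_X)) oo ?sh s = 1"
    by (simp add: geo_mult)
  then have 1: "(geo s' oo ?sh s) * (1 - fps_const s' * ?sh s) = 1"
    by (simp add: fps_compose_mult_distrib fps_compose_sub_distrib)
  have "?u * (1 - fps_const (s + s') * fps_X) =
    (geo s' oo ?sh s) * (geo s * (1 - fps_const s * fps_X) - fps_const s' * ?sh s)"
    by (simp add: algebra_simps flip: fps_const_add)
  also have "\<dots> = 1" unfolding geo_mult by (rule 1)
  finally have u: "?u = geo (s + s')" by (rule geo_unique)
  have sh: "?sh s' oo ?sh s = ?sh (s + s')"
    by (simp add: fps_compose_mult_distrib mult_ac flip: u)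
  have "binom_transform s (binom_transform s' g) = ?u * ((g oo ?sh s') oo ?sh s)"
    by (simp add: binom_transform_def fps_compose_mult_distrib mult_ac)
  also have "(g oo ?sh s') oo ?sh s = g oo ?sh (s + s')"
    by (subst fps_compose_assoc[symmetric]) (simp_all add: sh)
  finally show ?thesis by (simp add: u binom_transform_def)
qed

lemma deriv_shift:
  fixes s :: "'a::idom"
  shows "fps_deriv (fps_X * geo s) = geo s * geo s"
proof -
  have g: "geo s * (1 - fps_const s * fps_X) = 1" by (rule geo_mult)
  have "fps_deriv (geo s * (1 - fps_const s * fps_X)) = 0" unfolding g by simp
  then have "fps_deriv (geo s) * (1 - fps_const s * fps_X) = geo s * fps_const s"
    by (simp add: algebra_simps)
  then have "geo s * (fps_deriv (geo s) * (1 - fps_const s * fps_X)) = geo s * (geo s * fps_const s)"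
    by simp
  then have d: "fps_deriv (geo s) = geo s * geo s * fps_const s"
    using g by (metis mult.assoc mult.commute mult.left_neutral)
  have "fps_deriv (fps_X * geo s) = geo s + fps_X * (geo s * geo s * fps_const s)"
    by (simp add: d)
  also have "\<dots> = geo s * (geo s * (1 - fps_const s * fps_X) + fps_X * geo s * fps_const s)"
    unfolding g by (simp add: algebra_simps)
  also have "\<dots> = geo s * geo s" by (simp add: algebra_simps)
  finally show ?thesis .
qed

subsection \<open>Catalan numbers and central binomial coefficients\<close>

text \<open>The ballot difference, an integer by construction; \<open>Suc_times_catalan\<close>
  recovers the usual quotient.\<close>

definition catalan :: "nat \<Rightarrow> int" where
  "catalan k = int (2 * k choose k) - int (2 * k choose Suc k)"

lemma Suc_times_catalan: "int (Suc k) * catalan k = int (2 * k choose k)"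
proof -
  have "Suc k * (2 * k choose Suc k) = k * (2 * k choose k)"
    using binomial_absorption[of k "2 * k"] binomial_absorb_comp[of "2 * k" k] by (cases "k = 0") auto
  then have "int (Suc k) * int (2 * k choose Suc k) = int k * int (2 * k choose k)"
    by (metis of_nat_mult)
  then show ?thesis
    by (simp add: catalan_def algebra_simps)
qed

lemma central_binomial_Suc:
  "Suc k * (2 * Suc k choose Suc k) = 2 * Suc (2 * k) * (2 * k choose k)"
proof -
  have "Suc k * (2 * Suc k choose Suc k) = 2 * Suc k * (Suc (2 * k) choose k)"
    using Suc_times_binomial[of k "Suc (2 * k)"] by simp
  also have "(Suc (2 * k) choose k) = (Suc (2 * k) choose Suc k)"
    using binomial_symmetric[of k "Suc (2 * k)"] by simp
  also have "2 * Suc k * \<dots> = 2 * (Suc (2 * k) * (2 * k choose k))"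
    using Suc_times_binomial[of k "2 * k"] by (metis mult.assoc)
  finally show ?thesis by simp
qed

abbreviation T :: "int poly fps" where "T \<equiv> fps_const [:0, 1:]"

text \<open>With C and B the ordinary generating functions of the Catalan numbers and the central
  binomial coefficients, \<open>Cat\<close> is C(t X^2) and \<open>CB\<close> is B(t X^2). Spacing
  the terms out to even degrees turns binomial transforms into gamma expansions.\<close>

definition Cat :: "int poly fps" where
  "Cat = Abs_fps (\<lambda>n. if even n then monom (catalan (n div 2)) (n div 2) else 0)"

definition CB :: "int poly fps" where
  "CB = Abs_fps (\<lambda>n. if even n then monom (int (n choose (n div 2))) (n div 2) else 0)"

lemma var_mult_monom: "[:0, 1:] * monom c k = monom c (Suc k)" for c :: int
  by (simp add: monom_Suc)

lemma of_nat_mult_monom: "of_nat m * monom c k = monom (int m * c) k" for c :: int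
  by (simp add: of_nat_poly smult_monom)

lemma fps_X2_mult_nth: "fps_nth (fps_X * (fps_X * f)) n = (if n < 2 then 0 else fps_nth f (n - 2))"
  for f :: "'a::comm_ring_1 fps"
  by (cases n) (auto simp: numeral_2_eq_2)

lemma CB_nth: "fps_nth CB (2 * k) = monom (int (2 * k choose k)) k" "fps_nth CB (Suc (2 * k)) = 0"
  by (auto simp: CB_def)

lemma Cat_nth: "fps_nth Cat (2 * k) = monom (catalan k) k" "fps_nth Cat (Suc (2 * k)) = 0"
  by (auto simp: Cat_def)

text \<open>The recurrence \<open>central_binomial_Suc\<close> as the differential equation of (1 -
  4 t X^2)^(-1/2).\<close>

lemma CB_deriv: "fps_deriv CB - 4 * (T * (fps_X * (fps_X * fps_deriv CB))) = 4 * (T * (fps_X * CB))"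
proof (rule fps_ext)
  fix n
  have four: "(4 :: int poly fps) * f = fps_const (of_nat 4) * f" for f
    by (simp add: numeral_fps_const)
  show "fps_nth (fps_deriv CB - 4 * (T * (fps_X * (fps_X * fps_deriv CB)))) n = fps_nth (4 * (T * (fps_X * CB))) n"
  proof (cases "even n")
    case True
    then obtain k where n: "n = 2 * k" by blast
    show ?thesis
    proof (cases k)
      case (Suc j)
      have "n - Suc 0 = Suc (2 * j)" "n - 2 = 2 * j" using n Suc by auto
      then show ?thesis
        using CB_nth(2)[of k] CB_nth(2)[of j] unfolding four
        by (simp add: fps_X2_mult_nth n del: of_nat_numeral)
    qed (use n CB_nth(2)[of 0] in \<open>simp add: four\<close>)
  next
    case False
    then obtain k where n: "n = Suc (2 * k)" by (metis oddE Suc_eq_plus1)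
    have 1: "int (Suc k) * int (2 * Suc k choose Suc k) = 2 * int (Suc (2 * k)) * int (2 * k choose k)"
      using central_binomial_Suc[of k] by (metis of_nat_mult of_nat_numeral)
    have d: "fps_nth (fps_deriv CB) n = monom (2 * (int (Suc k) * int (2 * Suc k choose Suc k))) (Suc k)"
    proof -
      have "n + 1 = 2 * Suc k" using n by simp
      then have "fps_nth (fps_deriv CB) n = of_nat (2 * Suc k) * fps_nth CB (2 * Suc k)"
        by simp
      then show ?thesis unfolding CB_nth of_nat_mult_monom by (simp add: algebra_simps)
    qed
    have x: "fps_nth (T * (fps_X * (fps_X * fps_deriv CB))) n = monom (2 * int k * int (2 * k choose k)) (Suc k)"
    proof (cases k)
      case 0
      then show ?thesis using n by (simp add: fps_X2_mult_nth)
    next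
      case (Suc j)
      have "n - 2 = Suc (2 * j)" "\<not> n < 2" "Suc (2 * j) + 1 = 2 * k" using n Suc by auto
      then have "fps_nth (T * (fps_X * (fps_X * fps_deriv CB))) n = [:0, 1:] * (of_nat (2 * k) * fps_nth CB (2 * k))"
        by (simp only: fps_mult_left_const_nth fps_X2_mult_nth fps_deriv_nth if_False)
      then show ?thesis unfolding CB_nth of_nat_mult_monom var_mult_monom by (simp add: algebra_simps)
    qed
    have y: "fps_nth (T * (fps_X * CB)) n = monom (int (2 * k choose k)) (Suc k)"
      using CB_nth(1)[of k] n by (simp add: monom_Suc)
    have "fps_nth (fps_deriv CB - 4 * (T * (fps_X * (fps_X * fps_deriv CB)))) n =
        monom (2 * (int (Suc k) * int (2 * Suc k choose Suc k)) - 4 * (2 * int k * int (2 * k choose k))) (Suc k)"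
      unfolding four fps_sub_nth fps_mult_left_const_nth[of "of_nat 4"] d x of_nat_mult_monom
      by (simp add: diff_monom)
    also have "\<dots> = fps_nth (4 * (T * (fps_X * CB))) n"
      unfolding four fps_mult_left_const_nth[of "of_nat 4"] y of_nat_mult_monom 1
      by (simp add: algebra_simps)
    finally show ?thesis .
  qed
qed

text \<open>By \<open>CB_deriv\<close> the left side has derivative 0, so it equals its constant
  term. This expresses \<open>CB\<close> = (1 - 4 t X^2)^(-1/2) without a root.\<close>

lemma CB_square: "(1 - 4 * T * fps_X\<^sup>2) * CB\<^sup>2 = 1"
proof -
  let ?f = "(1 - 4 * T * fps_X\<^sup>2) * CB\<^sup>2"
  have d4: "fps_deriv (4 * T * fps_X\<^sup>2) = 8 * T * fps_X"
  proof -
    have "fps_deriv (4 * T * fps_X\<^sup>2) = 4 * T * fps_deriv (fps_X\<^sup>2)"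
      using fps_deriv_mult_const_left[of "4 * [:0,1:]" "fps_X\<^sup>2"]
      by (simp add: numeral_fps_const fps_const_mult flip: fps_const_mult)
    also have "\<dots> = 8 * T * fps_X" by (simp add: power2_eq_square algebra_simps)
    finally show ?thesis .
  qed
  have "fps_deriv ?f = - (8 * T * fps_X) * CB\<^sup>2 + 2 * CB * ((1 - 4 * T * fps_X\<^sup>2) * fps_deriv CB)"
    by (simp add: d4 power2_eq_square algebra_simps)
  also have "(1 - 4 * T * fps_X\<^sup>2) * fps_deriv CB = 4 * (T * (fps_X * CB))"
    using CB_deriv by (simp add: power2_eq_square algebra_simps)
  finally have "fps_deriv ?f = 0" by (simp add: power2_eq_square algebra_simps)
  then have "?f = fps_const (fps_nth ?f 0)" by (simp only: fps_deriv_eq_0_iff)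
  also have "fps_nth ?f 0 = 1"
    using CB_nth(1)[of 0] by (simp add: fps_mult_nth power2_eq_square)
  finally show ?thesis by simp
qed

text \<open>Both sides are the square root of 1 - 4 t X^2. On coefficients, with b_j the central
  binomial coefficients and C_j the Catalan numbers, the identity is b_(j+1) - 4 b_j = - 2
  C_j.\<close>

lemma Cat_CB: "1 - 2 * T * fps_X\<^sup>2 * Cat = (1 - 4 * T * fps_X\<^sup>2) * CB"
proof -
  have two: "(2 :: int poly fps) * f = fps_const (of_nat 2) * f" for f
    by (simp add: numeral_fps_const)
  have four: "(4 :: int poly fps) * f = fps_const (of_nat 4) * f" for f
    by (simp add: numeral_fps_const)
  have "1 - 2 * (T * (fps_X * (fps_X * Cat))) = CB - 4 * (T * (fps_X * (fps_X * CB)))"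
  proof (rule fps_ext)
    fix n
    show "fps_nth (1 - 2 * (T * (fps_X * (fps_X * Cat)))) n = fps_nth (CB - 4 * (T * (fps_X * (fps_X * CB)))) n"
    proof (cases "even n")
      case True
      then obtain k where n: "n = 2 * k" by blast
      show ?thesis
      proof (cases k)
        case 0
        then show ?thesis using n CB_nth(1)[of 0] by (simp add: two four)
      next
        case (Suc j)
        have e: "n - 2 = 2 * j" "\<not> n < 2" "n \<noteq> 0" using n Suc by auto
        have "int (Suc j) * (4 * int (2 * j choose j) - int (2 * Suc j choose Suc j)) = int (Suc j) * (2 * catalan j)"
        proof -
          have 1: "int (Suc j) * int (2 * Suc j choose Suc j) = 2 * int (Suc (2 * j)) * int (2 * j choose j)"
            using central_binomial_Suc[of j] by (metis of_nat_mult of_nat_numeral)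
          have "int (Suc j) * (4 * int (2 * j choose j) - int (2 * Suc j choose Suc j)) =
            int (Suc j) * (4 * int (2 * j choose j)) - int (Suc j) * int (2 * Suc j choose Suc j)"
            by (rule right_diff_distrib)
          also have "\<dots> = 2 * int (2 * j choose j)" unfolding 1 by (simp add: algebra_simps)
          also have "\<dots> = int (Suc j) * (2 * catalan j)"
            unfolding Suc_times_catalan[symmetric] by simp
          finally show ?thesis .
        qed
        then have *: "int (2 * Suc j choose Suc j) - 4 * int (2 * j choose j) = - (2 * catalan j)"
          by (simp only: mult_left_cancel)
        have "fps_nth (CB - 4 * (T * (fps_X * (fps_X * CB)))) n =
            monom (int (2 * Suc j choose Suc j) - 4 * int (2 * j choose j)) (Suc j)"
        proof -
          have "fps_nth CB n = monom (int (2 * Suc j choose Suc j)) (Suc j)"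
            using CB_nth(1)[of "Suc j"] n Suc by simp
          moreover have "fps_nth (4 * (T * (fps_X * (fps_X * CB)))) n = monom (4 * int (2 * j choose j)) (Suc j)"
            unfolding four fps_mult_left_const_nth fps_X2_mult_nth
            using e CB_nth(1)[of j]
            by (simp add: monom_Suc of_nat_mult_monom del: of_nat_numeral)
          ultimately show ?thesis by (simp add: diff_monom)
        qed
        also have "\<dots> = monom (- (2 * catalan j)) (Suc j)" unfolding * ..
        also have "\<dots> = fps_nth (1 - 2 * (T * (fps_X * (fps_X * Cat)))) n"
          unfolding two fps_sub_nth fps_mult_left_const_nth fps_X2_mult_nth
          using e Cat_nth(1)[of j]
          by (simp add: monom_Suc of_nat_mult_monom minus_monom del: of_nat_numeral)
        finally show ?thesis by simp
      qed
    next
      case False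
      then obtain k where n: "n = Suc (2 * k)" by (metis oddE Suc_eq_plus1)
      show ?thesis
      proof (cases k)
        case 0
        then show ?thesis using n CB_nth(2)[of 0] by (simp add: two four fps_X2_mult_nth)
      next
        case (Suc j)
        have "n - 2 = Suc (2 * j)" "\<not> n < 2" "n \<noteq> 0" using n Suc by auto
        then show ?thesis
          using CB_nth(2)[of k] CB_nth(2)[of j] Cat_nth(2)[of j] n unfolding two four
          by (simp add: fps_X2_mult_nth)
      qed
    qed
  qed
  then show ?thesis by (simp add: power2_eq_square algebra_simps)
qed

lemma Cat_times_CB: "(1 - 2 * T * fps_X\<^sup>2 * Cat) * CB = 1"
  unfolding Cat_CB using CB_square by (simp add: power2_eq_square mult_ac)

text \<open>The square of \<open>1 - 2 * T * fps_X\<^sup>2 * Cat\<close> is 1 - 4 t X^2; expanding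
  and cancelling 4 t X leaves the quadratic equation of the Catalan series.\<close>

lemma X_Cat_equation: "fps_X * Cat = fps_X + T * fps_X * (fps_X * Cat)\<^sup>2"
proof -
  have T0: "T \<noteq> 0" by simp
  have "(1 - 2 * T * fps_X\<^sup>2 * Cat)\<^sup>2 = (1 - 4 * T * fps_X\<^sup>2) * (CB * (1 - 2 * T * fps_X\<^sup>2 * Cat))"
    unfolding power2_eq_square[of "1 - 2 * T * fps_X\<^sup>2 * Cat"] by (subst Cat_CB) (simp add: mult_ac)
  then have "(1 - 2 * T * fps_X\<^sup>2 * Cat)\<^sup>2 = 1 - 4 * T * fps_X\<^sup>2"
    using Cat_times_CB by (simp add: mult.commute)
  then have "(4 * T * fps_X) * (fps_X * Cat) = (4 * T * fps_X) * (fps_X + T * fps_X * (fps_X * Cat)\<^sup>2)"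
    by (simp add: power2_eq_square algebra_simps)
  moreover have nz: "4 * T * fps_X \<noteq> 0" using T0 by simp
  ultimately show ?thesis using mult_left_cancel[OF nz] by blast
qed

text \<open>Implicit differentiation of \<open>X_Cat_equation\<close>; the factor 1 - 2 t X c that
  appears is inverse to \<open>CB\<close> by \<open>Cat_times_CB\<close>.\<close>

lemma deriv_X_Cat: "fps_deriv (fps_X * Cat) = Cat * CB"
proof -
  define c where "c = fps_X * Cat"
  have eq: "c = fps_X + T * (fps_X * c\<^sup>2)" unfolding c_def using X_Cat_equation by (simp add: mult_ac)
  then have "fps_deriv c = fps_deriv (fps_X + T * (fps_X * c\<^sup>2))" by simp
  then have d: "fps_deriv c = 1 + T * (c\<^sup>2 + 2 * fps_X * c * fps_deriv c)"
    by (simp add: power2_eq_square algebra_simps)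
  have R: "(1 - 2 * T * fps_X * c) * CB = 1"
    using Cat_times_CB by (simp add: c_def power2_eq_square mult_ac)
  have "(1 - 2 * T * fps_X * c) * fps_deriv c = 1 + T * c\<^sup>2"
    using d by algebra
  then have "fps_X * ((1 - 2 * T * fps_X * c) * fps_deriv c) = fps_X * (1 + T * c\<^sup>2)"
    by (simp only:)
  also have "\<dots> = fps_X + T * (fps_X * c\<^sup>2)"
    by (simp add: algebra_simps)
  also have "\<dots> = c" using eq by simp
  finally have "fps_X * ((1 - 2 * T * fps_X * c) * fps_deriv c) * CB = fps_X * (Cat * CB)"
    unfolding c_def by (simp add: mult_ac)
  then have "fps_X * fps_deriv c * ((1 - 2 * T * fps_X * c) * CB) = fps_X * (Cat * CB)"
    by (simp add: mult_ac)
  then have "fps_X * fps_deriv c = fps_X * (Cat * CB)" unfolding R by simp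
  moreover have nz: "(fps_X :: int poly fps) \<noteq> 0" by simp
  ultimately show ?thesis unfolding c_def[symmetric] using mult_left_cancel[OF nz] by blast
qed

subsection \<open>Motzkin and Narayana polynomials\<close>

abbreviation T1 :: "int poly fps" where "T1 \<equiv> fps_const [:1, 1:]"

lemma T1_eq: "T1 = 1 + T"
  by (simp add: fps_eq_iff one_pCons)

text \<open>The coefficient of X^n is the sum over i of c_i binom(n, 2i) t^i, each term multiplied
  by (1 + t)^(n - 2i) in the case of \<open>Nar\<close> and \<open>NarB\<close>. The c_i are Catalan
  numbers for \<open>Mot\<close> and \<open>Nar\<close>, central binomial coefficients for
  \<open>NarB\<close>.\<close>

definition Mot :: "int poly fps" where "Mot = binom_transform 1 Cat"
definition Nar :: "int poly fps" where "Nar = binom_transform [:1, 1:] Cat"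
definition NarB :: "int poly fps" where "NarB = binom_transform [:1, 1:] CB"

lemma Nar_Mot: "Nar = binom_transform [:0, 1:] Mot"
  by (simp add: Nar_def Mot_def binom_transform_binom_transform one_pCons)

text \<open>The Catalan equation after substituting X / (1 - s X); s = 1 gives the Motzkin and s = 1
  + t the Narayana equation.\<close>

lemma X_transform_Cat:
  "fps_X * binom_transform s Cat * (1 - fps_const s * fps_X) =
   fps_X * (1 + T * (fps_X * binom_transform s Cat)\<^sup>2)"
proof -
  let ?sh = "fps_X * geo s" and ?a = "fps_X * binom_transform s Cat"
  have a: "?a = (fps_X * Cat) oo ?sh" by (rule X_mult_binom_transform)
  have "(fps_X * Cat) oo ?sh = (fps_X + T * fps_X * (fps_X * Cat)\<^sup>2) oo ?sh"
    using X_Cat_equation by simp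
  also have "\<dots> = ?sh + T * ?sh * ((fps_X * Cat) oo ?sh)\<^sup>2"
    by (simp add: fps_compose_add_distrib fps_compose_mult_distrib power2_eq_square)
  finally have "?a = ?sh * (1 + T * ?a\<^sup>2)" unfolding a by (simp add: algebra_simps)
  then have "?a * (1 - fps_const s * fps_X) = fps_X * (geo s * (1 - fps_const s * fps_X)) * (1 + T * ?a\<^sup>2)"
    by (metis (no_types, lifting) mult.assoc mult.commute)
  then show ?thesis unfolding geo_mult by simp
qed

lemma Mot_equation: "fps_X * Mot = fps_X * (1 + fps_X * Mot + T * (fps_X * Mot)\<^sup>2)"
  using X_transform_Cat[of 1] unfolding Mot_def[symmetric] by (simp add: algebra_simps)

lemma Nar_equation: "Nar = (1 + fps_X * Nar) * (1 + T * (fps_X * Nar))"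
proof -
  have "fps_X * Nar * (1 - T1 * fps_X) = fps_X * (1 + T * (fps_X * Nar)\<^sup>2)"
    using X_transform_Cat[of "[:1, 1:]"] unfolding Nar_def[symmetric] .
  then have "fps_X * (Nar * (1 - T1 * fps_X)) = fps_X * (1 + T * (fps_X * Nar)\<^sup>2)"
    by (simp only: mult_ac)
  moreover have nz: "(fps_X :: int poly fps) \<noteq> 0" by simp
  ultimately have "Nar * (1 - T1 * fps_X) = 1 + T * (fps_X * Nar)\<^sup>2"
    using mult_left_cancel[OF nz] by blast
  then show ?thesis unfolding T1_eq by (simp add: algebra_simps power2_eq_square)
qed

text \<open>The substitution applied to \<open>deriv_X_Cat\<close>; the chain rule supplies the two
  factors \<open>geo\<close> that complete \<open>CB\<close> and \<open>Cat\<close> to their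
  transforms. Thus \<open>NarB\<close> is X a'/a for a = X Nar.\<close>

lemma deriv_X_Nar: "fps_deriv (fps_X * Nar) = NarB * Nar"
proof -
  let ?sh = "fps_X * geo [:1, 1 :: int:]"
  have "fps_deriv (fps_X * Nar) = (fps_deriv (fps_X * Cat) oo ?sh) * (geo [:1, 1:] * geo [:1, 1:])"
    unfolding Nar_def X_mult_binom_transform by (simp only: fps_compose_deriv shift_0 deriv_shift)
  also have "\<dots> = NarB * Nar"
    unfolding deriv_X_Cat NarB_def Nar_def binom_transform_def
    by (simp add: fps_compose_mult_distrib mult_ac)
  finally show ?thesis .
qed

definition Mot_inv :: "int poly fps" where
  "Mot_inv = fps_right_inverse (1 + fps_X * Mot) 1"

lemma Mot_inv: "(1 + fps_X * Mot) * Mot_inv = 1"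
  unfolding Mot_inv_def by (rule fps_right_inverse) simp

text \<open>Generating function of the Kazhdan--Lusztig polynomials of the whirl matroids: the
  logarithmic derivative of \<open>1 + X Mot\<close>.\<close>

definition Whirl :: "int poly fps" where
  "Whirl = fps_X * fps_deriv (fps_X * Mot) * Mot_inv"

text \<open>Difference of the Kazhdan--Lusztig polynomials of whirls and wheels (in degrees at least 2).\<close>

definition Relax :: "int poly fps" where
  "Relax = T * (fps_X * (fps_X * Mot)\<^sup>2 + (fps_X * Mot) ^ 3) * Mot_inv"

text \<open>Generating function of the contributions to the \<open>Z\<close>-polynomials of wheels and whirls of the
  flats containing a spoke.\<close>

definition hub_part :: "int poly fps" where
  "hub_part = T * (fps_X * Nar + fps_X\<^sup>2 * fps_deriv (fps_X * Nar) * (1 + T * (fps_X * Nar)))"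

section \<open>The substitution X -> X / (1 - t X): from Motzkin to Narayana series\<close>

context
  fixes a :: "int poly fps" and sh :: "int poly fps"
  defines "a \<equiv> fps_X * Nar" and "sh \<equiv> fps_X * geo [:0, 1:]"
begin

private lemma a_comp: "(fps_X * Mot) oo sh = a"
  unfolding a_def sh_def Nar_Mot by (rule X_mult_binom_transform[symmetric])

private lemma sh0: "fps_nth sh 0 = 0"
  by (simp add: sh_def)

private lemma a_comp': "sh * (Mot oo sh) = a"
  using a_comp unfolding fps_compose_mult_distrib[OF sh0] by (simp add: sh0)

private lemma a_eq: "a = fps_X * ((1 + a) * (1 + T * a))"
  unfolding a_def using Nar_equation by simp

private lemma a_sh: "a = sh * (1 + a + T * a\<^sup>2)" and geo_sh: "geo [:0, 1:] = 1 + T * sh"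
proof -
  have g: "geo [:0, 1:] * (1 - T * fps_X) = 1" by (rule geo_mult)
  then show gs: "geo [:0, 1:] = 1 + T * sh"
    unfolding sh_def by (simp add: algebra_simps)
  have "(fps_X * Mot) oo sh = (fps_X * (1 + fps_X * Mot + T * (fps_X * Mot)\<^sup>2)) oo sh"
    using Mot_equation by simp
  also have "\<dots> = sh * (1 + a + T * a\<^sup>2)"
    unfolding fps_compose_mult_distrib[OF sh0] fps_compose_add_distrib power2_eq_square
    by (simp add: sh0 a_comp')
  finally show "a = sh * (1 + a + T * a\<^sup>2)" unfolding a_comp .
qed

private lemma one_plus_a: "1 + a \<noteq> 0"
proof
  assume "1 + a = 0"
  then have "fps_nth (1 + a) 0 = 0" by simp
  then show False by (simp add: a_def)
qed

private lemma one_plus_Ta: "1 + T * a \<noteq> 0"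
proof
  assume "1 + T * a = 0"
  then have "fps_nth (1 + T * a) 0 = 0" by simp
  then show False by (simp add: a_def)
qed

private lemma comp_inv: "(1 + a) * (Mot_inv oo sh) = 1"
proof -
  have "((1 + fps_X * Mot) * Mot_inv) oo sh = 1" unfolding Mot_inv by simp
  then show ?thesis
    unfolding fps_compose_mult_distrib[OF sh0] fps_compose_add_distrib by (simp add: sh0 a_comp')
qed

text \<open>The product of \<open>sh\<close> with the prefactor \<open>geo\<close> is X times the
  derivative of \<open>sh\<close>. So by the chain rule the logarithmic derivative of 1 + X Mot
  becomes that of 1 + a.\<close>

private lemma transform_Whirl: "(1 + a) * binom_transform [:0, 1:] Whirl = fps_X * fps_deriv a"
proof -
  have "fps_deriv a = (fps_deriv (fps_X * Mot) oo sh) * (geo [:0, 1:] * geo [:0, 1:])"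
    unfolding a_comp[symmetric] fps_compose_deriv[OF sh0] unfolding sh_def deriv_shift ..
  moreover have "binom_transform [:0, 1:] Whirl =
     geo [:0, 1:] * (sh * (fps_deriv (fps_X * Mot) oo sh) * (Mot_inv oo sh))"
    unfolding binom_transform_def Whirl_def sh_def[symmetric] fps_compose_mult_distrib[OF sh0]
    using sh0 by simp
  moreover have "(1 + a) * (geo [:0, 1:] * (sh * d * i)) = (1 + a) * i * (geo [:0, 1:] * sh * d)"
    for d i :: "int poly fps"
    by (simp add: mult_ac)
  ultimately show ?thesis
    unfolding sh_def by (simp add: comp_inv[unfolded sh_def] mult_ac)
qed

private lemma deriv_a: "fps_X * fps_deriv a * (1 - T * a\<^sup>2) = a * ((1 + a) * (1 + T * a))"
proof -
  have "fps_deriv a = fps_deriv (fps_X * ((1 + a) * (1 + T * a)))"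
    using a_eq by simp
  then have d: "fps_deriv a = (1 + a) * (1 + T * a) + fps_X * (fps_deriv a * (1 + T * a) + (1 + a) * (T * fps_deriv a))"
    by simp (simp add: algebra_simps)
  show ?thesis using d a_eq by algebra
qed

text \<open>This is X a'/a = 1 + X a'/(1 + a) + t X a'/(1 + t a), the logarithmic derivative of
  \<open>a_eq\<close> multiplied by X, with denominators cleared.\<close>

lemma NarB_decomposition: "NarB = 1 + binom_transform [:0, 1:] Whirl + hub_part"
proof -
  let ?W = "binom_transform [:0, 1:] Whirl" and ?N = "(1 + a) * (1 + T * a)"
  \<comment> \<open>Brings \<open>hub_part\<close>, which is defined in the shape that counting
    words produces, into the form t X a'/(1 + t a).\<close>
  have hub: "(1 + T * a) * hub_part = T * fps_X * fps_deriv a"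
  proof -
    have "hub_part = T * (a + fps_X\<^sup>2 * fps_deriv a * (1 + T * a))"
      unfolding hub_part_def a_def ..
    then have "(1 + a) * fps_X * ((1 + T * a) * hub_part) = (1 + a) * fps_X * (T * fps_X * fps_deriv a)"
      using deriv_a a_eq by algebra
    moreover have nz: "(1 + a) * fps_X \<noteq> 0" using one_plus_a by simp
    ultimately show ?thesis using mult_left_cancel[OF nz] by blast
  qed
  have Y: "NarB * a = fps_X * fps_deriv a"
    using deriv_X_Nar unfolding a_def by (simp add: mult_ac)
  have "(a * ?N) * (NarB - (1 + ?W + hub_part)) = 0"
    using Y hub transform_Whirl deriv_a by algebra
  moreover have "a \<noteq> 0"
  proof
    assume "a = 0"
    then have "fps_nth a 1 = 0" by simp
    then show False by (simp add: a_def Nar_def binom_transform_nth Cat_def catalan_def)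
  qed
  ultimately show ?thesis using one_plus_a one_plus_Ta by simp
qed

text \<open>With s for \<open>sh\<close>, the relation a = s (1 + a + t a^2) gives (1 + a) (a - s) =
  a^2 (1 + t s); multiplying by t (a + s) gives the claim.\<close>

lemma transform_Relax:
  "binom_transform [:0, 1:] Relax = T * (fps_X * Nar)\<^sup>2 - T * (fps_X * geo [:0, 1:])\<^sup>2"
proof -
  let ?D = "binom_transform [:0, 1:] Relax"
  have "?D = geo [:0, 1:] * (T * (sh * a\<^sup>2 + a ^ 3) * (Mot_inv oo sh))"
    unfolding binom_transform_def Relax_def sh_def[symmetric] power3_eq_cube power2_eq_square
    unfolding fps_compose_mult_distrib[OF sh0] fps_compose_add_distrib
    by (simp add: sh0 a_comp')
  then have "(1 + a) * ?D = geo [:0, 1:] * (T * (sh * a\<^sup>2 + a ^ 3)) * ((1 + a) * (Mot_inv oo sh))"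
    by (simp only: mult_ac)
  then have D: "(1 + a) * ?D = (1 + T * sh) * (T * (sh * a\<^sup>2 + a ^ 3))"
    unfolding comp_inv geo_sh by simp
  have "(1 + a) * ?D = (1 + a) * (T * a\<^sup>2 - T * sh\<^sup>2)"
    using D a_sh by algebra
  then have "?D = T * a\<^sup>2 - T * sh\<^sup>2"
    using mult_left_cancel[OF one_plus_a] by blast
  then show ?thesis unfolding a_def sh_def .
qed

end

lemma coeff_one_plus_var_power: "coeff ([:1, 1 :: int:] ^ m) k = int (m choose k)"
proof (induction m arbitrary: k)
  case (Suc m)
  then show ?case by (cases k) (auto simp: coeff_pCons)
qed (simp add: coeff_1)

lemma X_mult_mult_nth_Suc:
  fixes f g :: "'a::comm_ring_1 fps"
  shows "fps_nth (fps_X * (f * g)) (Suc n) = (\<Sum>k\<le>n. fps_nth f k * fps_nth g (n - k))"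
proof -
  have "fps_nth (fps_X * (f * g)) (Suc n) = fps_nth (f * g) n" by simp
  then show ?thesis by (simp only: fps_mult_nth atLeast0AtMost)
qed

lemma X_mult_nth_Suc: "fps_nth (fps_X * f) (Suc n) = fps_nth f n" for f :: "'a::comm_ring_1 fps"
  by simp

lemma var_power: "[:0, 1 :: int:] ^ k = monom 1 k"
  by (simp add: monom_altdef)

abbreviation nar :: "nat \<Rightarrow> int poly" where "nar \<equiv> fps_nth Nar"
abbreviation narB :: "nat \<Rightarrow> int poly" where "narB \<equiv> fps_nth NarB"

text \<open>Indexed by rank: the fan with n spokes gets the Motzkin polynomial of index n - 1. The
  value 1 at 0 makes empty runs neutral in products.\<close>

definition fan_kl :: "nat \<Rightarrow> int poly" where "fan_kl = fps_nth (1 + fps_X * Mot)"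
definition whirl_kl :: "nat \<Rightarrow> int poly" where "whirl_kl = fps_nth Whirl"
definition wheel_kl :: "nat \<Rightarrow> int poly" where "wheel_kl = fps_nth (Whirl - Relax)"

lemma fan_kl_0 [simp]: "fan_kl 0 = 1"
  by (simp add: fan_kl_def)

lemma fan_kl_Suc: "fan_kl (Suc n) = fps_nth Mot n"
  by (simp add: fan_kl_def)

subsubsection \<open>Degrees\<close>

text \<open>\<open>degree_gap 1\<close> is the bound 2 deg < n demanded of Kazhdan--Lusztig
  polynomials. Gaps add up under products, and a factor t costs 2.\<close>

definition degree_gap :: "nat \<Rightarrow> int poly fps \<Rightarrow> bool" where
  "degree_gap d f \<longleftrightarrow> (\<forall>n i. coeff (fps_nth f n) i \<noteq> 0 \<longrightarrow> 2 * i + d \<le> n)"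

lemma degree_gap_mult:
  assumes "degree_gap d f" "degree_gap e g"
  shows "degree_gap (d + e) (f * g)"
  unfolding degree_gap_def
proof (intro allI impI)
  fix n i assume "coeff (fps_nth (f * g) n) i \<noteq> 0"
  then have "(\<Sum>k=0..n. coeff (fps_nth f k * fps_nth g (n - k)) i) \<noteq> 0"
    by (simp add: fps_mult_nth coeff_sum)
  then obtain k where k: "k \<le> n" "coeff (fps_nth f k * fps_nth g (n - k)) i \<noteq> 0"
    by (elim sum.not_neutral_contains_not_neutral) (use atLeastAtMost_iff in blast)
  then have "(\<Sum>j\<le>i. coeff (fps_nth f k) j * coeff (fps_nth g (n - k)) (i - j)) \<noteq> 0"
    by (simp add: coeff_mult)
  then obtain j where j: "j \<le> i" "coeff (fps_nth f k) j * coeff (fps_nth g (n - k)) (i - j) \<noteq> 0"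
    by (elim sum.not_neutral_contains_not_neutral) (use atMost_iff in blast)
  then have "coeff (fps_nth f k) j \<noteq> 0" "coeff (fps_nth g (n - k)) (i - j) \<noteq> 0" by auto
  then have "2 * j + d \<le> k" "2 * (i - j) + e \<le> n - k"
    using assms unfolding degree_gap_def by blast+
  then show "2 * i + (d + e) \<le> n" using k j by linarith
qed

lemma degree_gap_add: "degree_gap d f \<Longrightarrow> degree_gap d g \<Longrightarrow> degree_gap d (f + g)"
  unfolding degree_gap_def by (metis add.right_neutral coeff_add fps_add_nth add_0)

lemma degree_gap_diff: "degree_gap d f \<Longrightarrow> degree_gap d g \<Longrightarrow> degree_gap d (f - g)"
  unfolding degree_gap_def by (metis coeff_diff diff_zero fps_sub_nth)

lemma degree_gap_X: "degree_gap 1 fps_X"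
  by (auto simp: degree_gap_def fps_X_def coeff_1 split: if_splits)

lemma degree_gap_T: "degree_gap (d + 2) f \<Longrightarrow> degree_gap d (T * f)"
  by (force simp: degree_gap_def coeff_pCons split: nat.splits)

lemma degree_gap_Mot: "degree_gap 0 Mot"
  unfolding degree_gap_def
proof (intro allI impI)
  fix n i assume "coeff (fps_nth Mot n) i \<noteq> 0"
  then have "(\<Sum>j\<le>n. coeff (of_nat (n choose j) * fps_nth Cat j) i) \<noteq> 0"
    by (simp add: Mot_def binom_transform_nth coeff_sum)
  then obtain j where "j \<le> n" "coeff (of_nat (n choose j) * fps_nth Cat j) i \<noteq> 0"
    by (elim sum.not_neutral_contains_not_neutral) (use atMost_iff in blast)
  moreover from this have "coeff (fps_nth Cat j) i \<noteq> 0" by (auto simp: of_nat_poly)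
  then have "2 * i \<le> j" by (auto simp: Cat_def split: if_splits)
  ultimately show "2 * i + 0 \<le> n" by linarith
qed

lemma degree_gap_XMot: "degree_gap 1 (fps_X * Mot)"
  using degree_gap_mult[OF degree_gap_X degree_gap_Mot] by simp

lemma degree_gap_X_deriv: "degree_gap d f \<Longrightarrow> degree_gap d (fps_X * fps_deriv f)"
  unfolding degree_gap_def
proof (intro allI impI)
  fix n i assume f: "\<forall>n i. coeff (fps_nth f n) i \<noteq> 0 \<longrightarrow> 2 * i + d \<le> n"
    and nz: "coeff (fps_nth (fps_X * fps_deriv f) n) i \<noteq> 0"
  have "fps_nth (fps_X * fps_deriv f) n = of_nat n * fps_nth f n"
    by (cases n) auto
  then have "coeff (fps_nth f n) i \<noteq> 0" using nz by (auto simp: of_nat_poly)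
  then show "2 * i + d \<le> n" using f by blast
qed

lemma degree_gap_Mot_inv: "degree_gap 0 Mot_inv"
proof -
  have eq: "Mot_inv = 1 - fps_X * Mot * Mot_inv"
    using Mot_inv by (simp add: algebra_simps)
  have "coeff (fps_nth Mot_inv n) i \<noteq> 0 \<Longrightarrow> 2 * i \<le> n" for n i
  proof (induction n arbitrary: i rule: less_induct)
    case (less n)
    have "coeff (fps_nth Mot_inv n) i = coeff (fps_nth (1 - fps_X * Mot * Mot_inv) n) i"
      using eq by simp
    then have "coeff (fps_nth 1 n) i \<noteq> 0 \<or> coeff (fps_nth (fps_X * (Mot * Mot_inv)) n) i \<noteq> (0 :: int)"
      using less.prems by (auto simp: mult.assoc simp del: fps_X_mult_nth)
    then show ?case
    proof
      assume "coeff (fps_nth 1 n) i \<noteq> (0 :: int)"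
      then show ?thesis by (auto simp: coeff_1 split: if_splits)
    next
      assume nz: "coeff (fps_nth (fps_X * (Mot * Mot_inv)) n) i \<noteq> 0"
      then obtain m where n: "n = Suc m" by (cases n) auto
      then have "(\<Sum>k\<le>m. coeff (fps_nth Mot k * fps_nth Mot_inv (m - k)) i) \<noteq> 0"
        using nz unfolding n X_mult_mult_nth_Suc by (simp only: coeff_sum not_False_eq_True)
      then obtain k where k: "k \<le> m" "coeff (fps_nth Mot k * fps_nth Mot_inv (m - k)) i \<noteq> 0"
        by (elim sum.not_neutral_contains_not_neutral) (use atMost_iff in blast)
      then have "(\<Sum>j\<le>i. coeff (fps_nth Mot k) j * coeff (fps_nth Mot_inv (m - k)) (i - j)) \<noteq> 0"
        by (simp add: coeff_mult)
      then obtain j where j: "j \<le> i" "coeff (fps_nth Mot k) j * coeff (fps_nth Mot_inv (m - k)) (i - j) \<noteq> 0"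
        by (elim sum.not_neutral_contains_not_neutral) (use atMost_iff in blast)
      then have "2 * j \<le> k" using degree_gap_Mot unfolding degree_gap_def by force
      moreover have "2 * (i - j) \<le> m - k" using less.IH[of "m - k" "i - j"] j n by auto
      ultimately show ?thesis using k j n by linarith
    qed
  qed
  then show ?thesis by (simp add: degree_gap_def)
qed

lemma degree_gap_Whirl: "degree_gap 1 Whirl"
  unfolding Whirl_def
  using degree_gap_mult[OF degree_gap_X_deriv[OF degree_gap_XMot] degree_gap_Mot_inv] by simp

text \<open>Each summand is a product of three series of gap 1; this pays for the factor t and
  leaves gap 1.\<close>

lemma degree_gap_Relax: "degree_gap 1 Relax"
proof -
  have 2: "degree_gap 2 ((fps_X * Mot)\<^sup>2)"
    using degree_gap_mult[OF degree_gap_XMot degree_gap_XMot]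
    by (simp add: power2_eq_square numeral_2_eq_2)
  have "degree_gap 3 (fps_X * (fps_X * Mot)\<^sup>2)" "degree_gap 3 ((fps_X * Mot) ^ 3)"
    using degree_gap_mult[OF degree_gap_X 2] degree_gap_mult[OF degree_gap_XMot 2]
    by (simp_all add: power3_eq_cube power2_eq_square mult.assoc numeral_3_eq_3)
  then have "degree_gap 1 (T * (fps_X * (fps_X * Mot)\<^sup>2 + (fps_X * Mot) ^ 3))"
    by (intro degree_gap_T degree_gap_add) (simp_all add: numeral_3_eq_3)
  then show ?thesis
    unfolding Relax_def using degree_gap_mult[OF _ degree_gap_Mot_inv] by fastforce
qed

lemma degree_gapD: "degree_gap 1 f \<Longrightarrow> 0 < n \<Longrightarrow> 2 * degree (fps_nth f n) < n"
  unfolding degree_gap_def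
  by (metis Suc_eq_plus1 Suc_le_lessD degree_0 leading_coeff_0_iff mult_0_right)

lemma degree_fan_kl: "0 < n \<Longrightarrow> 2 * degree (fan_kl n) < n"
proof -
  assume n: "0 < n"
  then have "fan_kl n = fps_nth (fps_X * Mot) n" by (simp add: fan_kl_def)
  then show ?thesis using degree_gapD[OF degree_gap_XMot n] by (simp only:)
qed

lemma degree_whirl_kl: "0 < n \<Longrightarrow> 2 * degree (whirl_kl n) < n"
  unfolding whirl_kl_def by (rule degree_gapD[OF degree_gap_Whirl])

lemma degree_wheel_kl: "0 < n \<Longrightarrow> 2 * degree (wheel_kl n) < n"
  unfolding wheel_kl_def by (rule degree_gapD[OF degree_gap_diff[OF degree_gap_Whirl degree_gap_Relax]])

lemma Relax_low: "fps_nth Relax 0 = 0" "fps_nth Relax 1 = 0"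
proof -
  have "Relax = fps_X * (fps_X * (T * (fps_X * Mot\<^sup>2 + fps_X * Mot ^ 3) * Mot_inv))"
    by (simp add: Relax_def power3_eq_cube power2_eq_square algebra_simps)
  then show "fps_nth Relax 0 = 0" "fps_nth Relax 1 = 0" by (metis fps_X2_mult_nth one_less_numeral_iff pos2 semiring_norm(76))+
qed

lemma Whirl_low: "fps_nth Whirl 0 = 0" "fps_nth Whirl 1 = 1"
proof -
  have W: "Whirl = fps_X * (fps_deriv (fps_X * Mot) * Mot_inv)"
    by (simp add: Whirl_def mult_ac)
  have "fps_nth ((1 + fps_X * Mot) * Mot_inv) 0 = 1" unfolding Mot_inv by simp
  then have "fps_nth Mot_inv 0 = 1" by simp
  moreover have "fps_nth Mot 0 = 1"
    by (simp add: Mot_def binom_transform_nth Cat_def catalan_def)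
  ultimately show "fps_nth Whirl 0 = 0" "fps_nth Whirl 1 = 1" unfolding W by simp_all
qed

text \<open>The rim has no block and no spoke and is not a flat of the whirl; the value 0 of
  \<open>whirl_kl\<close> at 0 makes it contribute nothing.\<close>

lemma kl_low: "whirl_kl 0 = 0" "wheel_kl 0 = 0" "whirl_kl (Suc 0) = 1" "wheel_kl (Suc 0) = 1"
  using Whirl_low Relax_low by (simp_all add: whirl_kl_def wheel_kl_def)

subsubsection \<open>Recurrences\<close>

lemma nar_eq_sum: "nar n = (\<Sum>j\<le>n. of_nat (n choose j) * monom 1 (n - j) * fan_kl (Suc j))"
  unfolding Nar_Mot by (simp add: binom_transform_nth var_power fan_kl_Suc)

lemma Nar_expand: "Nar = 1 + T1 * (fps_X * Nar) + T * (fps_X * (fps_X * (Nar * Nar)))"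
  unfolding T1_eq by (subst Nar_equation) (simp add: algebra_simps)

lemma nar_0: "nar 0 = 1"
  by (subst Nar_expand) simp

lemma nar_Suc:
  "nar (Suc n) = [:1, 1:] * nar n + [:0, 1:] * (\<Sum>d<n. nar d * nar (n - 1 - d))"
proof -
  have "nar (Suc n) = fps_nth (1 + T1 * (fps_X * Nar) + T * (fps_X * (fps_X * (Nar * Nar)))) (Suc n)"
    using Nar_expand by simp
  also have "\<dots> = [:1, 1:] * nar n + [:0, 1:] * fps_nth (fps_X * (Nar * Nar)) n"
    by (simp only: fps_add_nth fps_mult_left_const_nth fps_X_mult_nth fps_one_nth) simp
  also have "fps_nth (fps_X * (Nar * Nar)) n = (\<Sum>d<n. nar d * nar (n - 1 - d))"
    by (cases n) (simp_all only: X_mult_mult_nth_Suc lessThan_Suc_atMost, simp_all)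
  finally show ?thesis .
qed

lemma sum_triangle: "(\<Sum>c<m. \<Sum>d<c. g d) = (\<Sum>d<m. of_nat (m - 1 - d) * g d)" for g :: "nat \<Rightarrow> int poly"
proof (induction m)
  case (Suc m)
  have "(\<Sum>d<Suc m. of_nat (Suc m - 1 - d) * g d) = (\<Sum>d<m. of_nat (m - 1 - d) * g d + g d)"
    by (auto intro!: sum.cong simp: algebra_simps of_nat_diff Suc_diff_le)
  then show ?case using Suc by (simp add: sum.distrib)
qed simp

text \<open>The shape in which words produce these coefficients in
  \<open>upper_sum_Bar_Start_total\<close>. The derivative in \<open>hub_part\<close> supplies
  multiplicities, which \<open>sum_triangle\<close> unfolds into a double sum.\<close>

lemma hub_part_nth:
  "fps_nth hub_part (Suc m) = [:0, 1:] * (nar m + (\<Sum>c<m. nar (m - 1) + [:0, 1:] * (\<Sum>d<c. nar d * nar (m - 2 - d))))"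
proof -
  let ?a' = "fps_deriv (fps_X * Nar)"
  have a': "fps_nth ?a' n = of_nat (Suc n) * nar n" for n
    by (simp add: fps_deriv_nth del: fps_deriv_mult)
  have hp: "hub_part = T * (fps_X * Nar + fps_X * (fps_X * (?a' + T * (fps_X * (Nar * ?a')))))"
    by (simp add: hub_part_def power2_eq_square algebra_simps del: fps_deriv_mult)
  have conv: "fps_nth (fps_X * (Nar * ?a')) n = (\<Sum>d<n. of_nat (n - d) * (nar d * nar (n - 1 - d)))" for n
  proof (cases n)
    case (Suc k)
    have "fps_nth (fps_X * (Nar * ?a')) n = (\<Sum>d\<le>k. nar d * (of_nat (Suc (k - d)) * nar (k - d)))"
      unfolding Suc X_mult_mult_nth_Suc a' ..
    also have "\<dots> = (\<Sum>d<n. of_nat (n - d) * (nar d * nar (n - 1 - d)))"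
      unfolding Suc lessThan_Suc_atMost by (intro sum.cong) (auto simp: Suc_diff_le mult_ac simp del: of_nat_Suc)
    finally show ?thesis .
  qed simp
  show ?thesis
  proof (cases m)
    case 0
    then show ?thesis unfolding hp by simp
  next
    case (Suc n)
    have "fps_nth hub_part (Suc m) = [:0, 1:] * (nar m + (of_nat (Suc n) * nar n + [:0, 1:] * (\<Sum>d<n. of_nat (n - d) * (nar d * nar (n - 1 - d)))))"
      unfolding hp Suc by (simp only: fps_mult_left_const_nth fps_add_nth X_mult_nth_Suc conv a')
    also have "(\<Sum>d<n. of_nat (n - d) * (nar d * nar (n - 1 - d))) = (\<Sum>c<m. \<Sum>d<c. nar d * nar (n - 1 - d))"
      unfolding sum_triangle Suc by simp
    finally show ?thesis
      unfolding Suc sum.distrib sum_distrib_left[symmetric] sum_constant card_lessThan by simp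
  qed
qed

lemma narB_decomposition:
  assumes "m \<ge> 1"
  shows "narB m = (\<Sum>k\<le>m. of_nat (m choose k) * monom 1 (m - k) * whirl_kl k) + fps_nth hub_part m"
  using assms by (subst NarB_decomposition) (simp add: binom_transform_nth var_power whirl_kl_def)

text \<open>By \<open>Nar_expand\<close>, what is subtracted from \<open>narB m\<close> is, for m at
  least 1, the coefficient of t (X Nar)^2, the main part of the transform of
  \<open>Relax\<close>.\<close>

definition wheel_Z :: "nat \<Rightarrow> int poly" where
  "wheel_Z m = narB m - nar m + [:1, 1:] * nar (m - 1)"

text \<open>The term k = 1 of the full transform is m t^(m-1), one summand for each way to keep a
  single block. The second part of \<open>transform_Relax\<close> cancels m - 1 of these; the
  remaining t^(m-1) is the contribution of the rim.\<close>

lemma wheel_Z_decomposition: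
  assumes "m \<ge> 2"
  shows "wheel_Z m = (\<Sum>k\<in>{2..m}. of_nat (m choose k) * monom 1 (m - k) * wheel_kl k)
    + monom 1 (m - 1) + fps_nth hub_part m"
proof -
  let ?c = "\<lambda>k. of_nat (m choose k) * monom 1 (m - k) :: int poly"
  obtain n where m: "m = Suc n" "n \<ge> 1" using assms by (cases m) auto
  have "T * (fps_X * Nar)\<^sup>2 = Nar - 1 - T1 * (fps_X * Nar)"
    by (subst (2) Nar_expand) (simp add: power2_eq_square algebra_simps)
  then have 1: "fps_nth (T * (fps_X * Nar)\<^sup>2) m = nar m - [:1, 1:] * nar n"
    using m by simp
  have "T * (fps_X * geo [:0, 1:])\<^sup>2 = T * (fps_X * (geo [:0, 1:] * (fps_X * geo [:0, 1:]) ^ 1))"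
    by (simp add: power2_eq_square mult_ac)
  then have "fps_nth (T * (fps_X * geo [:0, 1:])\<^sup>2) m = [:0, 1:] * (of_nat (n choose 1) * [:0, 1:] ^ (n - 1))"
    using geo_power_nth[of "[:0, 1:]" 1 n] m by simp
  then have 2: "fps_nth (T * (fps_X * geo [:0, 1:])\<^sup>2) m = of_nat n * monom 1 n"
    using m by (cases n) (simp_all add: var_power monom_Suc mult_ac)
  have "fps_nth (binom_transform [:0, 1:] Relax) m = nar m - [:1, 1:] * nar n - of_nat n * monom 1 n"
    unfolding transform_Relax fps_sub_nth 1 2 ..
  then have "(\<Sum>k\<le>m. ?c k * fps_nth Relax k) = nar m - [:1, 1:] * nar n - of_nat n * monom 1 n"
    unfolding binom_transform_nth var_power .
  then have "(\<Sum>k\<le>m. ?c k * wheel_kl k) =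
      (\<Sum>k\<le>m. ?c k * whirl_kl k) - (nar m - [:1, 1:] * nar n - of_nat n * monom 1 n)"
    by (simp add: wheel_kl_def whirl_kl_def right_diff_distrib sum_subtractf)
  moreover have "(\<Sum>k\<le>m. ?c k * wheel_kl k) = of_nat m * monom 1 n + (\<Sum>k\<in>{2..m}. ?c k * wheel_kl k)"
  proof -
    have "{..m} = insert 0 (insert 1 {2..m})" using assms by auto
    then show ?thesis using m by (simp add: kl_low)
  qed
  ultimately show ?thesis
    using narB_decomposition[of m] m by (simp add: wheel_Z_def algebra_simps)
qed

subsubsection \<open>Closed forms\<close>

text \<open>Only the indices j = 2i contribute, each with c_i t^i; there remains the coefficient of
  t^(k - i) in (1 + t)^(n - 2i), so terms with i > k vanish.\<close>

lemma coeff_transform: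
  assumes C: "\<And>i. fps_nth C (2 * i) = monom (c i) i" "\<And>i. fps_nth C (Suc (2 * i)) = 0"
    and k: "k \<le> n"
  shows "coeff (fps_nth (binom_transform [:1, 1:] C) n) k =
    (\<Sum>i\<le>k. int (n choose (2 * i)) * int ((n - 2 * i) choose (k - i)) * c i)"
proof -
  let ?g = "\<lambda>j. int (n choose j) * coeff ([:1, 1:] ^ (n - j) * fps_nth C j) k"
  have "coeff (fps_nth (binom_transform [:1, 1:] C) n) k = (\<Sum>j\<le>n. ?g j)"
    by (simp add: binom_transform_nth coeff_sum of_nat_poly mult.assoc)
  also have "\<dots> = (\<Sum>j\<le>2 * n. ?g j)"
    by (intro sum.mono_neutral_left) (auto simp: binomial_eq_0)
  also have "\<dots> = (\<Sum>j\<in>(\<lambda>i. 2 * i) ` {..n}. ?g j)"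
  proof (intro sum.mono_neutral_right ballI)
    fix j assume j: "j \<in> {..2 * n} - (\<lambda>i. 2 * i) ` {..n}"
    have "odd j"
    proof
      assume "even j"
      then obtain i where "j = 2 * i" by blast
      then show False using j by auto
    qed
    then obtain i where "j = Suc (2 * i)" by (metis oddE Suc_eq_plus1)
    then show "?g j = 0" using C(2) by simp
  qed auto
  also have "\<dots> = (\<Sum>i\<le>n. ?g (2 * i))"
    by (subst sum.reindex) (auto simp: inj_on_def)
  also have "\<dots> = (\<Sum>i\<le>k. ?g (2 * i))"
  proof (rule sum.mono_neutral_right)
    show "\<forall>i\<in>{..n} - {..k}. ?g (2 * i) = 0"
      by (auto simp: C(1) coeff_monom_mult mult.commute[of _ "monom _ _"])
  qed (use k in auto)
  also have "\<dots> = (\<Sum>i\<le>k. int (n choose (2 * i)) * int ((n - 2 * i) choose (k - i)) * c i)"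
    by (intro sum.cong)
       (auto simp: C(1) coeff_monom_mult mult.commute[of _ "monom _ _"] coeff_one_plus_var_power)
  finally show ?thesis .
qed

text \<open>For i + k \<le> n both sides are n! / (i! i! (k - i)! (n - k - i)!); otherwise both
  vanish.\<close>

lemma binomial_product:
  assumes "i \<le> k" "k \<le> n"
  shows "(n choose (2 * i)) * ((n - 2 * i) choose (k - i)) * (2 * i choose i) =
         (n choose k) * (k choose i) * ((n - k) choose i)"
proof (cases "i + k \<le> n")
  case True
  have "2 * i \<le> n" using assms True by linarith
  have "(n choose (2 * i)) * (2 * i choose i) = (n choose i) * ((n - i) choose i)"
    using choose_mult[of i "2 * i" n] \<open>2 * i \<le> n\<close> by (simp add: mult_2)
  moreover have "((n - i) choose k) * (k choose i) = ((n - i) choose i) * ((n - 2 * i) choose (k - i))"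
    using choose_mult[of i k "n - i"] assms True by (simp add: mult_2)
  moreover have "(n choose (i + k)) * ((i + k) choose i) = (n choose i) * ((n - i) choose k)"
    using choose_mult[of i "i + k" n] True by simp
  moreover have "(n choose (i + k)) * ((i + k) choose k) = (n choose k) * ((n - k) choose i)"
    using choose_mult[of k "i + k" n] True by simp
  moreover have "((i + k) choose k) = ((i + k) choose i)"
    using binomial_symmetric[of k "i + k"] by simp
  ultimately show ?thesis by (metis mult.assoc mult.commute)
next
  case False
  then have "(n - k) choose i = 0" using assms by (intro binomial_eq_0) simp
  moreover have "(n choose (2 * i)) = 0 \<or> (n - 2 * i) choose (k - i) = 0"
    using False assms by (cases "2 * i \<le> n") (auto simp: binomial_eq_0)
  ultimately show ?thesis by (elim disjE) (simp_all only: mult_0 mult_0_right)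
qed

text \<open>Vandermonde's identity after passing from r + i to its complement in m.\<close>

lemma vandermonde_complement:
  assumes "r \<le> m"
  shows "(\<Sum>i\<le>k. (k choose i) * (m choose (r + i))) = (k + m) choose (k + r)"
proof -
  have "(k + m) choose (k + r) = (k + m) choose (m - r)"
    using binomial_symmetric[of "k + r" "k + m"] assms by simp
  also have "\<dots> = (\<Sum>i\<le>m - r. (k choose i) * (m choose (m - r - i)))"
    by (rule vandermonde[symmetric])
  also have "\<dots> = (\<Sum>i\<le>m - r. (k choose i) * (m choose (r + i)))"
    using assms by (intro sum.cong refl) (auto simp: binomial_symmetric[of "r + _" m])
  also have "\<dots> = (\<Sum>i\<le>k + m. (k choose i) * (m choose (r + i)))"
    using assms by (intro sum.mono_neutral_left) (auto simp: binomial_eq_0)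
  also have "\<dots> = (\<Sum>i\<le>k. (k choose i) * (m choose (r + i)))"
    by (intro sum.mono_neutral_right) (auto simp: binomial_eq_0)
  finally show ?thesis ..
qed

lemma coeff_narB: "k \<le> n \<Longrightarrow> coeff (narB n) k = (int (n choose k))\<^sup>2"
proof -
  assume k: "k \<le> n"
  have "coeff (narB n) k = (\<Sum>i\<le>k. int (n choose (2 * i)) * int ((n - 2 * i) choose (k - i)) * int (2 * i choose i))"
    unfolding NarB_def by (rule coeff_transform[OF CB_nth k])
  also have "\<dots> = int (\<Sum>i\<le>k. (n choose k) * ((k choose i) * ((n - k) choose i)))"
    unfolding of_nat_sum using binomial_product[OF _ k]
    by (intro sum.cong refl) (metis atMost_iff mult.assoc of_nat_mult)
  also have "(\<Sum>i\<le>k. (n choose k) * ((k choose i) * ((n - k) choose i))) = (n choose k)\<^sup>2"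
    using vandermonde_complement[of 0 "n - k" k] k
    by (simp add: power2_eq_square flip: sum_distrib_left)
  finally show ?thesis by simp
qed

text \<open>The denominator i + 1 of the Catalan number turns binom(n - k, i) into binom(n - k + 1,
  i + 1) / (n - k + 1); then Vandermonde with shift r = 1 applies. Multiplying out n + 1 and n - k +
  1 keeps everything in the integers.\<close>

lemma coeff_nar:
  assumes k: "k \<le> n"
  shows "int (n + 1) * coeff (nar n) k = int ((n + 1) choose (k + 1)) * int ((n + 1) choose k)"
proof -
  have *: "int (n - k + 1) * (int (n choose (2 * i)) * int ((n - 2 * i) choose (k - i)) * catalan i) =
      int ((n choose k) * ((k choose i) * ((n - k + 1) choose (i + 1))))" if "i \<le> k" for i
  proof -
    have 1: "int (Suc i) * int ((n - k + 1) choose (i + 1)) = int (n - k + 1) * int ((n - k) choose i)"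
      using Suc_times_binomial[of i "n - k"] by (metis Suc_eq_plus1 of_nat_mult)
    have 2: "int (n choose (2 * i)) * int ((n - 2 * i) choose (k - i)) * int (2 * i choose i) =
         int (n choose k) * int (k choose i) * int ((n - k) choose i)"
      using binomial_product[OF that k] by (metis of_nat_mult)
    have "int (Suc i) * (int (n - k + 1) * (int (n choose (2 * i)) * int ((n - 2 * i) choose (k - i)) * catalan i)) =
      int (n - k + 1) * (int (n choose (2 * i)) * int ((n - 2 * i) choose (k - i)) * (int (Suc i) * catalan i))"
      by (simp only: mult_ac)
    also have "\<dots> = int (n - k + 1) * (int (n choose k) * int (k choose i) * int ((n - k) choose i))"
      unfolding Suc_times_catalan 2 ..
    also have "\<dots> = int (n choose k) * int (k choose i) * (int (Suc i) * int ((n - k + 1) choose (i + 1)))"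
      unfolding 1 by (simp only: mult_ac)
    also have "\<dots> = int (Suc i) * int ((n choose k) * ((k choose i) * ((n - k + 1) choose (i + 1))))"
      by (simp only: of_nat_mult mult_ac)
    finally have eq: "int (Suc i) * (int (n - k + 1) * (int (n choose (2 * i)) * int ((n - 2 * i) choose (k - i)) * catalan i)) =
      int (Suc i) * int ((n choose k) * ((k choose i) * ((n - k + 1) choose (i + 1))))" .
    have nz: "int (Suc i) \<noteq> 0" by simp
    show ?thesis using eq mult_left_cancel[OF nz] by blast
  qed
  have "int (n - k + 1) * coeff (nar n) k =
     (\<Sum>i\<le>k. int (n - k + 1) * (int (n choose (2 * i)) * int ((n - 2 * i) choose (k - i)) * catalan i))"
    unfolding Nar_def coeff_transform[OF Cat_nth k] by (rule sum_distrib_left)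
  also have "\<dots> = int (\<Sum>i\<le>k. (n choose k) * ((k choose i) * ((n - k + 1) choose (1 + i))))"
    unfolding of_nat_sum using * by (intro sum.cong refl) (simp add: add.commute)
  also have "(\<Sum>i\<le>k. (n choose k) * ((k choose i) * ((n - k + 1) choose (1 + i)))) =
      (n choose k) * ((n + 1) choose (k + 1))"
    using vandermonde_complement[of 1 "n - k + 1" k] k by (simp flip: sum_distrib_left)
  finally have nk: "int (n - k + 1) * coeff (nar n) k = int (n choose k) * int ((n + 1) choose (k + 1))"
    by simp
  have "int (n + 1) * int (n choose k) = int (n - k + 1) * int ((n + 1) choose k)"
  proof -
    have "(Suc n - k) * (Suc n choose k) = Suc n * (n choose k)"
      using binomial_absorb_comp[of "Suc n" k] by simp
    then show ?thesis using k by (metis Suc_diff_le Suc_eq_plus1 of_nat_mult)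
  qed
  then have "int (n - k + 1) * (int (n + 1) * coeff (nar n) k) =
      int (n - k + 1) * (int ((n + 1) choose (k + 1)) * int ((n + 1) choose k))"
    using nk by (metis mult.assoc mult.commute)
  then show ?thesis by (simp only: mult_left_cancel of_nat_eq_0_iff add_is_0 one_neq_zero simp_thms)
qed

lemma degree_transform_le:
  fixes c :: "nat \<Rightarrow> int"
  assumes "\<And>i. fps_nth C (2 * i) = monom (c i) i" "\<And>i. fps_nth C (Suc (2 * i)) = 0"
  shows "degree (fps_nth (binom_transform [:1, 1:] C) n) \<le> n"
  unfolding binom_transform_nth
proof (rule degree_sum_le)
  fix j assume j: "j \<in> {..n}"
  have "degree ([:1, 1 :: int:] ^ (n - j)) \<le> n - j"
    using degree_power_le[of "[:1, 1 :: int:]" "n - j"] by simp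
  moreover have "degree (fps_nth C j) \<le> j"
  proof (cases "even j")
    case True
    then obtain i where "j = 2 * i" by blast
    then show ?thesis using assms(1)[of i] degree_monom_le[of "c i" i] by simp
  next
    case False
    then obtain i where "j = Suc (2 * i)" by (metis oddE Suc_eq_plus1)
    then show ?thesis using assms(2)[of i] by simp
  qed
  moreover have "degree (of_nat (n choose j) * [:1, 1 :: int:] ^ (n - j)) \<le> degree ([:1, 1 :: int:] ^ (n - j))"
    by (simp add: of_nat_poly degree_smult_le)
  ultimately show "degree (of_nat (n choose j) * [:1, 1:] ^ (n - j) * fps_nth C j) \<le> n"
    using degree_mult_le[of "of_nat (n choose j) * [:1, 1:] ^ (n - j)" "fps_nth C j"] j
    unfolding atMost_iff by linarith
qed simp

lemma palindromic_nar: "palindromic n (nar n)"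
proof -
  have "degree (nar n) \<le> n" unfolding Nar_def by (rule degree_transform_le[OF Cat_nth])
  moreover have "coeff (nar n) (n - i) = coeff (nar n) i" if i: "i \<le> n" for i
  proof -
    have "(n + 1) choose (n - i + 1) = (n + 1) choose i" "(n + 1) choose (n - i) = (n + 1) choose (i + 1)"
      using binomial_symmetric[of i "n + 1"] binomial_symmetric[of "i + 1" "n + 1"] i
      by (auto simp: Suc_diff_le)
    then have "int (n + 1) * coeff (nar n) (n - i) = int (n + 1) * coeff (nar n) i"
      using coeff_nar[of "n - i" n] coeff_nar[OF i] by simp
    then show ?thesis by simp
  qed
  ultimately show ?thesis by (simp add: palindromic_def)
qed

lemma palindromic_narB: "palindromic n (narB n)"
proof -
  have "degree (narB n) \<le> n" unfolding NarB_def by (rule degree_transform_le[OF CB_nth])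
  then show ?thesis
    by (auto simp: palindromic_def coeff_narB binomial_symmetric[symmetric])
qed

lemma palindromic_wheel_Z:
  assumes "m \<ge> 1"
  shows "palindromic m (wheel_Z m)"
proof -
  have "palindromic 1 [:1, 1 :: int:]"
    by (auto simp: palindromic_def coeff_pCons split: nat.splits)
  then have "palindromic (1 + (m - 1)) ([:1, 1:] * nar (m - 1))"
    by (rule palindromic_mult[OF _ palindromic_nar])
  then show ?thesis
    unfolding wheel_Z_def using assms
    by (intro palindromic_add palindromic_diff palindromic_nar palindromic_narB) simp
qed

subsection \<open>Words encoding flats\<close>

text \<open>The letter of a rim vertex records whether its spoke lies in the flat (\<open>Hub\<close>), or else
  whether the preceding rim edge does (\<open>Cont\<close>) or does not (\<open>Start\<close>, as the vertex starts a
  block of the contraction). The letter \<open>Bar\<close> occurs only in lower bounds: it stands for a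
  \<open>Start\<close> that must not be replaced by \<open>Hub\<close>.\<close>

datatype letter = Hub | Start | Cont | Bar

text \<open>The flag tells whether the preceding rim vertex is joined to the hub in the larger flat.\<close>

definition step :: "bool \<Rightarrow> letter \<Rightarrow> letter \<Rightarrow> bool" where
  "step b x y \<longleftrightarrow> (case x of
      Hub \<Rightarrow> y = Hub
    | Start \<Rightarrow> y = Hub \<or> y = Start \<or> y = Cont \<and> \<not> b
    | Bar \<Rightarrow> y = Start \<or> y = Cont \<and> \<not> b
    | Cont \<Rightarrow> y = (if b then Hub else Cont))"

fun above :: "bool \<Rightarrow> letter list \<Rightarrow> letter list \<Rightarrow> bool" where
  "above b [] [] = True"
| "above b (x # w) (y # v) = (step b x y \<and> above (y = Hub) w v)"
| "above b _ _ = False"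

definition blocks :: "letter list \<Rightarrow> nat" where
  "blocks w = length (filter (\<lambda>x. x = Start \<or> x = Bar) w)"

text \<open>Contraction identifies the hub vertices with the hub and so cuts the fan into smaller
  fans, one for each stretch between letters \<open>Hub\<close>; k counts the blocks of the current
  stretch. The weight is the product of their candidates.\<close>

fun run_weight :: "nat \<Rightarrow> letter list \<Rightarrow> int poly" where
  "run_weight k [] = fan_kl k"
| "run_weight k (Hub # v) = fan_kl k * run_weight 0 v"
| "run_weight k (Cont # v) = run_weight k v"
| "run_weight k (_ # v) = run_weight (Suc k) v"

text \<open>Here k is the number of blocks of the larger word since its last \<open>Hub\<close>, and
  it determines the flag: k = 0 means that the preceding vertex is a hub vertex or does not exist,
  and then \<open>Cont\<close> cannot come next.\<close>

definition upper_sum :: "nat \<Rightarrow> letter list \<Rightarrow> int poly" where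
  "upper_sum k w = (\<Sum>v\<in>{v. above (k = 0) w v}. monom 1 (blocks w - blocks v) * run_weight k v)"

lemma blocks_simps [simp]:
  "blocks [] = 0" "blocks (Hub # w) = blocks w" "blocks (Cont # w) = blocks w"
  "blocks (Start # w) = Suc (blocks w)" "blocks (Bar # w) = Suc (blocks w)"
  "blocks (u @ w) = blocks u + blocks w"
  by (simp_all add: blocks_def)

lemma above_Nil [simp]: "above b [] v \<longleftrightarrow> v = []"
  by (cases v) auto

lemma above_Cons: "above b (x # w) v \<longleftrightarrow> (\<exists>y v'. v = y # v' \<and> step b x y \<and> above (y = Hub) w v')"
  by (cases v) auto

lemma above_length: "above b w v \<Longrightarrow> length v = length w"
  by (induction b w v rule: above.induct) auto

lemma letter_UNIV: "(UNIV :: letter set) = {Hub, Start, Cont, Bar}"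
proof -
  have "x \<in> {Hub, Start, Cont, Bar}" for x by (cases x) auto
  then show ?thesis by blast
qed

lemma finite_letters [simp]: "finite (A :: letter set)"
  by (rule finite_subset[OF subset_UNIV]) (simp add: letter_UNIV)

lemma finite_above [simp]: "finite {v. above b w v}"
proof (rule finite_subset)
  show "{v. above b w v} \<subseteq> {v. set v \<subseteq> UNIV \<and> length v = length w}"
    using above_length by auto
  show "finite {v. set v \<subseteq> (UNIV :: letter set) \<and> length v = length w}"
    by (rule finite_lists_length_eq) simp
qed

lemma step_simps [simp]:
  "step b Hub y \<longleftrightarrow> y = Hub"
  "step b Start y \<longleftrightarrow> y = Hub \<or> y = Start \<or> y = Cont \<and> \<not> b"
  "step b Bar y \<longleftrightarrow> y = Start \<or> y = Cont \<and> \<not> b"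
  "step b Cont y \<longleftrightarrow> y = (if b then Hub else Cont)"
  by (simp_all add: step_def)

lemma blocks_above: "above b w v \<Longrightarrow> blocks v \<le> blocks w"
proof (induction b w v rule: above.induct)
  case (2 b x w y v)
  then show ?case by (cases x; cases y) (auto split: if_splits)
qed auto

lemma above_Cons_sum:
  "(\<Sum>v\<in>{v. above b (x # w) v}. f v) = (\<Sum>y\<in>{y. step b x y}. \<Sum>v\<in>{v. above (y = Hub) w v}. f (y # v))"
proof -
  have eq: "{v. above b (x # w) v} = (\<lambda>(y, v). y # v) ` (SIGMA y:{y. step b x y}. {v. above (y = Hub) w v})"
    by (auto simp: above_Cons)
  have "inj_on (\<lambda>(y, v). y # v) A" for A :: "(letter \<times> letter list) set"
    by (auto simp: inj_on_def)
  then show ?thesis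
    unfolding eq by (subst sum.reindex) (simp_all add: sum.Sigma case_prod_unfold)
qed

lemma monom_shift: "k \<le> m \<Longrightarrow> monom 1 (Suc m - k) * p = monom 1 1 * (monom 1 (m - k) * p)" for p :: "int poly"
  by (simp add: mult_monom Suc_diff_le flip: mult.assoc)

lemma upper_sum_Nil [simp]: "upper_sum k [] = fan_kl k"
  by (simp add: upper_sum_def)

lemma upper_sum_Hub: "upper_sum k (Hub # w) = fan_kl k * upper_sum 0 w"
  by (simp add: upper_sum_def above_Cons_sum sum_distrib_left mult_ac)

lemma upper_sum_Cont: "upper_sum k (Cont # w) = upper_sum k w"
  by (cases "k = 0") (simp_all add: upper_sum_def above_Cons_sum)

lemma sum_above_shift:
  fixes f :: "letter list \<Rightarrow> int poly"
  shows "(\<Sum>v\<in>{v. above b w v}. monom 1 (Suc (blocks w) - blocks v) * f v) =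
   monom 1 1 * (\<Sum>v\<in>{v. above b w v}. monom 1 (blocks w - blocks v) * f v)"
  unfolding sum_distrib_left by (intro sum.cong refl monom_shift) (auto intro: blocks_above)

lemma upper_sum_Bar: "upper_sum k (Bar # w) = upper_sum (Suc k) w + (if k = 0 then 0 else monom 1 1 * upper_sum k w)"
proof -
  have eq: "{y. step b Bar y} = (if b then {Start} else {Start, Cont})" for b
    by auto
  show ?thesis
    unfolding upper_sum_def above_Cons_sum eq
    by (cases k) (simp_all add: sum_above_shift)
qed

text \<open>The block joins the hub at cost t and closes the run, or it stays, or it merges at cost
  t with the preceding block, which exists only for k > 0.\<close>

lemma upper_sum_Start:
  "upper_sum k (Start # w) = monom 1 1 * (fan_kl k * upper_sum 0 w) + upper_sum (Suc k) w
    + (if k = 0 then 0 else monom 1 1 * upper_sum k w)"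
proof -
  have eq: "{y. step b Start y} = (if b then {Hub, Start} else {Hub, Start, Cont})" for b
    by auto
  have h: "(\<Sum>v\<in>{v. above True w v}. monom 1 (Suc (blocks w) - blocks v) * (fan_kl k * run_weight 0 v)) =
      monom 1 1 * (fan_kl k * (\<Sum>v\<in>{v. above True w v}. monom 1 (blocks w - blocks v) * run_weight 0 v))"
    unfolding sum_above_shift by (simp add: sum_distrib_left mult_ac)
  show ?thesis
    unfolding upper_sum_def above_Cons_sum eq using h
    by (cases k) (simp_all add: sum_above_shift add_ac)
qed

lemma run_weight_split: "run_weight k (u @ Hub # w) = run_weight k u * run_weight 0 w"
  by (induction k u rule: run_weight.induct) (simp_all add: mult.assoc)

text \<open>A \<open>Hub\<close> of the lower word persists in every larger word, so the interval is
  a product of intervals.\<close>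

lemma upper_sum_split: "upper_sum k (u @ Hub # w) = upper_sum k u * upper_sum 0 w"
proof (induction u arbitrary: k)
  case (Cons x u)
  then show ?case
    by (cases x) (simp_all add: upper_sum_Hub upper_sum_Cont upper_sum_Bar upper_sum_Start algebra_simps)
qed (simp add: upper_sum_Hub)

text \<open>A \<open>Cont\<close> of the lower word follows the fate of its predecessor: it offers
  no choice and carries no weight.\<close>

lemma upper_sum_filter: "upper_sum k w = upper_sum k (filter (\<lambda>x. x \<noteq> Cont) w)"
proof (induction w arbitrary: k)
  case (Cons x w)
  then show ?case
    by (cases x) (simp_all add: upper_sum_Hub upper_sum_Cont upper_sum_Bar upper_sum_Start)
qed simp

definition kl_bound :: "nat \<Rightarrow> int poly \<Rightarrow> bool" where
  "kl_bound m p \<longleftrightarrow> (m = 0 \<longrightarrow> p = 1) \<and> (0 < m \<longrightarrow> 2 * degree p < m)"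

lemma kl_bound_fan_kl: "kl_bound m (fan_kl m)"
  by (simp add: kl_bound_def degree_fan_kl)

lemma kl_bound_mult:
  assumes "kl_bound m p" "kl_bound n q"
  shows "kl_bound (m + n) (p * q)"
proof -
  have "2 * degree (p * q) < m + n" if "0 < m" "0 < n"
    using degree_mult_le[of p q] assms that unfolding kl_bound_def by linarith
  then show ?thesis using assms by (cases "m = 0"; cases "n = 0") (auto simp: kl_bound_def)
qed

lemma kl_bound_run_weight: "kl_bound (k + blocks v) (run_weight k v)"
proof (induction k v rule: run_weight.induct)
  case (2 k v)
  then show ?case using kl_bound_mult[OF kl_bound_fan_kl 2, of k] by simp
qed (simp_all add: kl_bound_fan_kl)

text \<open>Starting from k blocks, each of c further ones survives or is merged at cost t.\<close>

definition binom_sum :: "(nat \<Rightarrow> int poly) \<Rightarrow> nat \<Rightarrow> nat \<Rightarrow> int poly" where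
  "binom_sum f c k = (\<Sum>i\<le>c. of_nat (c choose i) * monom 1 (c - i) * f (k + i))"

lemma binom_sum_0 [simp]: "binom_sum f 0 k = f k"
  by (simp add: binom_sum_def)

lemma binom_sum_Suc: "binom_sum f (Suc c) k = binom_sum f c (Suc k) + monom 1 1 * binom_sum f c k"
proof -
  have 1: "binom_sum f c (Suc k) = (\<Sum>i\<le>c. of_nat (c choose i) * monom 1 (c - i) * f (k + Suc i))"
    by (simp add: binom_sum_def)
  have "monom 1 1 * binom_sum f c k = (\<Sum>i\<le>c. of_nat (c choose i) * monom 1 (Suc c - i) * f (k + i))"
    unfolding binom_sum_def sum_distrib_left
  proof (rule sum.cong[OF refl])
    fix i assume "i \<in> {..c}"
    then have "monom 1 (Suc c - i) = monom 1 1 * monom (1 :: int) (c - i)"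
      by (simp add: mult_monom Suc_diff_le)
    then show "monom 1 1 * (of_nat (c choose i) * monom 1 (c - i) * f (k + i)) =
        of_nat (c choose i) * monom 1 (Suc c - i) * f (k + i)"
      by (simp only: mult_ac)
  qed
  also have "\<dots> = (\<Sum>i\<le>Suc c. of_nat (c choose i) * monom 1 (Suc c - i) * f (k + i))"
    by (simp add: binomial_eq_0)
  also have "\<dots> = monom 1 (Suc c) * f k + (\<Sum>i\<le>c. of_nat (c choose Suc i) * monom 1 (c - i) * f (k + Suc i))"
    by (subst sum.atMost_Suc_shift) simp
  finally have 2: "monom 1 1 * binom_sum f c k =
     monom 1 (Suc c) * f k + (\<Sum>i\<le>c. of_nat (c choose Suc i) * monom 1 (c - i) * f (k + Suc i))" .
  have "binom_sum f (Suc c) k =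
      monom 1 (Suc c) * f k + (\<Sum>i\<le>c. of_nat (Suc c choose Suc i) * monom 1 (c - i) * f (k + Suc i))"
    unfolding binom_sum_def by (subst sum.atMost_Suc_shift) simp
  also have "(\<Sum>i\<le>c. of_nat (Suc c choose Suc i) * monom 1 (c - i) * f (k + Suc i)) =
     (\<Sum>i\<le>c. of_nat (c choose i) * monom 1 (c - i) * f (k + Suc i)) +
     (\<Sum>i\<le>c. of_nat (c choose Suc i) * monom 1 (c - i) * f (k + Suc i))"
    by (simp add: sum.distrib algebra_simps)
  finally show ?thesis unfolding 1 2 by (simp only: add_ac)
qed

lemma binom_sum_fan_kl: "binom_sum fan_kl c (Suc 0) = nar c"
  by (simp add: binom_sum_def nar_eq_sum)

lemma var_eq_monom: "[:0, 1 :: int:] = monom 1 1"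
  by (simp add: monom_Suc monom_0)

text \<open>For positive index, split at the first \<open>Hub\<close> of the larger word, if any:
  the c - 1 - d blocks before it extend the current run, the block there costs t, and the d blocks
  after it start afresh with \<open>nar d\<close>. The two claims feed each other in the
  induction.\<close>

lemma upper_sum_Start_replicate:
  "upper_sum 0 (replicate c Start) = nar c \<and>
   (\<forall>k. upper_sum (Suc k) (replicate c Start) = binom_sum fan_kl c (Suc k) +
      monom 1 1 * (\<Sum>d<c. nar d * binom_sum fan_kl (c - 1 - d) (Suc k)))"
proof (induction c)
  case 0
  then show ?case by (simp add: nar_0)
next
  case (Suc c)
  have "upper_sum 0 (replicate (Suc c) Start) = monom 1 1 * nar c + upper_sum (Suc 0) (replicate c Start)"
    using Suc by (simp add: upper_sum_Start)
  also have "\<dots> = nar (Suc c)"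
  proof -
    have "upper_sum (Suc 0) (replicate c Start) =
        nar c + monom 1 1 * (\<Sum>d<c. nar d * nar (c - 1 - d))"
      using conjunct2[OF Suc, THEN spec, of 0] unfolding binom_sum_fan_kl .
    moreover have "[:1, 1 :: int:] = 1 + monom 1 1"
      by (simp add: monom_Suc monom_0 one_pCons)
    ultimately show ?thesis
      unfolding nar_Suc var_eq_monom by (simp only: distrib_right mult_1 add_ac)
  qed
  finally have 1: "upper_sum 0 (replicate (Suc c) Start) = nar (Suc c)" .
  have 2: "upper_sum (Suc k) (replicate (Suc c) Start) = binom_sum fan_kl (Suc c) (Suc k) +
      monom 1 1 * (\<Sum>d<Suc c. nar d * binom_sum fan_kl (Suc c - 1 - d) (Suc k))" for k
  proof -
    let ?G = "binom_sum fan_kl" and ?t = "monom 1 1 :: int poly"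
    have "(\<Sum>d<c. nar d * ?G (c - d) (Suc k)) =
      (\<Sum>d<c. nar d * ?G (c - 1 - d) (Suc (Suc k))) + ?t * (\<Sum>d<c. nar d * ?G (c - 1 - d) (Suc k))"
    proof -
      have "?G (c - d) (Suc k) = ?G (c - 1 - d) (Suc (Suc k)) + ?t * ?G (c - 1 - d) (Suc k)" if "d < c" for d
        using binom_sum_Suc[of fan_kl "c - 1 - d" "Suc k"] that by (simp add: Suc_diff_Suc)
      then show ?thesis by (simp add: sum_distrib_left sum.distrib[symmetric] algebra_simps)
    qed
    then show ?thesis
      using Suc by (simp add: upper_sum_Start binom_sum_Suc algebra_simps)
  qed
  show ?case using 1 2 by blast
qed

text \<open>A \<open>Bar\<close> cannot become \<open>Hub\<close>, so the i of them only lengthen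
  the first run.\<close>

lemma upper_sum_Bar_Start:
  "upper_sum (Suc k) (replicate i Bar @ replicate c Start) = binom_sum fan_kl (c + i) (Suc k) +
      monom 1 1 * (\<Sum>d<c. nar d * binom_sum fan_kl (c - 1 - d + i) (Suc k))"
proof (induction i arbitrary: k)
  case 0
  then show ?case using upper_sum_Start_replicate by simp
next
  case (Suc i)
  then show ?case
    by (simp add: upper_sum_Bar binom_sum_Suc sum_distrib_left sum.distrib algebra_simps)
qed

lemma upper_sum_Bar_Start_total:
  "monom 1 1 * (\<Sum>c\<le>m. upper_sum 0 (replicate (m - c) Bar @ replicate c Start)) = fps_nth hub_part (Suc m)"
proof -
  have "upper_sum 0 (replicate (m - c) Bar @ replicate c Start) =
      nar (m - 1) + [:0, 1:] * (\<Sum>d<c. nar d * nar (m - 2 - d))" if c: "c < m" for c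
  proof -
    obtain i where i: "m - c = Suc i" using c by (cases "m - c") auto
    have "c + i = m - 1" and "c - 1 - d + i = m - 2 - d" if "d < c" for d
      using i that by linarith+
    moreover have "c + i = m - 1" using i by linarith
    ultimately show ?thesis
      using upper_sum_Bar_Start[of 0 i c]
      unfolding i replicate_Suc append_Cons upper_sum_Bar var_eq_monom
      by (simp add: binom_sum_fan_kl)
  qed
  then have "(\<Sum>c\<le>m. upper_sum 0 (replicate (m - c) Bar @ replicate c Start)) =
      nar m + (\<Sum>c<m. nar (m - 1) + [:0, 1:] * (\<Sum>d<c. nar d * nar (m - 2 - d)))"
    using upper_sum_Start_replicate[of m] by (simp add: lessThan_Suc_atMost[symmetric])
  then show ?thesis unfolding hub_part_nth var_eq_monom by simp
qed

lemma filter_no_Cont: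
  assumes "Hub \<notin> set w" "Bar \<notin> set w"
  shows "filter (\<lambda>x. x \<noteq> Cont) w = replicate (blocks w) Start"
  using assms
proof (induction w)
  case (Cons x w)
  then show ?case by (cases x) auto
qed simp

text \<open>Cutting at every \<open>Hub\<close> leaves words without \<open>Hub\<close>, whose sums
  are Narayana polynomials.\<close>

lemma palindromic_upper_sum:
  assumes "Bar \<notin> set w"
  shows "palindromic (blocks w) (upper_sum 0 w)"
  using assms
proof (induction w rule: length_induct)
  case (1 w)
  show ?case
  proof (cases "Hub \<in> set w")
    case True
    then obtain u v where w: "w = u @ Hub # v" by (meson split_list)
    then have "palindromic (blocks u) (upper_sum 0 u)" "palindromic (blocks v) (upper_sum 0 v)"
      using 1 by auto
    then show ?thesis
      unfolding w upper_sum_split using palindromic_mult by simp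
  next
    case False
    then have "upper_sum 0 w = nar (blocks w)"
      using upper_sum_filter[of 0 w] filter_no_Cont[of w] 1 upper_sum_Start_replicate by simp
    then show ?thesis using palindromic_nar by simp
  qed
qed

subsection \<open>Cyclic words\<close>

text \<open>On a cycle the first letter is preceded by the last one, so the initial flag has to be
  taken from the end of the larger word.\<close>

definition cyc_above :: "letter list \<Rightarrow> letter list \<Rightarrow> bool" where
  "cyc_above w v \<longleftrightarrow> w \<noteq> [] \<and> above (last v = Hub) w v"

text \<open>A hub vertex opens the cycle into a fan, read from there once around. Without one the
  contraction is again a wheel or whirl on \<open>blocks v\<close> rim vertices, up to parallel
  elements and degenerate small cases, and h supplies its candidate.\<close>

definition cyc_weight :: "(nat \<Rightarrow> int poly) \<Rightarrow> letter list \<Rightarrow> int poly" where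
  "cyc_weight h v =
     (if Hub \<in> set v
      then run_weight 0 (tl (dropWhile (\<lambda>x. x \<noteq> Hub) v) @ takeWhile (\<lambda>x. x \<noteq> Hub) v)
      else h (blocks v))"

definition cyc_sum :: "(nat \<Rightarrow> int poly) \<Rightarrow> letter list \<Rightarrow> int poly" where
  "cyc_sum h w = (\<Sum>v\<in>{v. cyc_above w v}. monom 1 (blocks w - blocks v) * cyc_weight h v)"

lemma finite_cyc_above [simp]: "finite {v. cyc_above w v}"
proof (rule finite_subset)
  show "{v. cyc_above w v} \<subseteq> {v. above True w v} \<union> {v. above False w v}"
    unfolding cyc_above_def by (auto simp del: above_Nil) (metis (full_types))
qed simp

text \<open>Which \<open>Hub\<close> is used to cut the cyclic word open is irrelevant.\<close>

lemma cyc_weight_cut: "cyc_weight h (u @ Hub # v) = run_weight 0 (v @ u)"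
proof (cases "Hub \<in> set u")
  case True
  then obtain a b where u: "u = a @ Hub # b" "Hub \<notin> set a" by (meson split_list_first)
  have t: "takeWhile (\<lambda>x. x \<noteq> Hub) (u @ Hub # v) = a"
    unfolding u by (subst append_assoc, subst takeWhile_append2) (use u in auto)
  have "dropWhile (\<lambda>x. x \<noteq> Hub) (u @ Hub # v) = Hub # b @ Hub # v"
    unfolding u by (subst append_assoc, subst dropWhile_append2) (use u in auto)
  then have "cyc_weight h (u @ Hub # v) = run_weight 0 (b @ Hub # (v @ a))"
    using t by (simp add: cyc_weight_def)
  also have "\<dots> = run_weight 0 ((v @ a) @ Hub # b)"
    unfolding run_weight_split by (rule mult.commute)
  finally show ?thesis by (simp add: u)
next
  case False
  then have "takeWhile (\<lambda>x. x \<noteq> Hub) (u @ Hub # v) = u"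
    "dropWhile (\<lambda>x. x \<noteq> Hub) (u @ Hub # v) = Hub # v"
    by (subst takeWhile_append2 dropWhile_append2, auto)+
  then show ?thesis by (simp add: cyc_weight_def)
qed

lemma above_append:
  assumes "length v1 = length w1"
  shows "above b (w1 @ w2) (v1 @ v2) \<longleftrightarrow>
    above b w1 v1 \<and> above (if v1 = [] then b else last v1 = Hub) w2 v2"
  using assms
proof (induction v1 w1 arbitrary: b rule: list_induct2)
  case (Cons y v1 x w1)
  show ?case by (simp add: Cons.IH)
qed simp

lemma cyc_above_cut:
  assumes "length v1 = length w1"
  shows "cyc_above (w1 @ Hub # w2) (v1 @ y # v2) \<longleftrightarrow> y = Hub \<and> above True (w2 @ w1) (v2 @ v1)"
proof (cases "length v2 = length w2")
  case True
  have "cyc_above (w1 @ Hub # w2) (v1 @ y # v2) \<longleftrightarrow>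
      above (last (y # v2) = Hub) w1 v1 \<and> y = Hub \<and> above True w2 v2"
    by (auto simp: cyc_above_def above_append[OF assms])
  also have "\<dots> \<longleftrightarrow> y = Hub \<and> above True (w2 @ w1) (v2 @ v1)"
    by (auto simp: above_append[OF True])
  finally show ?thesis .
next
  case False
  then show ?thesis using above_length assms by (force simp: cyc_above_def)
qed

text \<open>A \<open>Hub\<close> of the lower word stays in its place in all larger words, so the
  whole interval can be cut open there.\<close>

lemma cyc_sum_cut: "cyc_sum h (w1 @ Hub # w2) = upper_sum 0 (w2 @ w1)"
proof -
  let ?n = "length w1" and ?m = "length w2"
  have split1: "\<exists>v1 v2. v = v1 @ Hub # v2 \<and> length v1 = ?n \<and> length v2 = ?m \<and> above True (w2 @ w1) (v2 @ v1)"
    if "cyc_above (w1 @ Hub # w2) v" for v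
  proof -
    have len: "length v = ?n + Suc ?m" using that above_length by (fastforce simp: cyc_above_def)
    obtain y v2 where d: "drop ?n v = y # v2" using len by (cases "drop ?n v") auto
    have v: "v = take ?n v @ y # v2" by (metis append_take_drop_id d)
    have l: "length (take ?n v) = ?n" using len by simp
    have "y = Hub \<and> above True (w2 @ w1) (v2 @ take ?n v)"
      using that cyc_above_cut[OF l, of w2 y v2] v by metis
    moreover have "length v2 = ?m" using d len by (metis add_diff_cancel_left' length_Cons length_drop nat.inject)
    ultimately show ?thesis using v l by blast
  qed
  have split2: "\<exists>v1 v2. x = v2 @ v1 \<and> length v1 = ?n \<and> length v2 = ?m \<and> cyc_above (w1 @ Hub # w2) (v1 @ Hub # v2)"
    if "above True (w2 @ w1) x" for x
  proof -
    have len: "length x = ?m + ?n" using above_length[OF that] by simp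
    have l: "length (drop ?m x) = ?n" using len by simp
    show ?thesis
      using that len cyc_above_cut[OF l, of w2 Hub "take ?m x"]
      by (intro exI[of _ "drop ?m x"] exI[of _ "take ?m x"]) auto
  qed
  show ?thesis
    unfolding cyc_sum_def upper_sum_def
  proof (rule sum.reindex_bij_witness[of _ "\<lambda>x. drop ?m x @ Hub # take ?m x" "\<lambda>v. drop (Suc ?n) v @ take ?n v"])
    fix v assume "v \<in> {v. cyc_above (w1 @ Hub # w2) v}"
    then obtain v1 v2 where v: "v = v1 @ Hub # v2" "length v1 = ?n" "length v2 = ?m" "above True (w2 @ w1) (v2 @ v1)"
      using split1 by blast
    then show "drop ?m (drop (Suc ?n) v @ take ?n v) @ Hub # take ?m (drop (Suc ?n) v @ take ?n v) = v"
      "drop (Suc ?n) v @ take ?n v \<in> {v. above (0 = (0 :: nat)) (w2 @ w1) v}"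
      "monom 1 (blocks (w2 @ w1) - blocks (drop (Suc ?n) v @ take ?n v)) * run_weight 0 (drop (Suc ?n) v @ take ?n v) =
       monom 1 (blocks (w1 @ Hub # w2) - blocks v) * cyc_weight h v"
      by (simp_all add: cyc_weight_cut add.commute)
  next
    fix x assume "x \<in> {v. above (0 = (0 :: nat)) (w2 @ w1) v}"
    then have "above True (w2 @ w1) x" by simp
    then obtain v1 v2 where x: "x = v2 @ v1" "length v1 = ?n" "length v2 = ?m" "cyc_above (w1 @ Hub # w2) (v1 @ Hub # v2)"
      using split2 by blast
    then show "drop (Suc ?n) (drop ?m x @ Hub # take ?m x) @ take ?n (drop ?m x @ Hub # take ?m x) = x"
      "drop ?m x @ Hub # take ?m x \<in> {v. cyc_above (w1 @ Hub # w2) v}"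
      by simp_all
  qed
qed

lemma palindromic_cyc_sum_Hub:
  assumes "Hub \<in> set w" "Bar \<notin> set w"
  shows "palindromic (blocks w) (cyc_sum h w)"
proof -
  obtain w1 w2 where w: "w = w1 @ Hub # w2" using assms by (meson split_list)
  then show ?thesis
    using palindromic_upper_sum[of "w2 @ w1"] assms by (simp add: cyc_sum_cut add.commute)
qed

section \<open>Cyclic words in which blocks are newly joined to the hub\<close>

definition lock :: "letter \<Rightarrow> letter" where
  "lock x = (if x = Start then Bar else x)"

lemma above_lock:
  assumes "Bar \<notin> set w"
  shows "above b (map lock w) v \<longleftrightarrow> above b w v \<and> (Start, Hub) \<notin> set (zip w v)"
  using assms
proof (induction w arbitrary: b v)
  case (Cons x w)
  then show ?case by (cases x) (auto simp: above_Cons lock_def)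
qed simp

lemma blocks_lock [simp]: "blocks (map lock w) = blocks w"
  by (induction w) (auto simp: lock_def blocks_def)

text \<open>A block of \<open>w\<close> is joined to the hub only together with its first vertex.\<close>

lemma above_no_new_hub:
  assumes "above False w v" "(Start, Hub) \<notin> set (zip w v)" "set w \<subseteq> {Start, Cont}"
  shows "Hub \<notin> set v"
  using assms
proof (induction w arbitrary: v)
  case (Cons x w)
  then obtain y v' where v: "v = y # v'" "step False x y" "above (y = Hub) w v'"
    by (auto simp: above_Cons)
  then have "y \<noteq> Hub" using Cons.prems by auto
  then show ?case using Cons v by auto
qed simp

lemma above_no_new_hub_last:
  assumes "above b w v" "(Start, Hub) \<notin> set (zip w v)" "set w \<subseteq> {Start, Cont}" "Start \<in> set w"
  shows "last v \<noteq> Hub"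
  using assms
proof (induction w arbitrary: v b)
  case (Cons x w)
  then obtain y v' where v: "v = y # v'" "step b x y" "above (y = Hub) w v'"
    by (auto simp: above_Cons)
  show ?case
  proof (cases "x = Start")
    case True
    then have y: "y \<noteq> Hub" using Cons.prems v by auto
    then have "above False w v'" using v by simp
    then have "Hub \<notin> set v'"
      using Cons.prems v by (intro above_no_new_hub) auto
    then show ?thesis using v y by (auto dest: last_in_set)
  next
    case False
    then have "Start \<in> set w" using Cons.prems by auto
    moreover have "w \<noteq> []" using \<open>Start \<in> set w\<close> by auto
    then have "v' \<noteq> []" using v above_length by fastforce
    ultimately show ?thesis using Cons.IH[OF v(3)] Cons.prems v by auto
  qed
qed simp

text \<open>A \<open>Cont\<close> copies the hub status of its predecessor, so along the cycle the
  status can switch to \<open>Hub\<close> only at a \<open>Start\<close>. The presence of a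
  \<open>Start\<close> excludes words of letters \<open>Cont\<close> that become \<open>Hub\<close>
  all together.\<close>

lemma cyc_above_new_hub:
  assumes "cyc_above w v" "set w \<subseteq> {Start, Cont}" "Start \<in> set w" "Hub \<in> set v"
  shows "(Start, Hub) \<in> set (zip w v)"
proof (rule ccontr)
  assume n: "(Start, Hub) \<notin> set (zip w v)"
  have "last v \<noteq> Hub"
    using above_no_new_hub_last[OF _ n assms(2,3)] assms(1) by (auto simp: cyc_above_def)
  then have "Hub \<notin> set v"
    using above_no_new_hub[OF _ n assms(2)] assms(1) by (auto simp: cyc_above_def)
  then show False using assms(4) by simp
qed

text \<open>The cyclic words above \<open>w\<close> in which the block starting at \<open>i\<close> is the last one joined to the hub.\<close>

definition cut_at :: "nat \<Rightarrow> letter list \<Rightarrow> letter list" where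
  "cut_at i w = take i w @ Hub # map lock (drop (Suc i) w)"

lemma cyc_above_cut_at_iff:
  assumes "i < length w" "w ! i = Start" "Bar \<notin> set w"
  shows "cyc_above (cut_at i w) v \<longleftrightarrow>
    cyc_above w v \<and> v ! i = Hub \<and> (\<forall>j. i < j \<and> j < length w \<and> w ! j = Start \<longrightarrow> v ! j \<noteq> Hub)"
proof (cases "length v = length w")
  case len: True
  define v1 y v2 where "v1 = take i v" and "y = v ! i" and "v2 = drop (Suc i) v"
  define w1 w2 where "w1 = take i w" and "w2 = drop (Suc i) w"
  have v: "v = v1 @ y # v2" unfolding v1_def y_def v2_def using assms(1) len by (simp add: id_take_nth_drop)
  have w: "w = w1 @ Start # w2" unfolding w1_def w2_def using assms(1,2) by (metis id_take_nth_drop)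
  have l: "length v1 = length w1" "length v2 = length w2" "length w1 = i"
    using assms(1) len by (auto simp: v1_def w1_def v2_def w2_def)
  have B2: "Bar \<notin> set w2" using assms(3) w by simp
  have "(Start, Hub) \<notin> set (zip w2 v2) \<longleftrightarrow> (\<forall>j<length w2. w2 ! j = Start \<longrightarrow> v2 ! j \<noteq> Hub)"
    using l by (auto simp: set_zip)
  also have "\<dots> \<longleftrightarrow> (\<forall>j. i < j \<and> j < length w \<and> w ! j = Start \<longrightarrow> v ! j \<noteq> Hub)"
  proof
    assume *: "\<forall>j<length w2. w2 ! j = Start \<longrightarrow> v2 ! j \<noteq> Hub"
    show "\<forall>j. i < j \<and> j < length w \<and> w ! j = Start \<longrightarrow> v ! j \<noteq> Hub"
    proof (intro allI impI)
      fix j assume j: "i < j \<and> j < length w \<and> w ! j = Start"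
      then have "Suc i + (j - Suc i) = j" "j - Suc i < length w2" by (auto simp: w2_def)
      then show "v ! j \<noteq> Hub"
        using j *[rule_format, of "j - Suc i"] len by (auto simp: v2_def w2_def)
    qed
  next
    assume *: "\<forall>j. i < j \<and> j < length w \<and> w ! j = Start \<longrightarrow> v ! j \<noteq> Hub"
    then show "\<forall>j<length w2. w2 ! j = Start \<longrightarrow> v2 ! j \<noteq> Hub"
      using *[rule_format, of "Suc i + _"] len by (auto simp: v2_def w2_def)
  qed
  finally have zip: "(Start, Hub) \<notin> set (zip w2 v2) \<longleftrightarrow>
      (\<forall>j. i < j \<and> j < length w \<and> w ! j = Start \<longrightarrow> v ! j \<noteq> Hub)" .
  have "cyc_above (cut_at i w) v \<longleftrightarrow> above (last v = Hub) w1 v1 \<and> y = Hub \<and> above True (map lock w2) v2"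
    unfolding cyc_above_def cut_at_def w1_def[symmetric] w2_def[symmetric]
    by (subst (2) v) (auto simp: above_append[OF l(1)])
  also have "\<dots> \<longleftrightarrow> above (last v = Hub) w1 v1 \<and> y = Hub \<and> above True w2 v2 \<and> (Start, Hub) \<notin> set (zip w2 v2)"
    by (simp add: above_lock[OF B2])
  also have "\<dots> \<longleftrightarrow> cyc_above w v \<and> y = Hub \<and> (Start, Hub) \<notin> set (zip w2 v2)"
    unfolding cyc_above_def by (subst (2) v, subst (2) w) (auto simp: above_append[OF l(1)] w)
  finally show ?thesis unfolding zip y_def .
next
  case False
  have "length (cut_at i w) = length w" using assms(1) by (simp add: cut_at_def)
  then show ?thesis using False above_length by (metis cyc_above_def)
qed

text \<open>The successive letters \<open>Start\<close> have 0, 1, ..., \<open>blocks w - 1\<close>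
  of their kind in front of them.\<close>

lemma sum_Start_positions:
  "Bar \<notin> set w \<Longrightarrow> (\<Sum>i\<in>{i. i < length w \<and> w ! i = Start}. g (blocks (take i w))) = (\<Sum>c<blocks w. g c)"
  for g :: "nat \<Rightarrow> int poly"
proof (induction w rule: rev_induct)
  case (snoc x w)
  let ?I = "{i. i < length w \<and> w ! i = Start}"
  have "{i. i < length (w @ [x]) \<and> (w @ [x]) ! i = Start} = ?I \<union> (if x = Start then {length w} else {})"
    by (auto simp: nth_append less_Suc_eq)
  moreover have "(\<Sum>i\<in>?I. g (blocks (take i (w @ [x])))) = (\<Sum>i\<in>?I. g (blocks (take i w)))"
    by (intro sum.cong) auto
  ultimately show ?case
    using snoc by (cases x) auto
qed simp

text \<open>The words are sorted by the last block joined to the hub. Cutting there at cost t puts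
  the later blocks first, as \<open>Bar\<close> since they may not join the hub, followed by the c
  earlier blocks, which are free.\<close>

lemma sum_cyc_hub:
  assumes w: "set w \<subseteq> {Start, Cont}" and m: "blocks w = Suc m"
  shows "(\<Sum>v\<in>{v. cyc_above w v \<and> Hub \<in> set v}. monom 1 (blocks w - blocks v) * cyc_weight h v) =
    fps_nth hub_part (Suc m)"
proof -
  let ?I = "{i. i < length w \<and> w ! i = Start}"
  let ?V = "\<lambda>i. {v. cyc_above (cut_at i w) v}"
  let ?f = "\<lambda>v. monom 1 (blocks w - blocks v) * cyc_weight h v"
  have B: "Bar \<notin> set w" using w by auto
  have S: "Start \<in> set w"
  proof (rule ccontr)
    assume "Start \<notin> set w"
    then have "blocks w = 0" using B by (auto simp: blocks_def filter_empty_conv)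
    then show False using m by simp
  qed
  note iff = cyc_above_cut_at_iff[OF _ _ B]
  have len: "length v = length w" if "cyc_above w v" for v
    using that above_length by (auto simp: cyc_above_def)
  have "{v. cyc_above w v \<and> Hub \<in> set v} = (\<Union>i\<in>?I. ?V i)"
  proof (intro equalityI subsetI)
    fix v assume "v \<in> {v. cyc_above w v \<and> Hub \<in> set v}"
    then have v: "cyc_above w v" "Hub \<in> set v" by auto
    define J where "J = {i. i < length w \<and> w ! i = Start \<and> v ! i = Hub}"
    have "(Start, Hub) \<in> set (zip w v)" by (rule cyc_above_new_hub[OF v(1) w S v(2)])
    then have "\<exists>i. i < length w \<and> w ! i = Start \<and> v ! i = Hub"
      unfolding in_set_zip by auto
    then have "J \<noteq> {}" by (auto simp: J_def)
    moreover have fin: "finite J" by (simp add: J_def)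
    ultimately have "Max J \<in> J" by (rule Max_in[rotated])
    moreover have "j \<le> Max J" if "j \<in> J" for j using that fin by simp
    ultimately have "cyc_above (cut_at (Max J) w) v"
      using v(1) by (subst iff) (auto simp: J_def not_le[symmetric])
    then show "v \<in> (\<Union>i\<in>?I. ?V i)" using \<open>Max J \<in> J\<close> by (auto simp: J_def)
  next
    fix v assume "v \<in> (\<Union>i\<in>?I. ?V i)"
    then obtain i where i: "i < length w" "w ! i = Start" "cyc_above (cut_at i w) v" by auto
    then have "cyc_above w v" "v ! i = Hub" using iff[of i v] by auto
    then show "v \<in> {v. cyc_above w v \<and> Hub \<in> set v}" using len i by (metis (mono_tags) mem_Collect_eq nth_mem)
  qed
  moreover have "?V i \<inter> ?V j = {}" if ij: "i \<in> ?I" "j \<in> ?I" "i \<noteq> j" for i j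
  proof -
    have lt: "False" if "i < j" "i \<in> ?I" "j \<in> ?I" "v \<in> ?V i" "v \<in> ?V j" for i j v
    proof -
      have "v ! j \<noteq> Hub" using that iff[of i v] by blast
      moreover have "v ! j = Hub" using that iff[of j v] by blast
      ultimately show ?thesis by simp
    qed
    consider "i < j" | "j < i" using ij(3) by linarith
    then show ?thesis
    proof cases
      case 1
      then show ?thesis using lt[OF 1 ij(1,2)] by blast
    next
      case 2
      then show ?thesis using lt[OF 2 ij(2,1)] by blast
    qed
  qed
  ultimately have "(\<Sum>v\<in>{v. cyc_above w v \<and> Hub \<in> set v}. ?f v) = (\<Sum>i\<in>?I. \<Sum>v\<in>?V i. ?f v)"
    by (simp only:) (rule sum.UNION_disjoint, simp_all)
  also have "\<dots> = (\<Sum>i\<in>?I. (\<lambda>c. monom 1 1 * upper_sum 0 (replicate (m - c) Bar @ replicate c Start)) (blocks (take i w)))"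
  proof (rule sum.cong[OF refl])
    fix i assume i: "i \<in> ?I"
    then have w': "w = take i w @ Start # drop (Suc i) w" by (metis (mono_tags) id_take_nth_drop mem_Collect_eq)
    have "blocks w = Suc (blocks (take i w) + blocks (drop (Suc i) w))"
      by (subst w') simp
    then have b: "blocks (take i w) + blocks (drop (Suc i) w) = m" using m by simp
    have bc: "blocks (cut_at i w) = m" using b by (simp add: cut_at_def)
    have fv: "?f v = monom 1 1 * (monom 1 (blocks (cut_at i w) - blocks v) * cyc_weight h v)"
      if "v \<in> ?V i" for v
    proof -
      have "blocks v \<le> m" using that blocks_above bc by (auto simp: cyc_above_def)
      then show ?thesis unfolding m bc by (rule monom_shift)
    qed
    have "(\<Sum>v\<in>?V i. ?f v) = monom 1 1 * cyc_sum h (cut_at i w)"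
      unfolding cyc_sum_def sum_distrib_left by (rule sum.cong[OF refl fv])
    also have "cyc_sum h (cut_at i w) = upper_sum 0 (map lock (drop (Suc i) w) @ take i w)"
      unfolding cut_at_def by (rule cyc_sum_cut)
    also have "\<dots> = upper_sum 0 (replicate (m - blocks (take i w)) Bar @ replicate (blocks (take i w)) Start)"
    proof -
      have 1: "filter (\<lambda>x. x \<noteq> Cont) (take i w) = replicate (blocks (take i w)) Start"
        using w by (intro filter_no_Cont) (auto dest: in_set_takeD)
      have lk: "filter (\<lambda>x. x \<noteq> Cont) (map lock u) = map lock (filter (\<lambda>x. x \<noteq> Cont) u)" for u
        by (induction u) (auto simp: lock_def)
      have "filter (\<lambda>x. x \<noteq> Cont) (drop (Suc i) w) = replicate (blocks (drop (Suc i) w)) Start"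
        using w by (intro filter_no_Cont) (auto dest: in_set_dropD)
      then have 2: "filter (\<lambda>x. x \<noteq> Cont) (map lock (drop (Suc i) w)) = replicate (m - blocks (take i w)) Bar"
        unfolding lk using b by (simp add: lock_def)
      show ?thesis
        by (subst upper_sum_filter) (simp only: filter_append 1 2)
    qed
    finally show "(\<Sum>v\<in>?V i. ?f v) = (\<lambda>c. monom 1 1 * upper_sum 0 (replicate (m - c) Bar @ replicate c Start)) (blocks (take i w))" .
  qed
  also have "\<dots> = (\<Sum>c<blocks w. monom 1 1 * upper_sum 0 (replicate (m - c) Bar @ replicate c Start))"
    by (rule sum_Start_positions[OF B])
  also have "\<dots> = monom 1 1 * (\<Sum>c\<le>m. upper_sum 0 (replicate (m - c) Bar @ replicate c Start))"
    unfolding m lessThan_Suc_atMost by (rule sum_distrib_left[symmetric])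
  finally show ?thesis by (simp only: upper_sum_Bar_Start_total)
qed

text \<open>Without hub vertices each \<open>Start\<close> is kept or turned into
  \<open>Cont\<close>, independently of the others.\<close>

lemma sum_no_hub:
  assumes "set w \<subseteq> {Start, Cont}"
  shows "(\<Sum>v\<in>{v. above False w v \<and> Hub \<notin> set v}. monom 1 (blocks w - blocks v) * h (k + blocks v)) =
    binom_sum h (blocks w) k"
  using assms
proof (induction w arbitrary: k)
  case Nil
  have "{v. above False [] v \<and> Hub \<notin> set v} = {[]}" by auto
  then show ?case by (simp add: one_pCons[symmetric])
next
  case (Cons x w)
  let ?A = "{v. above False w v \<and> Hub \<notin> set v}"
  have fin: "finite ?A" by (rule finite_subset[OF _ finite_above[of False w]]) auto
  show ?case
  proof (cases "x = Start")
    case True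
    have eq: "{v. above False (x # w) v \<and> Hub \<notin> set v} = Cons Start ` ?A \<union> Cons Cont ` ?A"
      unfolding True by (auto simp: above_Cons)
    have sh: "monom 1 (Suc (blocks w) - blocks v) * h (k + blocks v) =
       monom 1 1 * (monom 1 (blocks w - blocks v) * h (k + blocks v))" if "v \<in> ?A" for v
      using that by (intro monom_shift) (auto intro: blocks_above)
    have "(\<Sum>v\<in>?A. monom 1 (Suc (blocks w) - blocks v) * h (k + blocks v)) = monom 1 1 * binom_sum h (blocks w) k"
      unfolding Cons.IH[symmetric, OF subset_trans[OF set_subset_Cons Cons.prems]] sum_distrib_left
      by (rule sum.cong[OF refl sh])
    moreover have "(\<Sum>v\<in>?A. monom 1 (blocks w - blocks v) * h (Suc (k + blocks v))) = binom_sum h (blocks w) (Suc k)"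
      using Cons.IH[of "Suc k"] Cons.prems by simp
    ultimately show ?thesis
      unfolding eq using fin True
      by (subst sum.union_disjoint) (auto simp: sum.reindex inj_on_def binom_sum_Suc)
  next
    case False
    then have x: "x = Cont" using Cons.prems by auto
    have eq: "{v. above False (x # w) v \<and> Hub \<notin> set v} = Cons Cont ` ?A"
      unfolding x by (auto simp: above_Cons)
    show ?thesis
      unfolding eq using x Cons by (simp add: sum.reindex inj_on_def)
  qed
qed

lemma cyc_sum_no_hub:
  assumes w: "set w \<subseteq> {Start, Cont}" and m: "0 < blocks w"
  shows "cyc_sum h w = binom_sum h (blocks w) 0 + fps_nth hub_part (blocks w)"
proof -
  obtain m' where m': "blocks w = Suc m'" using m by (cases "blocks w") auto
  have ne: "w \<noteq> []" using m by auto
  have V: "{v. cyc_above w v} = {v. cyc_above w v \<and> Hub \<in> set v} \<union> {v. above False w v \<and> Hub \<notin> set v}"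
  proof -
    have "cyc_above w v \<longleftrightarrow> above False w v" if "Hub \<notin> set v" for v
    proof -
      have "v = [] \<or> last v \<noteq> Hub" using that last_in_set by metis
      moreover have "\<not> above b w []" for b
        using ne above_length[of b w "[]"] by auto
      ultimately show ?thesis using ne by (cases "v = []") (simp_all add: cyc_above_def)
    qed
    then show ?thesis by auto
  qed
  have "cyc_sum h w =
     (\<Sum>v\<in>{v. cyc_above w v \<and> Hub \<in> set v}. monom 1 (blocks w - blocks v) * cyc_weight h v) +
     (\<Sum>v\<in>{v. above False w v \<and> Hub \<notin> set v}. monom 1 (blocks w - blocks v) * cyc_weight h v)"
    unfolding cyc_sum_def V
  proof (rule sum.union_disjoint)
    show "finite {v. cyc_above w v \<and> Hub \<in> set v}"
      by (rule finite_subset[OF _ finite_cyc_above[of w]]) auto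
    show "finite {v. above False w v \<and> Hub \<notin> set v}"
      by (rule finite_subset[OF _ finite_above[of False w]]) auto
  qed auto
  moreover have "(\<Sum>v\<in>{v. above False w v \<and> Hub \<notin> set v}. monom 1 (blocks w - blocks v) * cyc_weight h v) =
      binom_sum h (blocks w) 0"
    unfolding sum_no_hub[OF w, of h 0, symmetric] by (intro sum.cong) (auto simp: cyc_weight_def)
  ultimately show ?thesis
    using sum_cyc_hub[OF w m'] m' by simp
qed

subsection \<open>Flats of fans and wheels\<close>

lemma above_nth:
  "above b w v \<longleftrightarrow> length v = length w \<and>
    (\<forall>i<length w. step (if i = 0 then b else v ! (i - 1) = Hub) (w ! i) (v ! i))"
proof (induction w arbitrary: b v)
  case (Cons x w)
  show ?case
  proof (cases v)
    case (Cons y v')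
    have "(\<forall>i<length w. step (if i = 0 then y = Hub else v' ! (i - 1) = Hub) (w ! i) (v' ! i)) \<longleftrightarrow>
          (\<forall>i<length w. step ((y # v') ! i = Hub) (w ! i) (v' ! i))"
      by (intro all_cong) (auto simp: nth_Cons split: nat.splits)
    then show ?thesis
      using Cons by (auto simp: Cons.IH All_less_Suc2)
  qed simp
qed auto

definition prev :: "nat \<Rightarrow> nat \<Rightarrow> nat" where
  "prev n i = (if i = 0 then n - 1 else i - 1)"

text \<open>Rim vertex \<open>i + 1\<close> has index \<open>i\<close>; the rim edge of index \<open>i\<close> enters it.\<close>

definition spoke :: "nat \<Rightarrow> nat set" where
  "spoke i = {0, Suc i}"

definition rim_edge :: "nat \<Rightarrow> nat \<Rightarrow> nat set" where
  "rim_edge n i = {Suc (prev n i), Suc i}"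

lemma prev_less: "i < n \<Longrightarrow> prev n i < n"
  by (auto simp: prev_def)

lemma prev_Suc_mod: "i < n \<Longrightarrow> prev n (Suc i mod n) = i"
  by (cases "Suc i = n") (auto simp: prev_def)

lemma spoke_eq_iff [simp]: "spoke i = spoke j \<longleftrightarrow> i = j"
  by (auto simp: spoke_def doubleton_eq_iff)

lemma spoke_neq_rim_edge [simp]: "spoke i \<noteq> rim_edge n j" "rim_edge n j \<noteq> spoke i"
  by (auto simp: spoke_def rim_edge_def doubleton_eq_iff)

text \<open>Induction once around the cycle, starting at j.\<close>

lemma cyclic_induct:
  assumes "j < n" "P j" and step: "\<And>i. i < n \<Longrightarrow> i \<noteq> j \<Longrightarrow> P (prev n i) \<Longrightarrow> P i" and i: "i < n"
  shows "P i"
proof -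
  have *: "P ((j + k) mod n)" for k
  proof (induction k)
    case (Suc k)
    have n: "0 < n" using assms(1) by simp
    then have "(j + k) mod n < n" by simp
    then have "prev n (Suc ((j + k) mod n) mod n) = (j + k) mod n" by (rule prev_Suc_mod)
    then have "prev n ((j + Suc k) mod n) = (j + k) mod n" by (simp add: mod_Suc_eq)
    then show ?case
      using Suc step[of "(j + Suc k) mod n"] n assms(2) by (cases "(j + Suc k) mod n = j") auto
  qed (use assms in simp)
  have "(j + (n - j + i)) mod n = i" using i assms(1) by simp
  then show ?thesis using *[of "n - j + i"] by simp
qed

text \<open>K indexes the rim edges present: all of them for a wheel, all but index 0 for a fan. On
  a full rim, 3 \<le> n keeps the edges distinct and proper.\<close>

locale rim_graph =
  fixes n :: nat and K :: "nat set"
  assumes K_cases: "K = {..<n} \<and> 3 \<le> n \<or> K = {1..<n} \<and> 1 \<le> n"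
begin

abbreviation re :: "nat \<Rightarrow> nat set" where "re \<equiv> rim_edge n"

definition E :: "nat set set" where
  "E = re ` K \<union> spoke ` {..<n}"

definition M :: "nat set matroid" where
  "M = graphic_matroid ({0..n}, E)"

lemma K_less: "i \<in> K \<Longrightarrow> i < n"
  using K_cases by auto

lemma n_pos: "0 < n"
  using K_cases by auto

lemma in_K: "i < n \<Longrightarrow> i \<noteq> 0 \<Longrightarrow> i \<in> K"
  using K_cases by auto

lemma zero_in_K: "0 \<in> K \<Longrightarrow> K = {..<n} \<and> 3 \<le> n"
  using K_cases by auto

lemma re_eq_iff: "i \<in> K \<Longrightarrow> j \<in> K \<Longrightarrow> re i = re j \<longleftrightarrow> i = j"
  using K_cases by (auto simp: rim_edge_def prev_def doubleton_eq_iff split: if_splits)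

lemma ground_M [simp]: "ground M = E"
  by (simp add: M_def graphic_matroid_def)

lemma finite_E: "finite E"
  using K_less by (auto simp: E_def intro: finite_subset[of K "{..<n}"])

lemma re_in_E: "i \<in> K \<Longrightarrow> re i \<in> E" and spoke_in_E: "i < n \<Longrightarrow> spoke i \<in> E"
  by (auto simp: E_def)

lemma edge_cases:
  assumes "e \<in> E"
  obtains i where "i < n" "e = spoke i" | i where "i \<in> K" "e = re i"
  using assms by (auto simp: E_def)

lemma edge_pair: "e \<in> E \<Longrightarrow> \<exists>u v. e = {u, v} \<and> u \<noteq> v"
proof -
  assume "e \<in> E"
  then show ?thesis
  proof (cases rule: edge_cases)
    case (1 i)
    then show ?thesis by (intro exI[of _ 0] exI[of _ "Suc i"]) (simp add: spoke_def)
  next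
    case (2 i)
    then have "prev n i \<noteq> i" using K_cases by (auto simp: prev_def)
    then show ?thesis using 2
      by (intro exI[of _ "Suc (prev n i)"] exI[of _ "Suc i"]) (simp add: rim_edge_def)
  qed
qed

sublocale span_matroid M spans
  unfolding M_def by (rule span_matroid_graphic) (simp_all add: finite_E edge_pair)

lemma loopless_M: "loopless M"
proof -
  have "indep M {e}" if e: "e \<in> E" for e
  proof -
    obtain u v where uv: "e = {u, v}" "u \<noteq> v" using edge_pair[OF e] by blast
    have "(u, v) \<notin> joined {}"
      using uv(2) joined_colour[of u v "{}" id] by auto
    then show ?thesis using e uv by (auto simp: indep_iff spans_iff)
  qed
  then show ?thesis by (simp add: loopless_def)
qed

definition letter_of :: "nat set set \<Rightarrow> nat \<Rightarrow> letter" where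
  "letter_of F i = (if spoke i \<in> F then Hub else if i \<in> K \<and> re i \<in> F then Cont else Start)"

definition word :: "nat set set \<Rightarrow> letter list" where
  "word F = map (letter_of F) [0..<n]"

text \<open>The inverse of \<open>word\<close>. The letter \<open>Hub\<close> does not record the
  rim edge entering its vertex, but closure under triangles forces it to be present exactly when the
  preceding vertex is a hub vertex too.\<close>

definition edge_set :: "letter list \<Rightarrow> nat set set" where
  "edge_set v = spoke ` {i. i < n \<and> v ! i = Hub} \<union>
     re ` {i \<in> K. v ! i = Cont \<or> v ! i = Hub \<and> v ! prev n i = Hub}"

text \<open>Closure under the triangles of two neighbouring spokes and their rim edge. For fans this
  is flatness; for wheels and whirls it differs from flatness only in sets inside the rim, so one
  bijection with words serves all three families.\<close>

definition triangle_closed :: "nat set set \<Rightarrow> bool" where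
  "triangle_closed F \<longleftrightarrow> F \<subseteq> E \<and> (\<forall>i\<in>K.
     (re i \<in> F \<and> spoke i \<in> F \<longrightarrow> spoke (prev n i) \<in> F) \<and>
     (re i \<in> F \<and> spoke (prev n i) \<in> F \<longrightarrow> spoke i \<in> F) \<and>
     (spoke i \<in> F \<and> spoke (prev n i) \<in> F \<longrightarrow> re i \<in> F))"

text \<open>A vertex that no rim edge enters is treated as if it followed a hub vertex: in both
  cases \<open>Cont\<close> is impossible.\<close>

definition word_above :: "letter list \<Rightarrow> letter list \<Rightarrow> bool" where
  "word_above w v \<longleftrightarrow> length w = n \<and> length v = n \<and>
     (\<forall>i<n. step (i \<notin> K \<or> v ! prev n i = Hub) (w ! i) (v ! i))"

lemma triangle_closed_subset: "triangle_closed F \<Longrightarrow> F \<subseteq> E"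
  by (simp add: triangle_closed_def)

lemma triangle_closed_spoke_iff:
  "triangle_closed F \<Longrightarrow> i \<in> K \<Longrightarrow> re i \<in> F \<Longrightarrow> spoke i \<in> F \<longleftrightarrow> spoke (prev n i) \<in> F"
  unfolding triangle_closed_def by blast

lemma triangle_closed_re:
  "triangle_closed F \<Longrightarrow> i \<in> K \<Longrightarrow> spoke i \<in> F \<Longrightarrow> spoke (prev n i) \<in> F \<Longrightarrow> re i \<in> F"
  unfolding triangle_closed_def by blast

lemma length_word [simp]: "length (word F) = n"
  by (simp add: word_def)

lemma nth_word [simp]: "i < n \<Longrightarrow> word F ! i = letter_of F i"
  by (simp add: word_def)

lemma letter_of_Hub: "letter_of F i = Hub \<longleftrightarrow> spoke i \<in> F"
  and letter_of_Cont: "letter_of F i = Cont \<longleftrightarrow> spoke i \<notin> F \<and> i \<in> K \<and> re i \<in> F"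
  and letter_of_Start: "letter_of F i = Start \<longleftrightarrow> spoke i \<notin> F \<and> \<not> (i \<in> K \<and> re i \<in> F)"
  and letter_of_Bar: "letter_of F i \<noteq> Bar"
  by (auto simp: letter_of_def)

lemma Bar_notin_word: "Bar \<notin> set (word F)"
  using letter_of_Bar by (auto simp: word_def) metis

lemma Hub_in_word: "Hub \<in> set (word F) \<longleftrightarrow> (\<exists>i<n. spoke i \<in> F)"
proof -
  have "Hub \<in> set (word F) \<longleftrightarrow> (\<exists>i<n. letter_of F i = Hub)"
    by (force simp: word_def)
  then show ?thesis by (simp add: letter_of_Hub)
qed

lemma word_empty: "word {} = replicate n Start"
  by (intro nth_equalityI) (auto simp: letter_of_def)

lemma triangle_closed_empty: "triangle_closed {}"
  by (simp add: triangle_closed_def)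

lemma word_above_iff:
  assumes "length w = n"
  shows "word_above w v \<longleftrightarrow> (if 0 \<in> K then cyc_above w v else above True w v)"
proof (cases "length v = n")
  case True
  have w: "w \<noteq> []" "v \<noteq> []" using assms True n_pos by auto
  have eq: "(i \<notin> K \<or> v ! prev n i = Hub) \<longleftrightarrow>
      (if i = 0 then (0 \<in> K \<longrightarrow> last v = Hub) else v ! (i - 1) = Hub)" if "i < n" for i
    using in_K[OF that] w True by (auto simp: prev_def last_conv_nth)
  have "word_above w v \<longleftrightarrow> above (0 \<in> K \<longrightarrow> last v = Hub) w v"
    unfolding word_above_def above_nth using assms True eq by simp
  then show ?thesis using w by (simp add: cyc_above_def)
next
  case False
  then have "\<not> above b w v" for b using above_length assms by blast
  then show ?thesis using False by (simp add: word_above_def cyc_above_def)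
qed

text \<open>Letters miss the rim edges between hub vertices, and these are recovered from
  \<open>triangle_closed_re\<close>. A \<open>Cont\<close> of F may turn into \<open>Hub\<close> in
  G, which happens exactly if its predecessor is a hub vertex of G.\<close>

lemma word_above_word_iff:
  assumes F: "triangle_closed F" and G: "triangle_closed G"
  shows "word_above (word F) (word G) \<longleftrightarrow> F \<subseteq> G"
proof
  assume FG: "F \<subseteq> G"
  have "step (i \<notin> K \<or> letter_of G (prev n i) = Hub) (letter_of F i) (letter_of G i)" if i: "i < n" for i
  proof (cases "letter_of F i")
    case Hub
    then have "letter_of G i = Hub" using FG by (auto simp: letter_of_Hub)
    then show ?thesis using Hub by simp
  next
    case Cont
    then have f: "i \<in> K" "re i \<in> G" using FG by (auto simp: letter_of_Cont)
    then have "spoke i \<in> G \<longleftrightarrow> spoke (prev n i) \<in> G" by (rule triangle_closed_spoke_iff[OF G])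
    then have "letter_of G i = (if letter_of G (prev n i) = Hub then Hub else Cont)"
      using f by (simp add: letter_of_def)
    then show ?thesis using Cont f by simp
  next
    case Start
    have "letter_of G i = Cont \<Longrightarrow> i \<in> K \<and> letter_of G (prev n i) \<noteq> Hub"
      using triangle_closed_spoke_iff[OF G, of i] by (auto simp: letter_of_Hub letter_of_Cont)
    then show ?thesis using Start letter_of_Bar[of G i] by (cases "letter_of G i") auto
  qed (simp add: letter_of_Bar)
  then show "word_above (word F) (word G)"
    by (simp add: word_above_def prev_less)
next
  assume "word_above (word F) (word G)"
  then have st: "step (i \<notin> K \<or> letter_of G (prev n i) = Hub) (letter_of F i) (letter_of G i)" if "i < n" for i
    using that by (auto simp: word_above_def prev_less)
  have sp: "spoke i \<in> G" if "spoke i \<in> F" "i < n" for i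
    using st[OF that(2)] that(1) by (simp add: letter_of_Hub[symmetric])
  show "F \<subseteq> G"
  proof
    fix e assume e: "e \<in> F"
    then have "e \<in> E" using triangle_closed_subset[OF F] by blast
    then show "e \<in> G"
    proof (cases rule: edge_cases)
      case (1 i)
      then show ?thesis using sp e by blast
    next
      case (2 i)
      note i = K_less[OF 2(1)]
      show ?thesis
      proof (cases "spoke i \<in> F")
        case True
        then have "spoke (prev n i) \<in> F" using triangle_closed_spoke_iff[OF F 2(1)] e 2(2) by simp
        then have "spoke i \<in> G" "spoke (prev n i) \<in> G"
          using sp[OF _ i] sp[OF _ prev_less[OF i]] True by auto
        then show ?thesis unfolding 2(2) by (rule triangle_closed_re[OF G 2(1)])
      next
        case False
        then have "letter_of F i = Cont" using e 2 by (simp add: letter_of_Cont)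
        then have s: "letter_of G i = (if letter_of G (prev n i) = Hub then Hub else Cont)"
          using st[OF i] 2 by simp
        show ?thesis
        proof (cases "spoke (prev n i) \<in> G")
          case True
          then have "spoke i \<in> G" using s by (simp add: letter_of_Hub)
          then show ?thesis unfolding 2(2) using True by (rule triangle_closed_re[OF G 2(1)])
        next
          case False
          then have "letter_of G i = Cont" using s by (simp add: letter_of_Hub)
          then show ?thesis using 2 by (simp add: letter_of_Cont)
        qed
      qed
    qed
  qed
qed

text \<open>Above the word of a set, \<open>step\<close> excludes \<open>Bar\<close>, and it
  excludes \<open>Cont\<close> after a hub vertex or without an entering rim edge; any word avoiding
  these comes from a triangle-closed set.\<close>

lemma edge_set_word:
  assumes "word_above (word F) v"
  shows "triangle_closed (edge_set v)" "word (edge_set v) = v"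
proof -
  have len: "length v = n" using assms by (simp add: word_above_def)
  have st: "v ! i = Hub \<or> v ! i = Start \<or> v ! i = Cont \<and> i \<in> K \<and> v ! prev n i \<noteq> Hub" if "i < n" for i
  proof -
    have "step (i \<notin> K \<or> v ! prev n i = Hub) (letter_of F i) (v ! i)"
      using assms that by (auto simp: word_above_def)
    then show ?thesis using letter_of_Bar[of F i] by (cases "letter_of F i") (auto split: if_splits)
  qed
  have sp: "spoke i \<in> edge_set v \<longleftrightarrow> v ! i = Hub" if "i < n" for i
    using that by (auto simp: edge_set_def)
  have r: "re i \<in> edge_set v \<longleftrightarrow> v ! i = Cont \<or> v ! i = Hub \<and> v ! prev n i = Hub" if "i \<in> K" for i
    using that re_eq_iff by (auto simp: edge_set_def)
  show "triangle_closed (edge_set v)"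
    unfolding triangle_closed_def
  proof (intro conjI ballI)
    show "edge_set v \<subseteq> E" by (auto simp: edge_set_def E_def)
    fix i assume i: "i \<in> K"
    note l = K_less[OF i] prev_less[OF K_less[OF i]]
    show "re i \<in> edge_set v \<and> spoke i \<in> edge_set v \<longrightarrow> spoke (prev n i) \<in> edge_set v"
      "re i \<in> edge_set v \<and> spoke (prev n i) \<in> edge_set v \<longrightarrow> spoke i \<in> edge_set v"
      "spoke i \<in> edge_set v \<and> spoke (prev n i) \<in> edge_set v \<longrightarrow> re i \<in> edge_set v"
      using st[OF l(1)] unfolding r[OF i] sp[OF l(1)] sp[OF l(2)] by auto
  qed
  show "word (edge_set v) = v"
  proof (rule nth_equalityI)
    fix i assume "i < length (word (edge_set v))"
    then have i: "i < n" by simp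
    show "word (edge_set v) ! i = v ! i"
      using st[OF i] sp[OF i] r[of i] i by (auto simp: letter_of_def)
  qed (simp add: len)
qed

lemma sum_triangle_closed:
  fixes g :: "letter list \<Rightarrow> int poly"
  assumes F: "triangle_closed F"
  shows "(\<Sum>G\<in>{G. triangle_closed G \<and> F \<subseteq> G}. g (word G)) = (\<Sum>v\<in>{v. word_above (word F) v}. g v)"
proof (rule sum.reindex_bij_witness[of _ edge_set word])
  fix G assume "G \<in> {G. triangle_closed G \<and> F \<subseteq> G}"
  then have G: "triangle_closed G" "F \<subseteq> G" by auto
  then show a: "word G \<in> {v. word_above (word F) v}" using word_above_word_iff[OF F] by simp
  then have "triangle_closed (edge_set (word G))" "word (edge_set (word G)) = word G"
    using edge_set_word by auto
  then show "edge_set (word G) = G"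
    using word_above_word_iff G(1) by (metis order_refl subset_antisym)
next
  fix v assume "v \<in> {v. word_above (word F) v}"
  then have v: "word_above (word F) v" by simp
  note e = edge_set_word[OF v]
  then show "word (edge_set v) = v" by simp
  have "F \<subseteq> edge_set v" using word_above_word_iff[OF F e(1)] v e(2) by simp
  then show "edge_set v \<in> {G. triangle_closed G \<and> F \<subseteq> G}" using e by simp
qed simp

text \<open>On a wheel the rim is a circuit, so a flat cannot miss exactly one of its edges; for
  fans the condition is vacuous.\<close>

definition gapless :: "nat set set \<Rightarrow> bool" where
  "gapless F \<longleftrightarrow> (0 \<in> K \<longrightarrow> (\<forall>j<n. (\<forall>i<n. i \<noteq> j \<longrightarrow> re i \<in> F) \<longrightarrow> re j \<in> F))"

lemma joined_common: "(u, v) \<in> joined A \<Longrightarrow> (u, w) \<in> joined A \<Longrightarrow> (v, w) \<in> joined A"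
  by (rule joined_trans[OF joined_sym])

lemma joined_spoke: "spoke i \<in> A \<Longrightarrow> (0, Suc i) \<in> joined A"
  unfolding spoke_def by (rule joined_edge)

lemma joined_re: "re i \<in> A \<Longrightarrow> (Suc (prev n i), Suc i) \<in> joined A"
  unfolding rim_edge_def by (rule joined_edge)

lemma flat_imp:
  assumes "F \<in> flats M"
  shows "triangle_closed F" "gapless F"
proof -
  have F: "F \<subseteq> E" "\<And>e. e \<in> E \<Longrightarrow> spans F e \<Longrightarrow> e \<in> F"
    using assms by (auto simp: flats_iff)
  have s: "spoke i \<in> F" if "i < n" "(0, Suc i) \<in> joined F" for i
    by (rule F(2)[OF spoke_in_E]) (use that in \<open>simp_all add: spoke_def spans_iff\<close>)
  have r: "re i \<in> F" if "i \<in> K" "(Suc (prev n i), Suc i) \<in> joined F" for i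
    by (rule F(2)[OF re_in_E]) (use that in \<open>simp_all add: rim_edge_def spans_iff\<close>)
  show "triangle_closed F"
    unfolding triangle_closed_def
  proof (intro conjI ballI impI)
    fix i assume i: "i \<in> K"
    note l = K_less[OF i] prev_less[OF K_less[OF i]]
    show "spoke (prev n i) \<in> F" if "re i \<in> F \<and> spoke i \<in> F"
      using that joined_trans[OF joined_spoke joined_sym[OF joined_re]] by (intro s[OF l(2)]) blast
    show "spoke i \<in> F" if "re i \<in> F \<and> spoke (prev n i) \<in> F"
      using that joined_trans[OF joined_spoke joined_re] by (intro s[OF l(1)]) blast
    show "re i \<in> F" if "spoke i \<in> F \<and> spoke (prev n i) \<in> F"
      using that joined_trans[OF joined_sym[OF joined_spoke] joined_spoke] by (intro r[OF i]) blast
  qed (rule F(1))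
  show "gapless F"
    unfolding gapless_def
  proof (intro allI impI)
    fix j assume K: "0 \<in> K" and j: "j < n" and others: "\<forall>i<n. i \<noteq> j \<longrightarrow> re i \<in> F"
    have "(Suc j, Suc i) \<in> joined F" if "i < n" for i
    proof (rule cyclic_induct[where P = "\<lambda>i. (Suc j, Suc i) \<in> joined F", OF j _ _ that])
      fix i assume i: "i < n" "i \<noteq> j" "(Suc j, Suc (prev n i)) \<in> joined F"
      then have "re i \<in> F" using others by simp
      then show "(Suc j, Suc i) \<in> joined F"
        using joined_trans[OF i(3) joined_re] by simp
    qed simp
    then have "(Suc j, Suc (prev n j)) \<in> joined F" using prev_less[OF j] by blast
    then show "re j \<in> F"
      using zero_in_K[OF K] j joined_sym by (intro r) auto
  qed
qed

text \<open>The colouring numbers the blocks along the rim, modulo their number if the rim is a cycle;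
  its monochromatic edges are exactly those of \<open>F\<close>.\<close>

lemma flatI:
  assumes F: "triangle_closed F" and g: "gapless F"
  shows "F \<in> flats M"
proof -
  define N where "N i = {l \<in> K. l \<le> i \<and> re l \<notin> F}" for i
  define cnt where "cnt i = card (N i)" for i
  \<comment> \<open>On a full rim \<open>md\<close> is the number of rim edges outside F; for fans
    it is 0, and \<open>x mod 0 = x\<close> leaves the numbers unreduced. Colour 0 is reserved for
    the hub block, hence the \<open>Suc\<close> in c.\<close>
  define md where "md = (if 0 \<in> K then cnt (n - 1) else 0)"
  define c where "c u = (case u of 0 \<Rightarrow> 0 | Suc i \<Rightarrow> if spoke i \<in> F then 0 else Suc (cnt i mod md))" for u
  have fin: "finite (N i)" for i by (rule finite_subset[of _ "{..i}"]) (auto simp: N_def)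
  have cnt_Suc: "cnt i = cnt (i - 1) + (if re i \<in> F then 0 else 1)" if "i \<in> K" "i \<noteq> 0" for i
  proof -
    have "N i = N (i - 1) \<union> (if re i \<in> F then {} else {i})" "i \<notin> N (i - 1)"
      using that by (auto simp: N_def le_less_Suc_eq) (metis Suc_pred le_SucE not_gr_zero)+
    then show ?thesis using fin by (simp add: cnt_def)
  qed
  have cnt_0: "cnt 0 = (if re 0 \<in> F then 0 else 1)" if "0 \<in> K"
  proof -
    have "N 0 = (if re 0 \<in> F then {} else {0})" using that by (auto simp: N_def) (metis neq0_conv)
    then show ?thesis by (simp add: cnt_def)
  qed
  have same: "cnt (prev n i) mod md = cnt i mod md \<longleftrightarrow> re i \<in> F" if i: "i \<in> K" for i
  proof
    assume "re i \<in> F"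
    then show "cnt (prev n i) mod md = cnt i mod md"
      using cnt_Suc[OF i] cnt_0 i by (cases "i = 0") (auto simp: prev_def md_def)
  next
    assume eq: "cnt (prev n i) mod md = cnt i mod md"
    show "re i \<in> F"
    proof (rule ccontr)
      assume no: "re i \<notin> F"
      \<comment> \<open>Adding one is invisible modulo \<open>md\<close> only for
        \<open>md = 1\<close>, that is, if F misses exactly one rim edge, which
        \<open>gapless\<close> rules out.\<close>
      have one: "md = 1"
      proof (cases "i = 0")
        case True
        then have "cnt (n - 1) mod md = 1 mod md" "md = cnt (n - 1)"
          using eq cnt_0 i no by (auto simp: prev_def md_def)
        then have "1 mod md = 0" by simp
        then show ?thesis by (simp add: mod_eq_0_iff_dvd)
      next
        case False
        then have "Suc (cnt (i - 1)) mod md = cnt (i - 1) mod md"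
          using eq cnt_Suc[OF i] no by (simp add: prev_def)
        then show ?thesis by (auto simp: mod_Suc split: if_splits)
      qed
      then have K: "0 \<in> K" and c1: "card (N (n - 1)) = 1"
        by (auto simp: md_def cnt_def split: if_splits)
      have "i \<in> N (n - 1)" using i no K_less[OF i] by (auto simp: N_def)
      then have "N (n - 1) = {i}" using c1 by (metis card_1_singletonE singletonD)
      then have "l \<notin> N (n - 1)" if "l \<noteq> i" for l using that by simp
      moreover have "l \<in> K" if "l < n" for l using that K in_K by (cases "l = 0") auto
      ultimately have "re l \<in> F" if "l < n" "l \<noteq> i" for l using that by (force simp: N_def)
      then show False using g K K_less[OF i] no unfolding gapless_def by blast
    qed
  qed
  have mono: "re i \<in> F \<longleftrightarrow> c (Suc (prev n i)) = c (Suc i)" if i: "i \<in> K" for i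
  proof -
    have "c (Suc (prev n i)) = c (Suc i) \<longleftrightarrow> spoke (prev n i) \<in> F \<and> spoke i \<in> F \<or>
        spoke (prev n i) \<notin> F \<and> spoke i \<notin> F \<and> cnt (prev n i) mod md = cnt i mod md"
      by (simp add: c_def)
    then show ?thesis
      using same[OF i] triangle_closed_spoke_iff[OF F i] triangle_closed_re[OF F i] by blast
  qed
  have F_E: "F \<subseteq> E" by (rule triangle_closed_subset[OF F])
  have edge: "c x = c y" if "{x, y} \<in> F" for x y
  proof -
    have "{x, y} \<in> E" using that F_E by blast
    then show ?thesis
    proof (cases rule: edge_cases)
      case (1 i)
      then have "c (Suc i) = c 0" using that by (simp add: c_def)
      then show ?thesis using 1 by (auto simp: spoke_def doubleton_eq_iff)
    next
      case (2 i)
      then have "c (Suc (prev n i)) = c (Suc i)" using that mono by simp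
      then show ?thesis using 2 by (auto simp: rim_edge_def doubleton_eq_iff)
    qed
  qed
  have "e \<in> F" if "e \<in> E" "spans F e" for e
    using that(1)
  proof (cases rule: edge_cases)
    case (1 i)
    then have "(0, Suc i) \<in> joined F" using that(2) by (simp add: spoke_def spans_iff)
    then have "c 0 = c (Suc i)" by (rule joined_colour) (rule edge)
    then show ?thesis using 1 by (simp add: c_def split: if_splits)
  next
    case (2 i)
    then have "(Suc (prev n i), Suc i) \<in> joined F" using that(2) by (simp add: rim_edge_def spans_iff)
    then have "c (Suc (prev n i)) = c (Suc i)" by (rule joined_colour) (rule edge)
    then show ?thesis using 2 mono by simp
  qed
  then show ?thesis using F_E by (simp add: flats_iff)
qed

subsection \<open>Ranks\<close>

lemma rank_full:
  assumes A: "A \<subseteq> E" and all: "\<And>i. i < n \<Longrightarrow> (0, Suc i) \<in> joined A"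
  shows "rank_of M A = rank_of M E"
proof (rule rank_of_spanned[symmetric])
  fix e assume "e \<in> E"
  then show "spans A e"
  proof (cases rule: edge_cases)
    case (1 i)
    then show ?thesis using all by (simp add: spoke_def spans_iff)
  next
    case (2 i)
    then have "(0, Suc (prev n i)) \<in> joined A" "(0, Suc i) \<in> joined A"
      using all K_less prev_less by auto
    then have "(Suc (prev n i), Suc i) \<in> joined A" by (rule joined_common)
    then show ?thesis by (simp add: 2 rim_edge_def spans_iff)
  qed
qed (use A in auto)

lemma rank_E: "rank_of M E = n"
proof -
  let ?S = "spoke ` {..<n}"
  have S: "?S \<subseteq> E" by (auto simp: E_def)
  have "indep M ?S"
    unfolding indep_iff
  proof (intro conjI ballI)
    fix x assume "x \<in> ?S"
    then obtain i where i: "x = spoke i" by blast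
    show "\<not> spans (?S - {x}) x"
    proof
      assume "spans (?S - {x}) x"
      then have "(0, Suc i) \<in> joined (?S - {x})" by (simp add: i spoke_def spans_iff)
      then have "(0 = Suc i) = (Suc i = Suc i)"
        by (rule joined_colour) (auto simp: i spoke_def doubleton_eq_iff)
      then show False by simp
    qed
  qed (use S in simp)
  then have "rank_of M ?S = card ?S" by (rule rank_of_indep[OF is_matroid])
  also have "card ?S = n" by (simp add: card_image inj_on_def)
  finally show ?thesis
    using rank_full[OF S] joined_spoke by auto
qed

lemma rk_M: "rk M = n"
  by (simp add: rk_def rank_E)

lemma blocks_word: "blocks (word F) = card {i. i < n \<and> letter_of F i = Start}"
proof -
  have "blocks (word F) = card {i. i < length (word F) \<and> (word F ! i = Start \<or> word F ! i = Bar)}"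
    unfolding blocks_def by (rule length_filter_conv_card)
  also have "{i. i < length (word F) \<and> (word F ! i = Start \<or> word F ! i = Bar)} = {i. i < n \<and> letter_of F i = Start}"
    using letter_of_Bar by auto
  finally show ?thesis .
qed

lemma blocks_word_le: "blocks (word F) \<le> n"
  unfolding blocks_word using card_mono[of "{..<n}" "{i. i < n \<and> letter_of F i = Start}"] by auto

text \<open>Upper bound: F is spanned by one edge per letter other than \<open>Start\<close>, its
  spoke or else its rim edge. Lower bound: adding the spokes at the letters \<open>Start\<close>
  connects everything to the hub, starting from j. The condition on j excludes the rim of a wheel,
  whose rank is n - 1 although its word has no block.\<close>

lemma rank_triangle_closed:
  assumes F: "triangle_closed F" and j: "j < n" "letter_of F j \<noteq> Cont"
  shows "rank_of M F = n - blocks (word F)"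
proof (rule antisym)
  have FE: "F \<subseteq> E" by (rule triangle_closed_subset[OF F])
  let ?I = "{i. i < n \<and> letter_of F i \<noteq> Start}"
  let ?B = "(\<lambda>i. if spoke i \<in> F then spoke i else re i) ` ?I"
  have BF: "?B \<subseteq> F" using letter_of_Bar by (auto simp: letter_of_def split: if_splits)
  have s: "(0, Suc i) \<in> joined ?B" if "i < n" "spoke i \<in> F" for i
  proof (rule joined_spoke)
    have "i \<in> ?I" using that by (simp add: letter_of_Start)
    then have "(if spoke i \<in> F then spoke i else re i) \<in> ?B" by (rule imageI)
    then show "spoke i \<in> ?B" using that by simp
  qed
  have "spans ?B e" if e: "e \<in> F" for e
  proof -
    have "e \<in> E" using e FE by blast
    then show ?thesis
    proof (cases rule: edge_cases)
      case (1 i)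
      then show ?thesis using s e by (simp add: spoke_def spans_iff)
    next
      case (2 i)
      note l = K_less[OF 2(1)] prev_less[OF K_less[OF 2(1)]]
      show ?thesis
      proof (cases "spoke i \<in> F")
        case True
        then have "spoke (prev n i) \<in> F" using triangle_closed_spoke_iff[OF F 2(1)] e 2(2) by simp
        then have "(Suc (prev n i), Suc i) \<in> joined ?B"
          using joined_common[OF s s] l True by simp
        then show ?thesis by (simp only: 2 rim_edge_def spans_iff)
      next
        case False
        then have "i \<in> ?I" using l e 2 by (simp add: letter_of_Start)
        then have "(if spoke i \<in> F then spoke i else re i) \<in> ?B" by (rule imageI)
        then have "re i \<in> ?B" using False by simp
        then have "(Suc (prev n i), Suc i) \<in> joined ?B" by (rule joined_re)
        then show ?thesis by (simp only: 2 rim_edge_def spans_iff)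
      qed
    qed
  qed
  then have "rank_of M F = rank_of M ?B"
    using BF FE by (intro rank_of_spanned) auto
  also have "\<dots> \<le> rank_of M {} + card ?B"
    using rank_of_Un_le[OF is_matroid, of ?B "{}"] by simp
  also have "\<dots> \<le> card ?I"
    unfolding rank_of_empty[OF is_matroid] add_0 by (rule card_image_le) simp
  also have "card ?I = n - blocks (word F)"
  proof -
    have "?I = {..<n} - {i. i < n \<and> letter_of F i = Start}" by auto
    then show ?thesis unfolding blocks_word by (simp only:) (subst card_Diff_subset, auto)
  qed
  finally show "rank_of M F \<le> n - blocks (word F)" .
  let ?S = "spoke ` {i. i < n \<and> letter_of F i = Start}"
  let ?A = "F \<union> ?S"
  have AE: "?A \<subseteq> E" using FE by (auto simp: E_def)
  have nc: "(0, Suc i) \<in> joined ?A" if "i < n" "letter_of F i \<noteq> Cont" for i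
    using that letter_of_Bar by (intro joined_spoke) (auto simp: letter_of_def split: if_splits)
  have "(0, Suc i) \<in> joined ?A" if "i < n" for i
  proof (rule cyclic_induct[where P = "\<lambda>i. (0, Suc i) \<in> joined ?A", OF j(1) _ _ that])
    show "(0, Suc j) \<in> joined ?A" by (rule nc[OF j])
    fix i assume i: "i < n" "i \<noteq> j" "(0, Suc (prev n i)) \<in> joined ?A"
    show "(0, Suc i) \<in> joined ?A"
    proof (cases "letter_of F i = Cont")
      case True
      then have "re i \<in> ?A" by (simp add: letter_of_Cont)
      then show ?thesis by (rule joined_trans[OF i(3) joined_re])
    next
      case False
      then show ?thesis using nc i by blast
    qed
  qed
  then have "n = rank_of M ?A" using rank_full[OF AE] rank_E by simp
  also have "\<dots> \<le> rank_of M F + card ?S"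
    by (rule rank_of_Un_le[OF is_matroid]) simp
  also have "card ?S = blocks (word F)"
    unfolding blocks_word by (simp add: card_image inj_on_def)
  finally show "n - blocks (word F) \<le> rank_of M F" by simp
qed

end

context rim_graph
begin

lemma rank_diff:
  assumes "triangle_closed F" "\<exists>j<n. letter_of F j \<noteq> Cont"
    and "triangle_closed G" "\<exists>j<n. letter_of G j \<noteq> Cont"
  shows "rank_of M G - rank_of M F = blocks (word F) - blocks (word G)"
  using rank_triangle_closed assms blocks_word_le[of F] blocks_word_le[of G] by auto

lemma flat_blocks_pos:
  assumes "F \<in> flats M" "F \<noteq> E" "\<exists>j<n. letter_of F j \<noteq> Cont"
  shows "0 < blocks (word F)"
proof (rule ccontr)
  assume "\<not> 0 < blocks (word F)"
  then have "rank_of M F = n"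
    using rank_triangle_closed flat_imp(1)[OF assms(1)] assms(3) by auto
  moreover have "rank_of M F < rank_of M E"
    using assms by (intro rank_of_flat_less[OF is_matroid]) (auto simp: flats_iff)
  ultimately show False by (simp add: rank_E)
qed

lemma word_E: "word E = replicate n Hub"
  by (intro nth_equalityI) (auto simp: letter_of_def spoke_in_E)

lemma set_word: "set (word F) \<subseteq> {Hub, Start, Cont}"
  using Bar_notin_word[of F] letter_UNIV by auto

end

subsubsection \<open>Fans\<close>

lemma blocks_replicate [simp]: "blocks (replicate n Hub) = 0" "blocks (replicate n Start) = n"
  by (simp_all add: blocks_def)

lemma spokes_eq: "spokes n = spoke ` {..<n}"
proof (intro equalityI subsetI)
  fix e assume "e \<in> spokes n"
  then obtain i where i: "e = {0, i}" "1 \<le> i" "i \<le> n" unfolding spokes_def by blast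
  then have "e = spoke (i - 1)" "i - 1 < n" by (auto simp: spoke_def)
  then show "e \<in> spoke ` {..<n}" by blast
next
  fix e assume "e \<in> spoke ` {..<n}"
  then obtain i where "i < n" "e = {0, Suc i}" unfolding spoke_def by blast
  then show "e \<in> spokes n" unfolding spokes_def by force
qed

lemma fan_edges:
  "snd (fan_graph n) = rim_edge n ` {1..<n} \<union> spoke ` {..<n}"
proof -
  have "{{i, i + 1} | i. 1 \<le> i \<and> i < n} = rim_edge n ` {1..<n}"
    by (force simp: rim_edge_def prev_def)
  then show ?thesis by (simp add: fan_graph_def spokes_eq)
qed

lemma Z_fan:
  assumes "1 \<le> n"
  shows "Z_graph (fan_graph n) = nar n"
proof -
  interpret rim_graph n "{Suc 0..<n}" using assms by unfold_locales simp
  have E: "snd (fan_graph n) = E" unfolding fan_edges E_def One_nat_def ..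
  have M: "graphic_matroid (fan_graph n) = M" by (simp only: M_def graphic_matroid_def E snd_conv)
  have nC: "\<exists>j<n. letter_of F j \<noteq> Cont" for F
    using assms by (intro exI[of _ 0]) (auto simp: letter_of_Cont)
  have flats: "F \<in> flats M \<longleftrightarrow> triangle_closed F" for F
    using flat_imp flatI by (auto simp: gapless_def)
  define f where "f F = run_weight 0 (word F)" for F
  have kl: "kl_bound (blocks (word F)) (f F)" for F
    unfolding f_def using kl_bound_run_weight[of 0 "word F"] by simp
  have rank: "rk M - rank_of M F = blocks (word F)" if "F \<in> flats M" for F
  proof -
    obtain j where "j < n" "letter_of F j \<noteq> Cont" using nC by blast
    then show ?thesis
      using that rank_triangle_closed[of F j] flats blocks_word_le[of F] by (simp add: rk_M)
  qed
  have Z: "upper_Z M f F = upper_sum 0 (word F)" if F: "F \<in> flats M" for F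
  proof -
    have "upper_Z M f F = (\<Sum>G\<in>{G. triangle_closed G \<and> F \<subseteq> G}. monom 1 (blocks (word F) - blocks (word G)) * run_weight 0 (word G))"
      unfolding upper_Z_def f_def
      using F rank_diff[OF _ nC _ nC] by (intro sum.cong) (auto simp: flats)
    also have "\<dots> = (\<Sum>v\<in>{v. word_above (word F) v}. monom 1 (blocks (word F) - blocks v) * run_weight 0 v)"
      using F by (intro sum_triangle_closed) (simp add: flats)
    also have "\<dots> = upper_sum 0 (word F)"
      unfolding upper_sum_def by (intro sum.cong) (auto simp: word_above_iff)
    finally show ?thesis .
  qed
  have "Z_poly M = upper_Z M f {}"
  proof (rule Z_poly_eqI[OF is_matroid loopless_M])
    show "f (ground M) = 1"
      using kl[of E] by (simp add: word_E kl_bound_def)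
    show "2 * degree (f F) < rk M - rank_of M F" if "F \<in> flats M" "F \<noteq> ground M" for F
      using kl[of F] flat_blocks_pos[of F] nC that by (simp add: rank kl_bound_def)
    show "palindromic (rk M - rank_of M F) (upper_Z M f F)" if "F \<in> flats M" for F
      unfolding Z[OF that] rank[OF that] by (rule palindromic_upper_sum[OF Bar_notin_word])
  qed
  also have "\<dots> = nar n"
    using Z[of "{}"] upper_sum_Start_replicate[of n] by (simp add: flats triangle_closed_empty word_empty)
  finally show ?thesis by (simp add: Z_graph_def M)
qed

subsubsection \<open>Wheels and whirls\<close>

locale wheel =
  fixes n :: nat
  assumes n3: "3 \<le> n"
begin

sublocale rim_graph n "{..<n}"
  using n3 by unfold_locales simp

lemma rim_eq: "rim n = re ` {..<n}"
proof -
  have "{{i, i + 1} | i. 1 \<le> i \<and> i < n} = re ` {1..<n}"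
    by (force simp: rim_edge_def prev_def)
  moreover have "{{n, 1}} = re ` {0}" using n3 by (simp add: rim_edge_def prev_def)
  moreover have "{..<n} = {1..<n} \<union> {0}" using n3 by auto
  ultimately show ?thesis unfolding rim_def by (simp add: image_Un)
qed

lemma wheel_edges: "snd (wheel_graph n) = E"
  by (simp add: wheel_graph_def rim_eq spokes_eq E_def)

lemma M_eq: "M = graphic_matroid (wheel_graph n)"
  by (simp add: M_def graphic_matroid_def wheel_edges)

lemma rim_subset: "rim n \<subseteq> E"
  by (auto simp: rim_eq E_def)

lemma re_in_rim: "i < n \<Longrightarrow> re i \<in> rim n"
  by (simp add: rim_eq)

lemma spoke_notin_rim [simp]: "spoke i \<notin> rim n"
  by (auto simp: rim_eq)

lemma card_rim: "card (rim n) = n"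
  unfolding rim_eq by (subst card_image) (auto simp: inj_on_def re_eq_iff)

lemma finite_rim: "finite (rim n)"
  by (simp add: rim_eq)

lemma subset_rim_iff: "F \<subseteq> E \<Longrightarrow> F \<subseteq> rim n \<longleftrightarrow> (\<forall>i<n. spoke i \<notin> F)"
  by (auto simp: rim_eq E_def)

lemma triangle_closed_rim_subset: "F \<subseteq> rim n \<Longrightarrow> triangle_closed F"
  using rim_subset by (auto simp: triangle_closed_def)

lemma all_Cont_iff:
  assumes "F \<subseteq> E"
  shows "(\<exists>j<n. letter_of F j \<noteq> Cont) \<longleftrightarrow> F \<noteq> rim n"
proof -
  have "(\<forall>j<n. letter_of F j = Cont) \<longleftrightarrow> (\<forall>j<n. spoke j \<notin> F) \<and> (\<forall>j<n. re j \<in> F)"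
    by (auto simp: letter_of_Cont)
  also have "\<dots> \<longleftrightarrow> F = rim n"
    using subset_rim_iff[OF assms] by (auto simp: rim_eq)
  finally show ?thesis by blast
qed

lemma rank_hub_rim:
  assumes A: "A \<subseteq> E" "rim n \<subseteq> A" "i < n" "spoke i \<in> A"
  shows "rank_of M A = n"
proof -
  have "(0, Suc j) \<in> joined A" if "j < n" for j
  proof (rule cyclic_induct[where P = "\<lambda>j. (0, Suc j) \<in> joined A", OF A(3) _ _ that])
    show "(0, Suc i) \<in> joined A" by (rule joined_spoke[OF A(4)])
    fix j assume j: "j < n" "j \<noteq> i" "(0, Suc (prev n j)) \<in> joined A"
    have "re j \<in> A" using A(2) re_in_rim[OF j(1)] by blast
    then show "(0, Suc j) \<in> joined A" by (rule joined_trans[OF j(3) joined_re])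
  qed
  then show ?thesis using rank_full[OF A(1)] rank_E by simp
qed

lemma rank_rim_minus: "j < n \<Longrightarrow> rank_of M (rim n - {re j}) = n - 1"
proof -
  assume j: "j < n"
  have "letter_of (rim n - {re j}) i = (if i = j then Start else Cont)" if "i < n" for i
    using that j re_eq_iff by (auto simp: letter_of_def rim_eq)
  then have "{i. i < n \<and> letter_of (rim n - {re j}) i = Start} = {j}" and "letter_of (rim n - {re j}) j \<noteq> Cont"
    using j by (auto split: if_splits)
  then show ?thesis
    using rank_triangle_closed[OF triangle_closed_rim_subset _ _, of "rim n - {re j}" j] j
    by (simp add: blocks_word)
qed

lemma rim_flat: "rim n \<in> flats M"
  by (rule flatI) (auto simp: triangle_closed_rim_subset gapless_def re_in_rim)

lemma rank_rim: "rank_of M (rim n) = n - 1"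
proof (rule antisym)
  have "rim n \<noteq> E" using spoke_in_E[of 0] n_pos spoke_notin_rim[of 0] by metis
  then have "rank_of M (rim n) < rank_of M E"
    using rim_subset by (intro rank_of_flat_less[OF is_matroid rim_flat]) auto
  then show "rank_of M (rim n) \<le> n - 1" by (simp add: rank_E)
  show "n - 1 \<le> rank_of M (rim n)"
    using rank_rim_minus[of 0] rank_of_mono[OF is_matroid, of "rim n - {re 0}" "rim n"] n3 by auto
qed

lemma rim_not_indep: "\<not> indep M (rim n)"
  using rank_of_indep[OF is_matroid, of "rim n"] rank_rim card_rim n3 by auto

lemma indep_rim_psubset:
  assumes "X \<subset> rim n"
  shows "indep M X"
proof -
  obtain j where j: "j < n" "X \<subseteq> rim n - {re j}" using assms by (auto simp: rim_eq)
  obtain B where B: "B \<subseteq> rim n - {re j}" "indep M B" "card B = n - 1"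
    using exists_basis[OF is_matroid, of "rim n - {re j}"] rank_rim_minus[OF j(1)]
    by (auto simp: basis_of_def)
  have "card (rim n - {re j}) = n - 1"
    using card_rim finite_rim re_in_rim[OF j(1)] by simp
  then have "B = rim n - {re j}"
    using B finite_rim by (intro card_subset_eq) auto
  then show ?thesis using indep_subset[OF is_matroid B(2)] j by blast
qed

text \<open>If exactly one rim edge were missing, any spoke would spread along the other rim edges
  and force the missing one. So a set that is not gapless has no spoke and is the rim minus one
  edge.\<close>

lemma gapless_iff:
  assumes F: "triangle_closed F"
  shows "gapless F \<longleftrightarrow> \<not> (Hub \<notin> set (word F) \<and> blocks (word F) = 1)"
proof
  assume g: "gapless F"
  show "\<not> (Hub \<notin> set (word F) \<and> blocks (word F) = 1)"
  proof
    assume *: "Hub \<notin> set (word F) \<and> blocks (word F) = 1"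
    then have "card {i. i < n \<and> letter_of F i = Start} = 1" by (simp add: blocks_word)
    then obtain j where j: "{i. i < n \<and> letter_of F i = Start} = {j}"
      by (rule card_1_singletonE)
    have "re i \<in> F" if "i < n" "i \<noteq> j" for i
    proof -
      have "letter_of F i \<noteq> Start" using j that by auto
      then show ?thesis using that * by (auto simp: letter_of_Start Hub_in_word)
    qed
    moreover have "j < n" "re j \<notin> F" using j by (auto simp: letter_of_Start)
    ultimately show False using g n3 by (auto simp: gapless_def)
  qed
next
  assume *: "\<not> (Hub \<notin> set (word F) \<and> blocks (word F) = 1)"
  show "gapless F"
    unfolding gapless_def
  proof (intro impI allI, rule ccontr)
    fix j assume j: "j < n" "\<forall>i<n. i \<noteq> j \<longrightarrow> re i \<in> F" "re j \<notin> F"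
    have P: "spoke i \<in> F \<longleftrightarrow> spoke j \<in> F" if "i < n" for i
    proof (rule cyclic_induct[where P = "\<lambda>i. spoke i \<in> F \<longleftrightarrow> spoke j \<in> F", OF j(1) _ _ that])
      fix i assume "i < n" "i \<noteq> j" "spoke (prev n i) \<in> F \<longleftrightarrow> spoke j \<in> F"
      then show "spoke i \<in> F \<longleftrightarrow> spoke j \<in> F"
        using triangle_closed_spoke_iff[OF F, of i] j(2) by simp
    qed simp
    have "spoke j \<notin> F"
      using triangle_closed_re[OF F, of j] P[OF prev_less[OF j(1)]] j(1,3) by auto
    then have no: "\<forall>i<n. spoke i \<notin> F" using P by blast
    then have "{i. i < n \<and> letter_of F i = Start} = {j}"
      using j by (auto simp: letter_of_Start)
    then show False using * no by (simp add: blocks_word Hub_in_word)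
  qed
qed

lemma kl_bound_cyc_weight:
  assumes "Hub \<in> set v"
  shows "kl_bound (blocks v) (cyc_weight h v)"
proof -
  obtain a b where v: "v = a @ Hub # b" using assms by (meson split_list)
  then show ?thesis
    using kl_bound_run_weight[of 0 "b @ a"] by (simp add: cyc_weight_cut add.commute)
qed

lemma sum_cyc:
  assumes "triangle_closed F"
  shows "(\<Sum>G\<in>{G. triangle_closed G \<and> F \<subseteq> G}. monom 1 (blocks (word F) - blocks (word G)) * cyc_weight h (word G)) =
    cyc_sum h (word F)"
  unfolding cyc_sum_def using sum_triangle_closed[OF assms] n_pos by (simp add: word_above_iff)

lemma set_word_no_hub: "Hub \<notin> set (word F) \<Longrightarrow> set (word F) \<subseteq> {Start, Cont}"
  using set_word[of F] by auto

lemma blocks_pos: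
  assumes "F \<subseteq> E" "F \<noteq> rim n" "Hub \<notin> set (word F)"
  shows "0 < blocks (word F)"
proof -
  obtain j where j: "j < n" "letter_of F j \<noteq> Cont" using all_Cont_iff assms by blast
  then have "letter_of F j = Start"
    using assms(3) letter_of_Bar[of F j] by (cases "letter_of F j") (auto simp: Hub_in_word letter_of_Hub)
  then have "{i. i < n \<and> letter_of F i = Start} \<noteq> {}" using j by auto
  then show ?thesis by (simp add: blocks_word card_gt_0_iff)
qed

lemma cyc_weight_rim: "cyc_weight h (word (rim n)) = h 0"
proof -
  have "Hub \<notin> set (word (rim n))" by (simp add: Hub_in_word)
  moreover have "blocks (word (rim n)) = 0"
    using re_in_rim by (auto simp: blocks_word letter_of_Start)
  ultimately show ?thesis by (simp add: cyc_weight_def)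
qed

lemma cyc_weight_E: "cyc_weight h (word E) = 1"
proof -
  have "Hub \<in> set (word E)" using n_pos by (simp add: word_E)
  from kl_bound_cyc_weight[OF this] show ?thesis by (simp add: kl_bound_def word_E)
qed

lemma rank_blocks: "triangle_closed F \<Longrightarrow> F \<noteq> rim n \<Longrightarrow> n - rank_of M F = blocks (word F)"
  using all_Cont_iff[OF triangle_closed_subset] rank_triangle_closed blocks_word_le by fastforce

lemma rank_diff_blocks:
  "triangle_closed F \<Longrightarrow> triangle_closed G \<Longrightarrow> F \<noteq> rim n \<Longrightarrow> G \<noteq> rim n \<Longrightarrow>
   rank_of M G - rank_of M F = blocks (word F) - blocks (word G)"
  using rank_diff all_Cont_iff triangle_closed_subset by metis

lemma finite_triangle_closed: "finite {G. triangle_closed G \<and> P G}"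
  by (rule finite_subset[of _ "Pow E"]) (auto simp: finite_E dest: triangle_closed_subset)

section \<open>The whirl as a relaxation of the wheel\<close>

lemma ground_whirl [simp]: "ground (whirl_matroid n) = E"
  by (simp add: whirl_matroid_def wheel_edges)

lemma indep_whirl: "indep (whirl_matroid n) X \<longleftrightarrow> indep M X \<or> X = rim n"
  by (auto simp: whirl_matroid_def M_eq graphic_matroid_def)

lemma is_matroid_whirl: "is_matroid (whirl_matroid n)"
  unfolding is_matroid_def
proof (intro conjI allI impI)
  show "finite (ground (whirl_matroid n))" by (simp add: finite_E)
  show "X \<subseteq> ground (whirl_matroid n)" if "indep (whirl_matroid n) X" for X
    using that indep_ground[OF is_matroid, of X] rim_subset unfolding indep_whirl by auto
  show "indep (whirl_matroid n) {}"
    using is_matroid by (simp add: indep_whirl is_matroid_def)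
  show "indep (whirl_matroid n) Y" if "indep (whirl_matroid n) X \<and> Y \<subseteq> X" for X Y
    using that indep_subset[OF is_matroid, of X Y] indep_rim_psubset[of Y] unfolding indep_whirl by blast
  show "\<exists>y\<in>Y - X. indep (whirl_matroid n) (insert y X)"
    if *: "indep (whirl_matroid n) X \<and> indep (whirl_matroid n) Y \<and> card X < card Y" for X Y
  proof -
    have le: "card Z \<le> n" if "indep (whirl_matroid n) Z" for Z
      using that indep_card_le_rank[OF is_matroid, of Z E] indep_ground[OF is_matroid, of Z] card_rim rank_E
      unfolding indep_whirl by auto
    have X: "indep M X" using * le[of Y] card_rim unfolding indep_whirl by auto
    show ?thesis
    proof (cases "indep M Y")
      case True
      then show ?thesis using indep_augment[OF is_matroid X True] * unfolding indep_whirl by blast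
    next
      case False
      then have Y: "Y = rim n" using * unfolding indep_whirl by blast
      show ?thesis
      proof (cases "X \<subseteq> rim n")
        case True
        moreover have "X \<noteq> rim n" using * Y by auto
        ultimately obtain y where y: "y \<in> rim n - X" by blast
        then have "insert y X = rim n \<or> insert y X \<subset> rim n" using True by blast
        then show ?thesis using y Y indep_rim_psubset unfolding indep_whirl by blast
      next
        case False
        have XE: "X \<subseteq> E" using indep_ground[OF is_matroid X] by simp
        then obtain i where "i < n" "spoke i \<in> X" using False subset_rim_iff by blast
        \<comment> \<open>Since X contains a spoke, X and the rim together have full rank; so X
          extends to a basis by elements of the rim alone.\<close>
        then have "rank_of M (X \<union> rim n) = n"
          using XE rim_subset by (intro rank_hub_rim) auto
        then obtain B where B: "B \<subseteq> X \<union> rim n" "indep M B" "card B = n" "X \<subseteq> B"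
          using extend_to_basisE[OF is_matroid X, of "X \<union> rim n"] by auto
        have "X \<noteq> B" using B(3) * le[of Y] by auto
        then obtain y where y: "y \<in> B" "y \<notin> X" using B(4) by blast
        then have "indep M (insert y X)" using B(4) by (intro indep_subset[OF is_matroid B(2)]) blast
        then show ?thesis using y B(1) Y unfolding indep_whirl by blast
      qed
    qed
  qed
qed

lemma loopless_whirl: "loopless (whirl_matroid n)"
  using loopless_M by (simp add: loopless_def indep_whirl)

text \<open>Only the rim gains rank: a larger set contains a spoke and has rank n already in the
  wheel.\<close>

lemma rank_whirl:
  assumes A: "A \<subseteq> E"
  shows "rank_of (whirl_matroid n) A = (if A = rim n then n else rank_of M A)"
proof (rule antisym)
  obtain X where X: "X \<subseteq> A" "indep (whirl_matroid n) X" "card X = rank_of (whirl_matroid n) A"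
    using exists_basis[OF is_matroid_whirl] by (auto simp: basis_of_def)
  show "rank_of (whirl_matroid n) A \<le> (if A = rim n then n else rank_of M A)"
  proof (cases "X = rim n")
    case True
    show ?thesis
    proof (cases "A = rim n")
      case False
      then have "\<not> A \<subseteq> rim n" using X(1) True by blast
      then obtain i where "i < n" "spoke i \<in> A" using subset_rim_iff[OF A] by blast
      then have "rank_of M A = n" using X(1) True A by (intro rank_hub_rim) auto
      then show ?thesis using X(3) True card_rim False by simp
    qed (use X(3) True card_rim in simp)
  next
    case False
    then have "indep M X" using X(2) by (simp add: indep_whirl)
    then have "card X \<le> rank_of M A" using X(1) by (rule indep_card_le_rank[OF is_matroid])
    moreover have "rank_of M (rim n) \<le> n" by (simp add: rank_rim)
    ultimately show ?thesis using X(3) by auto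
  qed
  show "(if A = rim n then n else rank_of M A) \<le> rank_of (whirl_matroid n) A"
  proof (cases "A = rim n")
    case True
    then show ?thesis
      using indep_card_le_rank[OF is_matroid_whirl, of "rim n" A] card_rim by (simp add: indep_whirl)
  next
    case False
    obtain B where "B \<subseteq> A" "indep M B" "card B = rank_of M A"
      using exists_basis[OF is_matroid] by (auto simp: basis_of_def)
    then show ?thesis
      using False indep_card_le_rank[OF is_matroid_whirl, of B A] by (simp add: indep_whirl)
  qed
qed

lemma rim_minus_insert: "j < n \<Longrightarrow> insert (re j) (rim n - {re j}) = rim n"
  using re_in_rim by blast

text \<open>Relaxation turns the rim into a basis, so it ceases to be a flat, while each set "rim
  minus one edge" becomes one, because its missing edge now raises the rank.\<close>

lemma flats_whirl: "F \<in> flats (whirl_matroid n) \<longleftrightarrow> triangle_closed F \<and> F \<noteq> rim n"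
proof
  assume F: "F \<in> flats (whirl_matroid n)"
  have FE: "F \<subseteq> E" using F by (simp add: flats_def)
  have gain: "rank_of (whirl_matroid n) F < rank_of (whirl_matroid n) (insert e F)" if "e \<in> E" "e \<notin> F" for e
    using F that by (simp add: flats_def)
  have nr: "F \<noteq> rim n"
  proof
    assume r: "F = rim n"
    have "rank_of M (insert (spoke 0) (rim n)) = n"
      using rim_subset spoke_in_E n_pos by (intro rank_hub_rim[of _ 0]) auto
    moreover have "insert (spoke 0) (rim n) \<noteq> rim n" using spoke_notin_rim by blast
    ultimately show False
      using gain[of "spoke 0"] spoke_in_E[OF n_pos] rim_subset r by (simp add: rank_whirl)
  qed
  moreover have "triangle_closed F"
  proof (cases "F \<in> flats M")
    case True
    then show ?thesis by (rule flat_imp)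
  next
    case False
    then obtain e where e: "e \<in> E" "e \<notin> F" "\<not> rank_of M F < rank_of M (insert e F)"
      using FE by (auto simp: flats_def)
    have "insert e F = rim n"
    proof (rule ccontr)
      assume "insert e F \<noteq> rim n"
      then show False using gain[OF e(1,2)] e(1,3) FE nr by (simp add: rank_whirl)
    qed
    then show ?thesis by (intro triangle_closed_rim_subset) blast
  qed
  ultimately show "triangle_closed F \<and> F \<noteq> rim n" by simp
next
  assume F: "triangle_closed F \<and> F \<noteq> rim n"
  have FE: "F \<subseteq> E" using F triangle_closed_subset by blast
  have up: "rank_of M A \<le> rank_of (whirl_matroid n) A" if "A \<subseteq> E" for A
    using that rank_rim by (simp add: rank_whirl)
  have "rank_of (whirl_matroid n) F < rank_of (whirl_matroid n) (insert e F)" if e: "e \<in> E" "e \<notin> F" for e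
  proof (cases "spans F e")
    case False
    then have "rank_of M F < rank_of M (insert e F)"
      using rank_of_insert_gt_iff[of F e] FE e by simp
    then show ?thesis using up[of "insert e F"] e FE F by (simp add: rank_whirl)
  next
    case True
    \<comment> \<open>Closed under triangles but not flat in the wheel, F must be the rim minus one
      edge, and e is that edge.\<close>
    then have "F \<notin> flats M" using e by (auto simp: flats_iff)
    then have "\<not> gapless F" using flatI F by blast
    then have h: "Hub \<notin> set (word F)" "blocks (word F) = 1" using gapless_iff F by auto
    then have "F \<subseteq> rim n" using subset_rim_iff[OF FE] Hub_in_word by blast
    obtain j where sj: "{i. i < n \<and> letter_of F i = Start} = {j}"
      using h(2) unfolding blocks_word by (rule card_1_singletonE)
    then have jn: "j < n" by blast
    have j: "letter_of F i = Start \<longleftrightarrow> i = j" if "i < n" for i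
      using sj that by blast
    have re: "re i \<in> F \<longleftrightarrow> i \<noteq> j" if "i < n" for i
    proof -
      have "spoke i \<notin> F" using h(1) that unfolding Hub_in_word by blast
      then show ?thesis using j[OF that] that unfolding letter_of_Start lessThan_iff by blast
    qed
    have rF: "F = rim n - {re j}"
    proof
      show "F \<subseteq> rim n - {re j}" using \<open>F \<subseteq> rim n\<close> re[OF jn] by blast
      show "rim n - {re j} \<subseteq> F"
      proof
        fix e assume "e \<in> rim n - {re j}"
        then obtain i where "i < n" "e = re i" "i \<noteq> j" unfolding rim_eq by blast
        then show "e \<in> F" using re by simp
      qed
    qed
    have "e = re j"
    proof (rule ccontr)
      assume "e \<noteq> re j"
      then have "e \<notin> rim n" using e(2) rF by blast
      then obtain i where i: "e = spoke i" using e(1) by (auto simp: rim_eq E_def)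
      then have "(0, Suc i) \<in> joined F" using True by (simp add: spoke_def spans_iff)
      then have "(0 = (0 :: nat)) = (Suc i = 0)"
        by (rule joined_colour) (auto simp: rF rim_eq rim_edge_def doubleton_eq_iff)
      then show False by simp
    qed
    then have "insert e F = rim n" using rF rim_minus_insert[OF jn] by simp
    then show ?thesis
      using rF rank_rim_minus[OF jn] FE F rim_subset n_pos by (simp add: rank_whirl)
  qed
  then show "F \<in> flats (whirl_matroid n)" using FE by (simp add: flats_def)
qed

lemma binom_sum_whirl:
  "1 \<le> m \<Longrightarrow> binom_sum whirl_kl m 0 + fps_nth hub_part m = narB m"
  by (simp add: narB_decomposition binom_sum_def)

lemma Z_whirl: "Z_poly (whirl_matroid n) = narB n"
proof -
  let ?W = "whirl_matroid n"
  define f where "f F = cyc_weight whirl_kl (word F)" for F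
  have rkW: "rk ?W = n"
    using rim_not_indep rank_whirl[of E] rank_E rank_rim n_pos by (auto simp: rk_def)
  have rank: "rank_of ?W F = rank_of M F" if "F \<in> flats ?W" for F
    using that rank_whirl triangle_closed_subset by (simp add: flats_whirl)
  have corank: "rk ?W - rank_of ?W F = blocks (word F)" if "F \<in> flats ?W" for F
    using that rank_blocks rank by (simp add: rkW flats_whirl)
  have Z: "upper_Z ?W f F = cyc_sum whirl_kl (word F)" if F: "F \<in> flats ?W" for F
  proof -
    have "upper_Z ?W f F = (\<Sum>G\<in>{G\<in>flats ?W. F \<subseteq> G}. monom 1 (blocks (word F) - blocks (word G)) * cyc_weight whirl_kl (word G))"
      unfolding upper_Z_def f_def
      using F rank_diff_blocks rank by (intro sum.cong) (auto simp: flats_whirl)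
    \<comment> \<open>The rim joins the range of summation with weight \<open>whirl_kl 0\<close>,
      which is 0.\<close>
    also have "\<dots> = (\<Sum>G\<in>{G. triangle_closed G \<and> F \<subseteq> G}. monom 1 (blocks (word F) - blocks (word G)) * cyc_weight whirl_kl (word G))"
      by (intro sum.mono_neutral_left finite_triangle_closed)
         (auto simp: flats_whirl cyc_weight_rim kl_low)
    also have "\<dots> = cyc_sum whirl_kl (word F)"
      using F by (intro sum_cyc) (simp add: flats_whirl)
    finally show ?thesis .
  qed
  have no_hub: "0 < blocks (word F) \<and> cyc_sum whirl_kl (word F) = narB (blocks (word F))"
    if "F \<in> flats ?W" "Hub \<notin> set (word F)" for F
  proof -
    have "0 < blocks (word F)"
      using that blocks_pos triangle_closed_subset by (simp add: flats_whirl)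
    then show ?thesis
      using cyc_sum_no_hub[OF set_word_no_hub[OF that(2)]] binom_sum_whirl[of "blocks (word F)"] by simp
  qed
  have "Z_poly ?W = upper_Z ?W f {}"
  proof (rule Z_poly_eqI[OF is_matroid_whirl loopless_whirl])
    show "f (ground ?W) = 1" by (simp add: f_def cyc_weight_E)
    show "2 * degree (f F) < rk ?W - rank_of ?W F" if F: "F \<in> flats ?W" "F \<noteq> ground ?W" for F
    proof -
      have "rank_of ?W F < rank_of ?W E"
        using F by (intro rank_of_flat_less[OF is_matroid_whirl]) (auto simp: flats_def)
      then have "rank_of ?W F < rk ?W" by (simp add: rk_def)
      then have pos: "0 < blocks (word F)" using corank[OF F(1)] by simp
      show ?thesis
        unfolding corank[OF F(1)] f_def
        using pos kl_bound_cyc_weight[of "word F" whirl_kl] degree_whirl_kl[OF pos]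
        by (cases "Hub \<in> set (word F)") (auto simp: kl_bound_def cyc_weight_def)
    qed
    show "palindromic (rk ?W - rank_of ?W F) (upper_Z ?W f F)" if F: "F \<in> flats ?W" for F
      unfolding corank[OF F] Z[OF F]
      using palindromic_cyc_sum_Hub[OF _ Bar_notin_word] no_hub[OF F] palindromic_narB
      by (cases "Hub \<in> set (word F)") auto
  qed
  moreover have e: "{} \<in> flats ?W" by (rule loopless_empty_flat[OF is_matroid_whirl loopless_whirl])
  moreover have "Hub \<notin> set (word {})" by (simp add: word_empty)
  ultimately show ?thesis using Z[OF e] no_hub[OF e] by (simp add: word_empty)
qed

lemma flats_wheel: "F \<in> flats M \<longleftrightarrow> triangle_closed F \<and> \<not> (Hub \<notin> set (word F) \<and> blocks (word F) = 1)"
  using flat_imp[of F] flatI[of F] gapless_iff[of F] by blast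

text \<open>One spoke spreads along the complete rim to all spokes.\<close>

lemma rim_subset_iff:
  assumes "F \<in> flats M"
  shows "rim n \<subseteq> F \<longleftrightarrow> F = rim n \<or> F = E"
proof
  assume r: "rim n \<subseteq> F"
  have F: "triangle_closed F" "F \<subseteq> E" using assms flat_imp triangle_closed_subset by blast+
  show "F = rim n \<or> F = E"
  proof (cases "F \<subseteq> rim n")
    case True
    then show ?thesis using r by blast
  next
    case False
    then obtain j where j: "j < n" "spoke j \<in> F" using subset_rim_iff[OF F(2)] by blast
    have "spoke i \<in> F" if "i < n" for i
    proof (rule cyclic_induct[where P = "\<lambda>i. spoke i \<in> F", OF j _ that])
      fix i assume i: "i < n" "i \<noteq> j" "spoke (prev n i) \<in> F"
      have "re i \<in> F" using r re_in_rim[OF i(1)] by blast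
      then show "spoke i \<in> F" using triangle_closed_spoke_iff[OF F(1), of i] i by simp
    qed
    then have "E \<subseteq> F" using r by (auto simp: E_def rim_eq)
    then show ?thesis using F(2) by blast
  qed
qed (use rim_subset in auto)

lemma Z_wheel: "Z_graph (wheel_graph n) = wheel_Z n"
proof -
  \<comment> \<open>\<open>h\<close> vanishes at 0 and 1, which silences the rim and the sets "rim
    minus one edge" in sums over triangle-closed sets. The rim, whose corank 1 is not the block
    count of its word, gets the value 1 from f and is added separately.\<close>
  define h where "h k = (if 2 \<le> k then wheel_kl k else 0)" for k
  define f where "f F = (if F = rim n then 1 else cyc_weight h (word F))" for F
  have word_rim: "Hub \<notin> set (word (rim n))" by (simp add: Hub_in_word)
  have corank: "rk M - rank_of M F = blocks (word F)" if "F \<in> flats M" "F \<noteq> rim n" for F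
    using that rank_blocks by (simp add: rk_M flats_wheel)
  have fE: "f E = 1"
    using spoke_in_E[OF n_pos] spoke_notin_rim by (auto simp: f_def cyc_weight_E)
  have Z: "upper_Z M f F = cyc_sum h (word F) + (if F \<subseteq> rim n then monom 1 (blocks (word F) - 1) else 0)"
    if F: "F \<in> flats M" "F \<noteq> rim n" for F
  proof -
    let ?A = "{G\<in>flats M. F \<subseteq> G} - {rim n}"
    have fin: "finite ?A" using finite_flats[OF is_matroid] by simp
    have "upper_Z M f F = (\<Sum>G\<in>?A. monom 1 (rank_of M G - rank_of M F) * f G) +
        (if F \<subseteq> rim n then monom 1 (rank_of M (rim n) - rank_of M F) else 0)"
    proof (cases "F \<subseteq> rim n")
      case True
      then have "{G\<in>flats M. F \<subseteq> G} = insert (rim n) ?A" using rim_flat by auto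
      then have "upper_Z M f F = (\<Sum>G\<in>insert (rim n) ?A. monom 1 (rank_of M G - rank_of M F) * f G)"
        unfolding upper_Z_def by (rule arg_cong)
      also have "\<dots> = monom 1 (rank_of M (rim n) - rank_of M F) * f (rim n) +
          (\<Sum>G\<in>?A. monom 1 (rank_of M G - rank_of M F) * f G)"
        using fin by (rule sum.insert) simp
      finally show ?thesis using True by (simp add: f_def add.commute)
    next
      case False
      then have "{G\<in>flats M. F \<subseteq> G} = ?A" by auto
      then show ?thesis using False unfolding upper_Z_def by simp
    qed
    also have "(\<Sum>G\<in>?A. monom 1 (rank_of M G - rank_of M F) * f G) =
        (\<Sum>G\<in>?A. monom 1 (blocks (word F) - blocks (word G)) * cyc_weight h (word G))"
      unfolding f_def using F rank_diff_blocks by (intro sum.cong) (auto simp: flats_wheel)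
    also have "\<dots> = (\<Sum>G\<in>{G. triangle_closed G \<and> F \<subseteq> G}. monom 1 (blocks (word F) - blocks (word G)) * cyc_weight h (word G))"
    proof (intro sum.mono_neutral_left finite_triangle_closed ballI)
      show "?A \<subseteq> {G. triangle_closed G \<and> F \<subseteq> G}" by (auto simp: flats_wheel)
      fix G assume "G \<in> {G. triangle_closed G \<and> F \<subseteq> G} - ?A"
      then have "G = rim n \<or> Hub \<notin> set (word G) \<and> blocks (word G) = 1"
        unfolding flats_wheel by blast
      then have "cyc_weight h (word G) = 0"
        using cyc_weight_rim[of h] by (elim disjE) (simp_all add: h_def cyc_weight_def)
      then show "monom 1 (blocks (word F) - blocks (word G)) * cyc_weight h (word G) = 0" by simp
    qed
    also have "\<dots> = cyc_sum h (word F)"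
      using F by (intro sum_cyc) (simp add: flats_wheel)
    also have "rank_of M (rim n) - rank_of M F = blocks (word F) - 1"
      using corank[OF F] by (simp add: rank_rim rk_M)
    finally show ?thesis .
  qed
  have Z_rim: "upper_Z M f (rim n) = [:1, 1:]"
  proof -
    have "E \<noteq> rim n" using spoke_in_E[OF n_pos] spoke_notin_rim by metis
    moreover have "{G\<in>flats M. rim n \<subseteq> G} = {rim n, E}"
      using rim_subset_iff rim_flat ground_in_flats[of M] rim_subset by auto
    moreover have "n - (n - 1) = 1" using n_pos by simp
    ultimately show ?thesis
      by (simp add: upper_Z_def fE rank_E rank_rim monom_Suc monom_0 one_pCons) (simp add: f_def one_pCons)
  qed
  have no_hub: "2 \<le> blocks (word F) \<and> upper_Z M f F = wheel_Z (blocks (word F))"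
    if F: "F \<in> flats M" "F \<noteq> rim n" "Hub \<notin> set (word F)" for F
  proof -
    have FE: "F \<subseteq> E" using F(1) by (simp add: flats_def)
    have sub: "F \<subseteq> rim n" using subset_rim_iff[OF FE] F(3) by (simp add: Hub_in_word)
    have "0 < blocks (word F)" by (rule blocks_pos[OF FE F(2,3)])
    moreover have "blocks (word F) \<noteq> 1" using F by (simp add: flats_wheel)
    ultimately have m: "2 \<le> blocks (word F)" by linarith
    have "binom_sum h m 0 = (\<Sum>k\<in>{2..m}. of_nat (m choose k) * monom 1 (m - k) * wheel_kl k)" for m
      unfolding binom_sum_def
      by (rule sum.mono_neutral_cong_right) (auto simp: h_def)
    then have "wheel_Z (blocks (word F)) =
        binom_sum h (blocks (word F)) 0 + monom 1 (blocks (word F) - 1) + fps_nth hub_part (blocks (word F))"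
      using wheel_Z_decomposition[OF m] by simp
    then show ?thesis
      using m Z[OF F(1,2)] sub cyc_sum_no_hub[OF set_word_no_hub[OF F(3)], of h] by simp
  qed
  have "Z_poly M = upper_Z M f {}"
  proof (rule Z_poly_eqI[OF is_matroid loopless_M])
    show "f (ground M) = 1" by (simp add: fE)
    show "2 * degree (f F) < rk M - rank_of M F" if F: "F \<in> flats M" "F \<noteq> ground M" for F
    proof (cases "F = rim n")
      case True
      then show ?thesis using n_pos by (simp add: f_def rk_M rank_rim)
    next
      case False
      have "rank_of M F < rank_of M E"
        using F by (intro rank_of_flat_less[OF is_matroid]) (auto simp: flats_def)
      then have pos: "0 < blocks (word F)" using corank[OF F(1) False] by (simp add: rk_M rank_E)
      show ?thesis
      proof (cases "Hub \<in> set (word F)")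
        case True
        then show ?thesis
          unfolding corank[OF F(1) False]
          using pos kl_bound_cyc_weight[OF True, of h] False by (simp add: f_def kl_bound_def)
      next
        case no: False
        then show ?thesis
          unfolding corank[OF F(1) False]
          using no_hub[OF F(1) False no] degree_wheel_kl[OF pos] False
          by (simp add: f_def cyc_weight_def h_def)
      qed
    qed
    show "palindromic (rk M - rank_of M F) (upper_Z M f F)" if F: "F \<in> flats M" for F
    proof (cases "F = rim n")
      case True
      then show ?thesis
        unfolding True Z_rim using n_pos
        by (auto simp: palindromic_def rk_M rank_rim coeff_pCons split: nat.splits)
    next
      case False
      show ?thesis
      proof (cases "Hub \<in> set (word F)")
        case True
        have "\<not> F \<subseteq> rim n" using True by (auto simp: Hub_in_word)
        then show ?thesis
          unfolding corank[OF F False] Z[OF F False]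
          using palindromic_cyc_sum_Hub[OF True Bar_notin_word] by simp
      next
        case no: False
        then show ?thesis
          unfolding corank[OF F False]
          using no_hub[OF F False no] palindromic_wheel_Z by simp
      qed
    qed
  qed
  moreover have e: "{} \<in> flats M" by (rule loopless_empty_flat[OF is_matroid loopless_M])
  moreover have "Hub \<notin> set (word {})" by (simp add: word_empty)
  moreover have "{} \<noteq> rim n" using re_in_rim[OF n_pos] by blast
  ultimately show ?thesis using no_hub[OF e] by (simp add: Z_graph_def M_eq word_empty)
qed

end

subsection \<open>Coefficients\<close>

lemma coeff_nar_rat:
  assumes "k \<le> n"
  shows "rat_of_int (coeff (nar n) k) = of_nat ((n + 1) choose (k + 1)) * of_nat ((n + 1) choose k) / of_nat (n + 1)"
proof -
  have "rat_of_int (int (n + 1) * coeff (nar n) k) = rat_of_int (int ((n + 1) choose (k + 1)) * int ((n + 1) choose k))"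
    using coeff_nar[OF assms] by simp
  then have "of_nat (n + 1) * rat_of_int (coeff (nar n) k) = of_nat ((n + 1) choose (k + 1)) * of_nat ((n + 1) choose k)"
    by (simp only: of_int_mult of_int_of_nat_eq)
  moreover have "rat_of_nat (n + 1) \<noteq> 0" by (simp only: of_nat_eq_0_iff)
  ultimately show ?thesis by (metis nonzero_mult_div_cancel_left)
qed

lemma poly_eq_sum_monom:
  assumes "degree p \<le> n" "\<And>k. k \<le> n \<Longrightarrow> rat_of_int (coeff p k) = c k"
  shows "map_poly rat_of_int p = (\<Sum>k=0..n. monom (c k) k)"
proof (rule poly_eqI)
  fix i
  have "coeff (\<Sum>k=0..n. monom (c k) k) i = (if i \<le> n then c i else 0)"
    by (simp add: coeff_sum)
  then show "coeff (map_poly rat_of_int p) i = coeff (\<Sum>k=0..n. monom (c k) k) i"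
    using assms coeff_eq_0[of p i] by (auto simp: coeff_map_poly)
qed

lemma binom_of_nat [simp]: "binom n (int k) = of_nat (n choose k)"
  by (simp add: binom_def)

lemma binom_succ: "binom n (int k + 1) = of_nat (n choose (k + 1))"
  by (simp add: binom_def nat_add_distrib)

lemma binom_pred: "binom n (int k - 1) = (if k = 0 then 0 else of_nat (n choose (k - 1)))"
  by (auto simp: binom_def nat_diff_distrib)

lemma coeff_wheel_Z:
  assumes n: "1 \<le> n" and k: "k \<le> n"
  shows "rat_of_int (coeff (wheel_Z n) k) =
    (of_nat (n choose k))\<^sup>2 - 2 / of_nat n * binom n (int k + 1) * binom n (int k - 1)"
proof -
  obtain m where m: "n = Suc m" using n by (cases n) auto
  have low: "coeff (wheel_Z n) 0 = 1"
  proof -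
    have "int (n + 1) * coeff (nar n) 0 = int (n + 1) * 1" using coeff_nar[of 0 n] by simp
    moreover have "int (m + 1) * coeff (nar m) 0 = int (m + 1) * 1" using coeff_nar[of 0 m] by simp
    ultimately show ?thesis using coeff_narB[of 0 n] by (simp add: wheel_Z_def m)
  qed
  consider "k = 0" | "k = n" | "0 < k" "k < n" using k by linarith
  then show ?thesis
  proof cases
    case 1
    then show ?thesis using low by (simp add: binom_def)
  next
    case 2
    \<comment> \<open>At k = n the index k exceeds n - 1, where \<open>coeff_nar\<close> gives
      nothing; palindromicity carries over the value at 0.\<close>
    then have "coeff (wheel_Z n) k = coeff (wheel_Z n) 0"
      using palindromic_wheel_Z[OF n] by (auto simp: palindromic_def)
    then show ?thesis using low 2 by (simp add: binom_succ binomial_eq_0)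
  next
    case 3
    then obtain j where j: "k = Suc j" by (cases k) auto
    \<comment> \<open>In terms of A, x = k and d = n - k the neighbouring binomial coefficients are
      A d/(x + 1) and A x/(d + 1), so the claim becomes an identity of rational functions.\<close>
    define A where "A = rat_of_nat (n choose k)"
    define x where "x = rat_of_nat k"
    define d where "d = rat_of_nat (n - k)"
    have pos: "x > 0" "d > 0" "x + 1 \<noteq> 0" "d + 1 \<noteq> 0" "x + d \<noteq> 0" "x + d + 1 \<noteq> 0"
      using 3 by (auto simp: x_def d_def)
    have nx: "rat_of_nat n = x + d" using k by (simp add: x_def d_def of_nat_diff)
    have up: "rat_of_nat (n choose (k + 1)) = A * d / (x + 1)"
    proof -
      have "Suc k * (n choose Suc k) = (n - k) * (n choose k)"
        using binomial_absorption[of k n] binomial_absorb_comp[of n k] by simp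
      then have "rat_of_nat (Suc k) * rat_of_nat (n choose Suc k) = d * A"
        unfolding A_def d_def by (metis of_nat_mult)
      then show ?thesis using pos by (simp add: x_def field_simps)
    qed
    have down: "rat_of_nat (n choose j) = A * x / (d + 1)"
    proof -
      have "Suc j * (n choose Suc j) = (n - j) * (n choose j)"
        using binomial_absorption[of j n] binomial_absorb_comp[of n j] by simp
      moreover have "n - j = Suc (n - k)" using 3 j by simp
      ultimately have "x * A = rat_of_nat (Suc (n - k)) * rat_of_nat (n choose j)"
        unfolding A_def x_def j by (metis of_nat_mult)
      then show ?thesis using pos by (simp add: d_def field_simps)
    qed
    have N1: "rat_of_int (coeff (nar n) k) = (A + A * d / (x + 1)) * (A * x / (d + 1) + A) / (x + d + 1)"
      using coeff_nar_rat[OF k] up down nx by (simp add: j A_def add_ac)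
    have N2: "rat_of_int (coeff (nar m) k) = A * d / (x + 1) * A / (x + d)"
      using coeff_nar_rat[of k m] 3 up nx by (simp add: m A_def)
    have N3: "rat_of_int (coeff (nar m) j) = A * (A * x / (d + 1)) / (x + d)"
      using coeff_nar_rat[of j m] 3 down nx by (simp add: m j A_def)
    have "rat_of_int (coeff (wheel_Z n) k) = A\<^sup>2 - rat_of_int (coeff (nar n) k)
        + (rat_of_int (coeff (nar m) k) + rat_of_int (coeff (nar m) j))"
      using coeff_narB[OF k] by (simp add: wheel_Z_def m j A_def coeff_pCons)
    also have "\<dots> = A\<^sup>2 - 2 / (x + d) * (A * d / (x + 1)) * (A * x / (d + 1))"
    proof -
      have 1: "(A + A * d / (x + 1)) * (A * x / (d + 1) + A) / (x + d + 1) = A\<^sup>2 * (x + d + 1) / ((x + 1) * (d + 1))"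
      proof -
        have "A + A * d / (x + 1) = A * (x + d + 1) / (x + 1)" "A * x / (d + 1) + A = A * (x + d + 1) / (d + 1)"
          using pos by (simp_all add: field_simps)
        then show ?thesis using pos by (simp add: power2_eq_square)
      qed
      have frac: "A\<^sup>2 * (s + 1) / (u * v) - (A * d / u * A / s + A * (A * x / v) / s) = A\<^sup>2 * (s * (s + 1) - d * v - x * u) / (s * u * v)"
        if "u \<noteq> 0" "v \<noteq> 0" "s \<noteq> 0" for u v s
        using that by (simp add: field_simps power2_eq_square)
      \<comment> \<open>The numerator that remains when the three Narayana terms are brought over
        the common denominator.\<close>
      have num: "(x + d) * (x + d + 1) - d * (d + 1) - x * (x + 1) = 2 * (d * x)"
        by (simp add: algebra_simps)
      have "2 / (x + d) * (A * d / (x + 1)) * (A * x / (d + 1)) = A\<^sup>2 * (2 * (d * x)) / ((x + d) * (x + 1) * (d + 1))"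
        by (simp add: power2_eq_square mult_ac)
      then show ?thesis
        unfolding N1 N2 N3 1 using frac[OF pos(3,4,5)] unfolding num by linarith
    qed
    also have "A * d / (x + 1) = binom n (int k + 1)"
      by (simp only: binom_succ up)
    also have "A * x / (d + 1) = binom n (int k - 1)"
      unfolding down[symmetric] by (simp add: binom_pred j)
    finally show ?thesis by (simp only: A_def nx)
  qed
qed

theorem theorem1p6:
  shows "(\<forall>n\<ge>1. map_poly rat_of_int (Z_graph (fan_graph n)) =
            (\<Sum>k=0..n. monom (1 / of_nat (n + 1) * binom (n + 1) (int k + 1) * binom (n + 1) (int k)) k))
       \<and> (\<forall>n\<ge>3. map_poly rat_of_int (Z_graph (wheel_graph n)) =
            (\<Sum>k=0..n. monom ((binom n (int k))\<^sup>2
                              - 2 / of_nat n * binom n (int k + 1) * binom n (int k - 1)) k))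
       \<and> (\<forall>n\<ge>3. map_poly rat_of_int (Z_poly (whirl_matroid n)) =
            (\<Sum>k=0..n. monom ((binom n (int k))\<^sup>2) k))"
proof (intro conjI allI impI)
  fix n :: nat
  show "map_poly rat_of_int (Z_graph (fan_graph n)) =
      (\<Sum>k=0..n. monom (1 / of_nat (n + 1) * binom (n + 1) (int k + 1) * binom (n + 1) (int k)) k)"
    if "1 \<le> n"
    unfolding Z_fan[OF that]
    using palindromic_nar[of n] coeff_nar_rat[of _ n]
    by (intro poly_eq_sum_monom) (simp_all add: palindromic_def binom_succ)
  show "map_poly rat_of_int (Z_graph (wheel_graph n)) =
      (\<Sum>k=0..n. monom ((binom n (int k))\<^sup>2
                        - 2 / of_nat n * binom n (int k + 1) * binom n (int k - 1)) k)"
    if "3 \<le> n"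
  proof -
    interpret wheel n using that by unfold_locales
    show ?thesis
      unfolding Z_wheel using palindromic_wheel_Z[of n] coeff_wheel_Z[of n] that
      by (intro poly_eq_sum_monom) (simp_all add: palindromic_def)
  qed
  show "map_poly rat_of_int (Z_poly (whirl_matroid n)) = (\<Sum>k=0..n. monom ((binom n (int k))\<^sup>2) k)"
    if "3 \<le> n"
  proof -
    interpret wheel n using that by unfold_locales
    show ?thesis
      unfolding Z_whirl using palindromic_narB[of n] coeff_narB[of _ n]
      by (intro poly_eq_sum_monom) (simp_all add: palindromic_def)
  qed
qed

end
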